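(* For $w\in B_n$, the closed interval $[e,w]$ in the absolute order $\mathrm{Abs}(B_n)$ is a lattice if and only if $\mu(w)$ is a hook partition, where $\mu(w)$ is the integer partition whose parts are the absolute lengths of all balanced cycles of $w$, arranged in decreasing order.
   Context: Hyperoctahedral group: $B_n$ is the group of permutations $w$ of $\{\pm1,\dots,\pm n\}$ with $w(-i)=-w(i)$ for all $i$; $e$ is the identity. For $a_1,\dots,a_k\in\{\pm1,\dots,\pm n\}$ with pairwise distinct absolute values, the paired $k$-cycle $(\!(a_1,\dots,a_k)\!)$ is the permutation with cycle form $(a_1\,a_2\cdots a_k)(-a_1\,-a_2\cdots -a_k)$, and the balanced $k$-cycle $[a_1,\dots,a_k]$ is the permutation with cycle form $(a_1\,a_2\cdots a_k\,-a_1\,-a_2\cdots -a_k)$. Every $w\in B_n$ is a product of disjoint paired or balanced cycles, called the cycles of $w$. The reflections of $B_n$ are $\mathcal{T}=\{[i]:1\le i\le n\}\cup\{(\!(i,j)\!),(\!(i,-j)\!):1\le i<j\le n\}$. Absolute order: the absolute length $\ell_{\mathcal T}(w)$ is the least $k$ such that $w$ is a product of $k$ elements of $\mathcal T$; $\mathrm{Abs}(B_n)$ is the partial order on $B_n$ given by $u\preceq v$ iff $\ell_{\mathcal T}(u)+\ell_{\mathcal T}(u^{-1}v)=\ell_{\mathcal T}(v)$. The interval $[e,w]$ is $\{z\in B_n: e\preceq z\preceq w\}$ with the induced order. A balanced $k$-cycle has absolute length $k$; for example, $w=[1,-5][2,7][6](\!(3,4)\!)\in B_8$ has $\mu(w)=(2,2,1)$.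 A hook partition is an integer partition of the form $\mu=(k,1,\dots,1)$, also written $\mu=(k,1^r)$, where $r$ is one less than the total number of parts of $\mu$.
   Formalization: The empty partition (the case where w has no balanced cycles, such as w = e) is counted as a hook partition; otherwise the equivalence fails for w = e, where [e,e] is a one-point lattice. *)

theory Defs
  imports "HOL-Combinatorics.Cycles" "HOL-Library.Multiset" "HOL-Algebra.Lattice"
begin

definition signed_points :: "nat \<Rightarrow> int set" where
  "signed_points n = {i. i \<noteq> 0 \<and> \<bar>i\<bar> \<le> int n}"

(* Elements are total functions on int, fixing 0 and every i with |i| > n
   (this is part of "permutes"); equality of group elements is equality of functions. *)
definition hyperoctahedral :: "nat \<Rightarrow> (int \<Rightarrow> int) set" where
  "hyperoctahedral n =
     {w. w permutes signed_points n \<and> (\<forall>i\<in>signed_points n. w (- i) = - w i)}"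

(* ((a_1, ..., a_k)) and [a_1, ..., a_k]; meaningful only when the a_i are nonzero
   with pairwise distinct absolute values. *)
definition paired_cycle :: "int list \<Rightarrow> int \<Rightarrow> int" where
  "paired_cycle as = cycle_of_list as \<circ> cycle_of_list (map uminus as)"

definition balanced_cycle :: "int list \<Rightarrow> int \<Rightarrow> int" where
  "balanced_cycle as = cycle_of_list (as @ map uminus as)"

definition product :: "(int \<Rightarrow> int) list \<Rightarrow> int \<Rightarrow> int" where
  "product ts = foldr (\<circ>) ts id"

definition reflections :: "nat \<Rightarrow> (int \<Rightarrow> int) set" where
  "reflections n =
     {balanced_cycle [i] | i. 1 \<le> i \<and> i \<le> int n} \<union>
     {paired_cycle [i, j] | i j. 1 \<le> i \<and> i < j \<and> j \<le> int n} \<union>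
     {paired_cycle [i, - j] | i j. 1 \<le> i \<and> i < j \<and> j \<le> int n}"

definition abs_length :: "nat \<Rightarrow> (int \<Rightarrow> int) \<Rightarrow> nat" where
  "abs_length n w =
     (LEAST k. \<exists>ts. length ts = k \<and> set ts \<subseteq> reflections n \<and> product ts = w)"

(* To be used on hyperoctahedral n only. *)
definition abs_le :: "nat \<Rightarrow> (int \<Rightarrow> int) \<Rightarrow> (int \<Rightarrow> int) \<Rightarrow> bool" where
  "abs_le n u v \<longleftrightarrow> abs_length n u + abs_length n (inv u \<circ> v) = abs_length n v"

definition abs_interval :: "nat \<Rightarrow> (int \<Rightarrow> int) \<Rightarrow> (int \<Rightarrow> int) set" where
  "abs_interval n w = {z \<in> hyperoctahedral n. abs_le n id z \<and> abs_le n z w}"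

definition interval_poset :: "nat \<Rightarrow> (int \<Rightarrow> int) \<Rightarrow> (int \<Rightarrow> int) gorder" where
  "interval_poset n w = \<lparr>carrier = abs_interval n w, eq = (=), le = abs_le n\<rparr>"

(* w is the product of the pairwise disjoint balanced cycles listed in bs and paired cycles
   listed in ps.  Paired 1-cycles (fixed points) may be listed or omitted. *)
definition cycle_decomposition ::
    "nat \<Rightarrow> (int \<Rightarrow> int) \<Rightarrow> int list list \<Rightarrow> int list list \<Rightarrow> bool" where
  "cycle_decomposition n w bs ps \<longleftrightarrow>
     [] \<notin> set (bs @ ps) \<and>
     set (concat (bs @ ps)) \<subseteq> signed_points n \<and>
     distinct (map abs (concat (bs @ ps))) \<and>
     w = product (map balanced_cycle bs @ map paired_cycle ps)"

definition balanced_cycles :: "nat \<Rightarrow> (int \<Rightarrow> int) \<Rightarrow> (int \<Rightarrow> int) set" where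
  "balanced_cycles n w =
     {balanced_cycle b | b. \<exists>bs ps. cycle_decomposition n w bs ps \<and> b \<in> set bs}"

lemma finite_balanced_cycles: "finite (balanced_cycles n w)"
proof (rule finite_subset)
  have "signed_points n \<subseteq> {- int n..int n}"
    by (auto simp: signed_points_def)
  then have "finite (signed_points n)"
    by (rule finite_subset) simp
  then show "finite {p. p permutes signed_points n}"
    by (rule finite_permutations)
  show "balanced_cycles n w \<subseteq> {p. p permutes signed_points n}"
  proof
    fix c assume "c \<in> balanced_cycles n w"
    then obtain b bs ps where c: "c = balanced_cycle b" "b \<in> set bs"
      and d: "cycle_decomposition n w bs ps"
      by (auto simp: balanced_cycles_def)
    have "set b \<subseteq> signed_points n"
      using c d by (auto simp: cycle_decomposition_def)
    then have "set (b @ map uminus b) \<subseteq> signed_points n"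
      by (auto simp: signed_points_def)
    then show "c \<in> {p. p permutes signed_points n}"
      unfolding c(1) balanced_cycle_def mem_Collect_eq
      by (rule permutes_subset[OF cycle_permutes])
  qed
qed

(* Partitions are weakly decreasing lists of their parts, repetitions included. *)
definition mu :: "nat \<Rightarrow> (int \<Rightarrow> int) \<Rightarrow> nat list" where
  "mu n w = rev (sorted_list_of_multiset
     (image_mset (abs_length n) (mset_set (balanced_cycles n w))))"

(* The empty partition (w without balanced cycles) counts as a hook partition, since
   [e, w] is a lattice in that case, e.g. for w = e. *)
definition hook_partition :: "nat list \<Rightarrow> bool" where
  "hook_partition p \<longleftrightarrow> p = [] \<or> (\<exists>k r. k \<ge> 1 \<and> p = k # replicate r 1)"

end

theory Submission
  imports Complex_Main Defs "HOL-Library.Function_Algebras"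
begin

text \<open>
  Let \<open>B\<^sub>n\<close> act on odd functions on the signed points. The absolute length of \<open>w\<close> is the
  codimension of its fixed space \<open>Fix w\<close>, lengths add in \<open>u \<circ> v\<close> iff \<open>Fix u + Fix v\<close> is everything,
  and on an interval \<open>[e, w]\<close> the order is reverse inclusion of fixed spaces. Since \<open>[z, w]\<close> is
  isomorphic to \<open>[e, inv z \<circ> w]\<close> and the hook property passes to \<open>inv z \<circ> w\<close> (by means of the Wall form),
  the lattice property reduces to the existence of joins of two reflections \<open>s\<close>, \<open>t\<close> below a
  hook element. If \<open>st\<close> or \<open>ts\<close> is below \<open>w\<close>, it is the join. Otherwise every upper bound has the
  supports of \<open>s\<close> and \<open>t\<close> either inside its balanced cycles or as crossing chords of one paired
  cycle; in the first case the restriction of \<open>w\<close> to the supports is the join, in the second the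
  paired 4-cycle through the chords is, unless two such 4-cycles with different signs occur, and
  then the Wall form of \<open>w\<close> shows that \<open>w\<close> has two balanced cycles of length at least 2. Conversely,
  two such cycles yield an element \<open>[a, b][c, d]\<close> below \<open>w\<close>, below which \<open>((a, c))\<close> and \<open>((b, d))\<close> have
  two incompatible upper bounds.
\<close>

section \<open>Signed permutations and reflections\<close>

text \<open>The condition \<open>Fix u + Fix v\<close> = everything only gets easier when the fixed
  spaces grow, unlike the length equation; most order arguments below produce such growth. The
  obstacle is heredity of the hook property: the cycle types of \<open>z\<close> and
  \<open>w\<close> do not determine that of \<open>inv z \<circ> w\<close>. The Wall form supplies
  what cycle types lack. Between two balanced points its entry is nonzero exactly when they share a
  cycle, and a right factor has the same entries as the whole product at its own balanced points. So
  balanced cycles of length at least 2 in the factor lie in such cycles of \<open>w\<close>, hence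
  in a single one, and the nonzero entries between their points show that they were a single cycle
  in the factor as well. The same entries decide the sign conflict of two 4-cycles: it becomes a
  small linear system, whose only solution for a hook element makes the product of the two
  reflections lie below \<open>w\<close>, the case treated before.\<close>

text \<open>All reflections at once: \<open>((a, b))\<close> for \<open>b \<noteq> -a\<close>, and \<open>[a]\<close> for \<open>b = -a\<close>.\<close>

definition sswap :: "int \<Rightarrow> int \<Rightarrow> int \<Rightarrow> int" where
  "sswap a b x = (if x = a then b else if x = b then a
     else if x = - a then - b else if x = - b then - a else x)"

locale signed_permutations =
  fixes n :: nat
begin

abbreviation X where "X \<equiv> signed_points n"
abbreviation G where "G \<equiv> hyperoctahedral n"
abbreviation len where "len \<equiv> abs_length n"

lemma finite_signed_points: "finite X"
proof (rule finite_subset)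
  show "X \<subseteq> {- int n..int n}"
    by (auto simp: signed_points_def)
qed simp

lemma uminus_signed_points [simp]: "- a \<in> X \<longleftrightarrow> a \<in> X"
  by (auto simp: signed_points_def)

lemma nonzero_signed_points: "a \<in> X \<Longrightarrow> a \<noteq> 0"
  by (auto simp: signed_points_def)

lemma hyperoctahedral_iff:
  "w \<in> G \<longleftrightarrow> bij w \<and> (\<forall>x. x \<notin> X \<longrightarrow> w x = x) \<and> (\<forall>x. w (- x) = - w x)"
proof
  assume "w \<in> G"
  then have w: "w permutes X" "\<And>x. x \<in> X \<Longrightarrow> w (- x) = - w x"
    by (auto simp: hyperoctahedral_def)
  have "w (- x) = - w x" for x
    using w by (cases "x \<in> X") (auto simp: permutes_def)
  with w(1) show "bij w \<and> (\<forall>x. x \<notin> X \<longrightarrow> w x = x) \<and> (\<forall>x. w (- x) = - w x)"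
    by (auto simp: permutes_bij permutes_def)
next
  assume "bij w \<and> (\<forall>x. x \<notin> X \<longrightarrow> w x = x) \<and> (\<forall>x. w (- x) = - w x)"
  then show "w \<in> G"
    by (auto simp: hyperoctahedral_def permutes_def bij_iff)
qed

lemma hyperoctahedralD:
  assumes "w \<in> G"
  shows "bij w" "inj w" "x \<notin> X \<Longrightarrow> w x = x" "w (- x) = - w x" "w permutes X"
    "w x \<in> X \<longleftrightarrow> x \<in> X" "w x = w y \<longleftrightarrow> x = y" "permutation w"
proof -
  show p: "w permutes X"
    using assms by (auto simp: hyperoctahedral_def)
  show "w x \<in> X \<longleftrightarrow> x \<in> X"
    by (rule permutes_in_image[OF p])
  show "permutation w"
    using p finite_signed_points by (auto simp: permutation_permutes)
  show "bij w" "inj w" "x \<notin> X \<Longrightarrow> w x = x" "w (- x) = - w x" "w x = w y \<longleftrightarrow> x = y"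
    using assms by (auto simp: hyperoctahedral_iff bij_def inj_eq)
qed

lemma id_hyperoctahedral [simp]: "id \<in> G"
  by (simp add: hyperoctahedral_iff)

lemma comp_hyperoctahedral [simp]: "u \<in> G \<Longrightarrow> v \<in> G \<Longrightarrow> u \<circ> v \<in> G"
  by (simp add: hyperoctahedral_iff bij_comp)

lemma inv_hyperoctahedral [simp]:
  assumes "u \<in> G"
  shows "inv u \<in> G"
proof -
  have "inv u (- x) = - inv u x" for x
    using hyperoctahedralD(1,4)[OF assms] by (metis bij_inv_eq_iff)
  moreover have "inv u x = x" if "x \<notin> X" for x
    using hyperoctahedralD[OF assms] that by (metis inv_f_eq)
  ultimately show ?thesis
    using hyperoctahedralD(1)[OF assms] by (simp add: hyperoctahedral_iff bij_imp_bij_inv)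
qed

lemma inv_comp_hyperoctahedral [simp]: 
  assumes "u \<in> G" 
  shows "inv u \<circ> u = id" "u \<circ> inv u = id" "inv u (u x) = x" "u (inv u x) = x" "inv (inv u) = u"
    "inv u \<circ> (u \<circ> v) = v" "u \<circ> (inv u \<circ> v) = v" "v \<circ> u \<circ> inv u = v" "v \<circ> inv u \<circ> u = v"
  using hyperoctahedralD(1)[OF assms] 
  by (auto simp: bij_def surj_iff inv_inv_eq surj_f_inv_f fun_eq_iff)

lemma sswap_involution [simp]: "a \<noteq> 0 \<Longrightarrow> b \<noteq> 0 \<Longrightarrow> sswap a b (sswap a b x) = x"
  by (auto simp: sswap_def)

lemma sswap_comp_sswap [simp]:
  assumes "a \<noteq> 0" "b \<noteq> 0"
  shows "sswap a b \<circ> sswap a b = id" "sswap a b \<circ> (sswap a b \<circ> v) = v" "v \<circ> sswap a b \<circ> sswap a b = v"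
  using assms by (auto simp: fun_eq_iff)

lemma sswap_sym: "a \<noteq> 0 \<Longrightarrow> b \<noteq> 0 \<Longrightarrow> sswap a b = sswap b a"
  by (auto simp: sswap_def fun_eq_iff)

lemma sswap_minus: "a \<noteq> 0 \<Longrightarrow> b \<noteq> 0 \<Longrightarrow> sswap (- a) (- b) = sswap a b"
  by (auto simp: sswap_def fun_eq_iff)

lemma sswap_fixes: "x \<noteq> a \<Longrightarrow> x \<noteq> b \<Longrightarrow> x \<noteq> - a \<Longrightarrow> x \<noteq> - b \<Longrightarrow> sswap a b x = x"
  by (simp add: sswap_def)

lemma sswap_eqs [simp]: "sswap a b a = b" "sswap a b b = a"
  by (simp_all add: sswap_def)

lemma sswap_hyperoctahedral [simp]:
  assumes "a \<in> X" "b \<in> X"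
  shows "sswap a b \<in> G"
proof -
  have nz: "a \<noteq> 0" "b \<noteq> 0"
    using assms nonzero_signed_points by auto
  have "bij (sswap a b)"
    using nz by (intro o_bij[of "sswap a b"]) auto
  moreover have "sswap a b x = x" if "x \<notin> X" for x
    using assms that by (intro sswap_fixes) auto
  moreover have "sswap a b (- x) = - sswap a b x" for x
    using nz by (auto simp: sswap_def)
  ultimately show ?thesis
    by (simp add: hyperoctahedral_iff)
qed

lemma balanced_singleton: "i \<noteq> 0 \<Longrightarrow> balanced_cycle [i] = sswap i (- i)"
  by (auto simp: balanced_cycle_def sswap_def fun_eq_iff transpose_def)

lemma paired_pair: "i \<noteq> 0 \<Longrightarrow> j \<noteq> 0 \<Longrightarrow> \<bar>i\<bar> \<noteq> \<bar>j\<bar> \<Longrightarrow> paired_cycle [i, j] = sswap i j"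
  by (auto simp: paired_cycle_def sswap_def fun_eq_iff transpose_def)

lemma reflections_eq: "reflections n = {sswap a b | a b. a \<in> X \<and> b \<in> X \<and> a \<noteq> b}" (is "_ = ?R")
proof (rule Set.set_eqI, rule iffI)
  fix t assume "t \<in> reflections n"
  then consider i where "1 \<le> i" "i \<le> int n" "t = balanced_cycle [i]"
    | i j where "1 \<le> i" "i < j" "j \<le> int n" "t = paired_cycle [i, j]"
    | i j where "1 \<le> i" "i < j" "j \<le> int n" "t = paired_cycle [i, - j]"
    unfolding reflections_def by blast
  then show "t \<in> ?R"
  proof cases
    case 1
    then show ?thesis 
      by (intro CollectI exI[of _ i] exI[of _ "- i"]) (auto simp: balanced_singleton signed_points_def)
  next
    case 2
    then show ?thesis 
      by (intro CollectI exI[of _ i] exI[of _ j]) (auto simp: paired_pair signed_points_def)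
  next
    case 3
    then show ?thesis 
      by (intro CollectI exI[of _ i] exI[of _ "- j"]) (auto simp: paired_pair signed_points_def)
  qed
next
  fix t assume "t \<in> ?R"
  then obtain a b where ab: "a \<in> X" "b \<in> X" "a \<noteq> b" "t = sswap a b"
    by blast
  have bal: "sswap a (- a) \<in> reflections n" if "a \<in> X" for a
  proof -
    have "sswap a (- a) = sswap \<bar>a\<bar> (- \<bar>a\<bar>)"
      by (cases "a > 0") (auto simp: sswap_def fun_eq_iff)
    also have "\<dots> = balanced_cycle [\<bar>a\<bar>]"
      using that by (simp add: balanced_singleton signed_points_def)
    finally show ?thesis
      using that unfolding reflections_def signed_points_def by force
  qed
  have pos: "sswap i b \<in> reflections n" if "0 < i" "i < \<bar>b\<bar>" "i \<in> X" "b \<in> X" for i b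
  proof (cases "b > 0")
    case True
    then have "sswap i b = paired_cycle [i, b]"
      using that by (simp add: paired_pair)
    then show ?thesis
      using that True unfolding reflections_def signed_points_def by force
  next
    case False
    define j where "j = - b"
    have "sswap i b = paired_cycle [i, - j]"
      using that by (subst paired_pair) (auto simp: j_def)
    moreover have "1 \<le> i" "i < j" "j \<le> int n"
      using that False by (auto simp: j_def signed_points_def)
    ultimately show ?thesis
      unfolding reflections_def by blast
  qed
  have less: "sswap a b \<in> reflections n" if "\<bar>a\<bar> < \<bar>b\<bar>" "a \<in> X" "b \<in> X" for a b
  proof (cases "a > 0")
    case True
    with that show ?thesis by (intro pos) auto
  next
    case False
    have "sswap (- a) (- b) \<in> reflections n"
      using False that nonzero_signed_points[of a] by (intro pos) auto
    then show ?thesis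
      using that nonzero_signed_points by (subst (asm) sswap_minus) auto
  qed
  consider "\<bar>a\<bar> < \<bar>b\<bar>" | "\<bar>b\<bar> < \<bar>a\<bar>" | "b = - a"
    using ab(3) by linarith
  then show "t \<in> reflections n"
  proof cases
    case 2
    then show ?thesis
      using less[OF 2] ab sswap_sym[of a b] nonzero_signed_points by auto
  qed (use ab bal less in auto)
qed

lemma reflection_hyperoctahedral: "t \<in> reflections n \<Longrightarrow> t \<in> G"
  by (auto simp: reflections_eq)

lemma sswap_reflection: "a \<in> X \<Longrightarrow> b \<in> X \<Longrightarrow> a \<noteq> b \<Longrightarrow> sswap a b \<in> reflections n"
  by (auto simp: reflections_eq)

section \<open>Words in reflections and the length function\<close>

lemma product_Nil [simp]: "product [] = id"
  and product_Cons [simp]: "product (t # ts) = t \<circ> product ts"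
  by (simp_all add: product_def)

lemma product_append [simp]: "product (ts @ us) = product ts \<circ> product us"
  by (induction ts) (simp_all add: comp_assoc)

lemma product_hyperoctahedral: "set ts \<subseteq> G \<Longrightarrow> product ts \<in> G"
  by (induction ts) auto

text \<open>For a moved point \<open>a\<close>, \<open>sswap a (w a) \<circ> w\<close> fixes
  \<open>a\<close> and every fixed point of \<open>w\<close>, so it moves fewer points.\<close>

lemma hyperoctahedral_factorization:
  "w \<in> G \<Longrightarrow> \<exists>ts. set ts \<subseteq> reflections n \<and> product ts = w"
proof (induction "card {x. w x \<noteq> x}" arbitrary: w rule: less_induct)
  case less
  note w = hyperoctahedralD[OF less.prems]
  show ?case
  proof (cases "w = id")
    case True
    then show ?thesis by (intro exI[of _ "[]"]) simp
  next
    case False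
    then obtain a where a: "w a \<noteq> a"
      by (auto simp: fun_eq_iff)
    have aX: "a \<in> X" "w a \<in> X"
      using a w by blast+
    let ?t = "sswap a (w a)"
    have nz: "a \<noteq> 0" "w a \<noteq> 0"
      using aX nonzero_signed_points by auto
    have sub: "{x. (?t \<circ> w) x \<noteq> x} \<subseteq> {x. w x \<noteq> x} - {a}"
    proof
      fix x assume x: "x \<in> {x. (?t \<circ> w) x \<noteq> x}"
      have "(?t \<circ> w) a = a" by simp
      moreover have "(?t \<circ> w) x = x" if "w x = x"
      proof -
        have "x \<noteq> a" "x \<noteq> - a" "x \<noteq> w a" "x \<noteq> - w a"
          using that a w(4)[of a] w(4)[of "w a"] w(7)
          by (metis add.inverse_inverse)+
        then have "?t x = x"
          by (intro sswap_fixes)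
        with that show ?thesis by simp
      qed
      ultimately show "x \<in> {x. w x \<noteq> x} - {a}"
        using x by auto
    qed
    have fin: "finite {x. w x \<noteq> x}"
      using w(3) by (intro finite_subset[OF _ finite_signed_points]) blast
    have "{x. (?t \<circ> w) x \<noteq> x} \<subset> {x. w x \<noteq> x}"
      using sub a by blast
    then have "card {x. (?t \<circ> w) x \<noteq> x} < card {x. w x \<noteq> x}"
      by (rule psubset_card_mono[OF fin])
    moreover have "?t \<circ> w \<in> G"
      using aX less.prems by simp
    ultimately obtain ts where ts: "set ts \<subseteq> reflections n" "product ts = ?t \<circ> w"
      using less.hyps by blast
    have "product (?t # ts) = w"
      using ts nz by simp
    moreover have "set (?t # ts) \<subseteq> reflections n"
      using ts sswap_reflection[of a "w a"] aX a by auto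
    ultimately show ?thesis by blast
  qed
qed

lemma abs_length_word:
  assumes "w \<in> G"
  obtains ts where "length ts = len w" "set ts \<subseteq> reflections n" "product ts = w"
proof -
  have "\<exists>k ts. length ts = k \<and> set ts \<subseteq> reflections n \<and> product ts = w"
    using hyperoctahedral_factorization[OF assms] by blast
  from LeastI_ex[OF this] show ?thesis
    using that unfolding abs_length_def by blast
qed

lemma abs_length_le:
  "set ts \<subseteq> reflections n \<Longrightarrow> product ts = w \<Longrightarrow> len w \<le> length ts"
  unfolding abs_length_def by (rule Least_le) blast

lemma abs_length_id [simp]: "len id = 0"
  using abs_length_le[of "[]"] by simp

lemma abs_length_0: "w \<in> G \<Longrightarrow> len w = 0 \<Longrightarrow> w = id"
  by (metis abs_length_word length_0_conv product_Nil)

lemma abs_length_comp: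
  assumes "u \<in> G" "v \<in> G"
  shows "len (u \<circ> v) \<le> len u + len v"
proof -
  obtain ts us where ts: "length ts = len u" "set ts \<subseteq> reflections n" "product ts = u"
    and us: "length us = len v" "set us \<subseteq> reflections n" "product us = v"
    using abs_length_word assms by metis
  have "len (u \<circ> v) \<le> length (ts @ us)"
    by (rule abs_length_le) (use ts us in auto)
  with ts us show ?thesis by simp
qed

lemma abs_length_sswap: "a \<in> X \<Longrightarrow> b \<in> X \<Longrightarrow> a \<noteq> b \<Longrightarrow> len (sswap a b) \<le> 1"
  using abs_length_le[of "[sswap a b]"] sswap_reflection by simp

lemma abs_length_step:
  assumes "w \<in> G" "w \<noteq> id"
  obtains a b v where "a \<in> X" "b \<in> X" "a \<noteq> b" "v \<in> G" "w = sswap a b \<circ> v" "len w = Suc (len v)"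
proof -
  obtain ts where ts: "length ts = len w" "set ts \<subseteq> reflections n" "product ts = w"
    using abs_length_word assms(1) by metis
  with assms obtain t us where us: "ts = t # us"
    by (cases ts) auto
  have tr: "t \<in> reflections n" "set us \<subseteq> reflections n"
    using ts us by auto
  then have "product us \<in> G"
    using reflection_hyperoctahedral by (intro product_hyperoctahedral) auto
  moreover from tr obtain a b where ab: "a \<in> X" "b \<in> X" "a \<noteq> b" "t = sswap a b"
    unfolding reflections_eq by blast
  moreover have w: "w = sswap a b \<circ> product us"
    using ts us ab by simp
  moreover have "len w = Suc (len (product us))"
  proof -
    have "len (product us) \<le> length us"
      using tr by (intro abs_length_le) auto
    moreover have "len w \<le> len (sswap a b) + len (product us)"
      using w ab calculation by (metis abs_length_comp sswap_hyperoctahedral \<open>product us \<in> G\<close>)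
    moreover have "len (sswap a b) \<le> 1"
      using ab abs_length_sswap by simp
    moreover have "len w = Suc (length us)"
      using ts us by simp
    ultimately show ?thesis by linarith
  qed
  ultimately show ?thesis using that by blast
qed

end

section \<open>Fixed spaces and the length function\<close>

text \<open>The root of \<open>sswap a b\<close>: e_a - e_b as an odd function, but e_a instead of 2
  e_a when \<open>b = - a\<close>. With this scaling the reflection formula
  \<open>odd_fun_sswap\<close> needs no case distinction.\<close>

definition rho :: "int \<Rightarrow> int \<Rightarrow> int \<Rightarrow> real" where
  "rho a b x = (if x = a \<or> x = - b then 1 else if x = b \<or> x = - a then - 1 else 0)"

context signed_permutations
begin

section \<open>Odd functions, invariants and the inner product\<close>

definition odd_funs :: "(int \<Rightarrow> real) set" where
  "odd_funs = {f. (\<forall>x. f (- x) = - f x) \<and> (\<forall>x. x \<notin> X \<longrightarrow> f x = 0)}"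

definition invariants :: "(int \<Rightarrow> int) \<Rightarrow> (int \<Rightarrow> real) set" where
  "invariants w = {f \<in> odd_funs. \<forall>x. f (w x) = f x}"

text \<open>\<open>eqv w a (-a)\<close> says that \<open>a\<close> lies in a balanced cycle of \<open>w\<close>.\<close>

definition eqv :: "(int \<Rightarrow> int) \<Rightarrow> int \<Rightarrow> int \<Rightarrow> bool" where
  "eqv w a b \<longleftrightarrow> (\<forall>f\<in>invariants w. f a = f b)"

definition ip :: "(int \<Rightarrow> real) \<Rightarrow> (int \<Rightarrow> real) \<Rightarrow> real" where
  "ip f g = (\<Sum>x\<in>X. f x * g x)"

lemma odd_funsD: "f \<in> odd_funs \<Longrightarrow> f (- x) = - f x" "f \<in> odd_funs \<Longrightarrow> x \<notin> X \<Longrightarrow> f x = 0"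
  by (auto simp: odd_funs_def)

lemma invariantsD:
  "f \<in> invariants w \<Longrightarrow> f \<in> odd_funs" "f \<in> invariants w \<Longrightarrow> f (w x) = f x"
  "f \<in> invariants w \<Longrightarrow> f (- x) = - f x"
  by (auto simp: invariants_def odd_funs_def)

lemma odd_funs_lin [intro]:
  "f \<in> odd_funs \<Longrightarrow> g \<in> odd_funs \<Longrightarrow> (\<lambda>x. f x + g x) \<in> odd_funs"
  "f \<in> odd_funs \<Longrightarrow> g \<in> odd_funs \<Longrightarrow> (\<lambda>x. f x - g x) \<in> odd_funs"
  "f \<in> odd_funs \<Longrightarrow> (\<lambda>x. c * f x) \<in> odd_funs"
  by (auto simp: odd_funs_def)

lemma invariants_lin [intro]:
  "f \<in> invariants w \<Longrightarrow> g \<in> invariants w \<Longrightarrow> (\<lambda>x. f x + g x) \<in> invariants w"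
  "f \<in> invariants w \<Longrightarrow> g \<in> invariants w \<Longrightarrow> (\<lambda>x. f x - g x) \<in> invariants w"
  "f \<in> invariants w \<Longrightarrow> (\<lambda>x. c * f x) \<in> invariants w"
  by (auto simp: invariants_def odd_funs_def)

lemma odd_funs_comp: "f \<in> odd_funs \<Longrightarrow> w \<in> G \<Longrightarrow> (\<lambda>x. f (w x)) \<in> odd_funs"
  by (auto simp: odd_funs_def hyperoctahedralD)

lemma invariants_id: "invariants id = odd_funs"
  by (auto simp: invariants_def)

lemma invariants_inv:
  assumes "w \<in> G"
  shows "invariants (inv w) = invariants w"
  using inv_comp_hyperoctahedral(3,4)[OF assms] by (auto simp: invariants_def) metis+

lemma invariants_comp: "f \<in> invariants u \<Longrightarrow> f \<in> invariants v \<Longrightarrow> f \<in> invariants (u \<circ> v)"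
  by (auto simp: invariants_def)

lemma invariants_cancel_right:
  assumes "f \<in> invariants (u \<circ> v)" "f \<in> invariants v" "v \<in> G"
  shows "f \<in> invariants u"
proof -
  have "f (u x) = f x" for x
    using assms(1,2) invariantsD(2)[of f "u \<circ> v" "inv v x"] invariantsD(2)[of f "v" "inv v x"]
      inv_comp_hyperoctahedral(4)[OF assms(3)] by simp
  then show ?thesis
    using assms by (auto simp: invariants_def)
qed

lemma invariants_cancel_left:
  "f \<in> invariants (u \<circ> v) \<Longrightarrow> f \<in> invariants u \<Longrightarrow> f \<in> invariants v"
  by (auto simp: invariants_def)

lemma eqv_refl: "eqv w a a"
  and eqv_sym: "eqv w a b \<Longrightarrow> eqv w b a"
  and eqv_trans: "eqv w a b \<Longrightarrow> eqv w b c \<Longrightarrow> eqv w a c"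
  and eqv_minus: "eqv w (- a) (- b) \<longleftrightarrow> eqv w a b"
  and eqv_minus_right: "eqv w (- a) b \<longleftrightarrow> eqv w a (- b)"
  and eqv_image: "eqv w (w a) a"
  by (auto simp: eqv_def invariants_def odd_funs_def)

lemma eqv_balanced_zero: "eqv w a (- a) \<Longrightarrow> f \<in> invariants w \<Longrightarrow> f a = 0"
  using invariantsD(3)[of f w a] unfolding eqv_def by fastforce

lemma eqv_balanced_iff: "eqv w a (- a) \<longleftrightarrow> (\<forall>f\<in>invariants w. f a = 0)"
  using eqv_balanced_zero[of w a] unfolding eqv_def by (force simp: invariantsD(3))

lemma rho_odd: "a \<in> X \<Longrightarrow> b \<in> X \<Longrightarrow> a \<noteq> b \<Longrightarrow> rho a b \<in> odd_funs"
  using nonzero_signed_points[of a] nonzero_signed_points[of b]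
  by (auto simp: odd_funs_def rho_def)

lemma odd_fun_sswap:
  assumes "f \<in> odd_funs" "a \<in> X" "b \<in> X" "a \<noteq> b"
  shows "f (sswap a b x) = f x + (f b - f a) * rho a b x"
  using assms nonzero_signed_points[of a] nonzero_signed_points[of b] odd_funsD(1)[OF assms(1)]
  by (auto simp: rho_def sswap_def)

lemma invariants_sswap:
  assumes "f \<in> odd_funs" "a \<in> X" "b \<in> X" "a \<noteq> b" "f a = f b"
  shows "f \<in> invariants (sswap a b)"
  using assms by (auto simp: invariants_def odd_fun_sswap)

text \<open>Summing over both signs counts every coordinate twice. This gives
  \<open>2 * (f a - f b)\<close> in general, and \<open>2 * f a = f a - f (- a)\<close> for
  \<open>b = - a\<close>.\<close>

lemma ip_rho:
  assumes "f \<in> odd_funs" "a \<in> X" "b \<in> X" "a \<noteq> b"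
  shows "ip f (rho a b) = (if b = - a then 1 else 2) * (f a - f b)"
proof -
  have "ip f (rho a b) = (\<Sum>x\<in>{a, b, - a, - b}. f x * rho a b x)"
    unfolding ip_def
    by (rule sum.mono_neutral_right) (use assms finite_signed_points in \<open>auto simp: rho_def\<close>)
  also have "\<dots> = (if b = - a then 1 else 2) * (f a - f b)"
  proof -
    have "a \<noteq> 0" "b \<noteq> 0"
      using assms nonzero_signed_points by blast+
    then show ?thesis
      using assms(4) odd_funsD(1)[OF assms(1)]
      by (cases "b = - a") (auto simp: rho_def insert_commute insert_absorb)
  qed
  finally show ?thesis .
qed

lemma ip_comp:
  assumes "w \<in> G"
  shows "ip (\<lambda>x. f (w x)) (\<lambda>x. g (w x)) = ip f g"
proof -
  have "ip f g = (\<Sum>x\<in>X. ((\<lambda>x. f x * g x) \<circ> w) x)"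
    unfolding ip_def by (rule sum.permute[OF hyperoctahedralD(5)[OF assms]])
  then show ?thesis
    by (simp add: ip_def)
qed

lemma ip_sym: "ip f g = ip g f"
  by (simp add: ip_def mult.commute)

lemma ip_lin:
  "ip (\<lambda>x. f x + g x) h = ip f h + ip g h" "ip (\<lambda>x. f x - g x) h = ip f h - ip g h"
  "ip (\<lambda>x. c * f x) h = c * ip f h"
  "ip h (\<lambda>x. f x + g x) = ip h f + ip h g" "ip h (\<lambda>x. f x - g x) = ip h f - ip h g"
  "ip h (\<lambda>x. c * f x) = c * ip h f"
  by (simp_all add: ip_def algebra_simps sum.distrib sum_subtractf sum_distrib_left)

lemma ip_definite:
  assumes "f \<in> odd_funs" "ip f f = 0"
  shows "f x = 0"
proof (cases "x \<in> X")
  case True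
  have "\<forall>x\<in>X. f x * f x = 0"
    using assms(2) sum_nonneg_eq_0_iff[OF finite_signed_points, of "\<lambda>x. f x * f x"]
    unfolding ip_def by simp
  with True show ?thesis by simp
qed (use assms odd_funsD in auto)

lemma ip_coboundary:
  assumes "w \<in> G" "f \<in> odd_funs" "g \<in> invariants w"
  shows "ip (\<lambda>x. f (w x) - f x) g = 0"
proof -
  have "ip (\<lambda>x. f (w x)) g = ip (\<lambda>x. f (w x)) (\<lambda>x. g (w x))"
    using invariantsD(2)[OF assms(3)] by simp
  then show ?thesis
    using ip_comp[OF assms(1)] by (simp add: ip_lin)
qed

text \<open>The averaging argument behind \<open>im (w - 1) = Fix(w)\<^sup>\<bottom>\<close>: since \<open>w\<close> has
  finite order \<open>N\<close> and the average of \<open>\<alpha>\<close> vanishes, \<open>x = (1/N) \<Sum>m \<cdot> \<alpha> \<circ> w\<^sup>m\<close> works.\<close>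

lemma coboundary_exists:
  assumes w: "w \<in> G" and \<alpha>: "\<alpha> \<in> odd_funs" and orth: "\<And>f. f \<in> invariants w \<Longrightarrow> ip \<alpha> f = 0"
  obtains x where "x \<in> odd_funs" "\<And>y. x (w y) = x y + \<alpha> y"
proof -
  obtain N where N: "w ^^ N = id" "N > 0"
    using permutation_is_nilpotent[OF hyperoctahedralD(8)[OF w]] by blast
  have pow: "w ^^ m \<in> G" for m
    using w by (induction m) auto
  define A where "A y = (\<Sum>m<N. \<alpha> ((w ^^ m) y))" for y
  have shift: "(\<Sum>m<N. \<alpha> ((w ^^ Suc m) y)) = A y" for y
  proof -
    have "(\<Sum>m<N. \<alpha> ((w ^^ Suc m) y)) + \<alpha> ((w ^^ 0) y) = (\<Sum>m<Suc N. \<alpha> ((w ^^ m) y))"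
      by (subst sum.lessThan_Suc_shift) simp
    then show ?thesis
      using N by (simp add: A_def)
  qed
  have "A (w y) = A y" for y
    using shift[of y] unfolding A_def funpow_Suc_right by simp
  moreover have "A \<in> odd_funs"
    using \<alpha> hyperoctahedralD[OF pow] by (auto simp: odd_funs_def A_def sum_negf)
  ultimately have A: "A \<in> invariants w" "A \<in> odd_funs"
    by (auto simp: invariants_def)
  have Apow: "A ((w ^^ m) y) = A y" for m y
    using A by (induction m) (auto simp: invariantsD)
  \<comment> \<open>\<open>A\<close> is \<open>N\<close> times the orthogonal projection of \<alpha>
    to the invariants: each summand of \<open>ip A A\<close> equals \<open>ip \<alpha> A\<close>,
    because \<open>A\<close> is invariant and composition with \<open>w\<close> is an
    isometry.\<close>
  have "ip A A = (\<Sum>m<N. ip (\<lambda>y. \<alpha> ((w ^^ m) y)) A)"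
    unfolding ip_def A_def[abs_def] sum_distrib_right by (rule sum.swap)
  also have "\<dots> = (\<Sum>m<N. ip (\<lambda>y. \<alpha> ((w ^^ m) y)) (\<lambda>y. A ((w ^^ m) y)))"
    by (simp add: Apow)
  also have "\<dots> = 0"
    using ip_comp[OF pow, of \<alpha> _ A] orth[OF A(1)] by simp
  finally have A0: "A y = 0" for y
    using ip_definite A by blast
  define x where "x y = (\<Sum>m<N. real m * \<alpha> ((w ^^ m) y)) / real N" for y
  have "x \<in> odd_funs"
    using \<alpha> hyperoctahedralD[OF pow] by (auto simp: odd_funs_def x_def sum_negf)
  moreover have "x (w y) = x y + \<alpha> y" for y
  proof -
    have "(\<Sum>m<N. real (Suc m) * \<alpha> ((w ^^ Suc m) y) - real m * \<alpha> ((w ^^ m) y))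
        = real N * \<alpha> y"
      using N sum_lessThan_telescope[of "\<lambda>m. real m * \<alpha> ((w ^^ m) y)" N] by simp
    moreover have "(\<Sum>m<N. real (Suc m) * \<alpha> ((w ^^ Suc m) y))
        = (\<Sum>m<N. real m * \<alpha> ((w ^^ Suc m) y)) + (\<Sum>m<N. \<alpha> ((w ^^ Suc m) y))"
      by (simp add: algebra_simps sum.distrib)
    ultimately have "(\<Sum>m<N. real m * \<alpha> ((w ^^ Suc m) y)) - (\<Sum>m<N. real m * \<alpha> ((w ^^ m) y))
        = real N * \<alpha> y"
      using shift[of y] A0[of y] by (simp add: sum_subtractf)
    moreover have "x (w y) = (\<Sum>m<N. real m * \<alpha> ((w ^^ Suc m) y)) / real N"
      unfolding x_def funpow_Suc_right by simp
    ultimately show ?thesis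
      using N unfolding x_def by (simp add: field_simps)
  qed
  ultimately show ?thesis using that by blast
qed

section \<open>Dimensions of fixed spaces\<close>

interpretation fs: vector_space "\<lambda>(r::real) (f::int \<Rightarrow> real). (\<lambda>x. r * f x)"
  by unfold_locales (auto simp: fun_eq_iff algebra_simps)

lemma odd_funs_finite_span: "\<exists>B. finite B \<and> odd_funs \<subseteq> fs.span B"
proof -
  define d where "d a x = (if x = a then 1 else 0 :: real)" for a x :: int
  have "f \<in> fs.span (d ` X)" if "f \<in> odd_funs" for f
  proof -
    have sum_apply: "(\<Sum>a\<in>S. g a) x = (\<Sum>a\<in>S. g a x)" if "finite S" for S and g :: "int \<Rightarrow> int \<Rightarrow> real" and x
      using that by (induction S) auto
    have "(\<Sum>a\<in>X. (\<lambda>x. f a * d a x)) = f"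
    proof
      fix x
      have "(\<Sum>a\<in>X. f a * d a x) = (\<Sum>a\<in>X. if a = x then f x else 0)"
        by (rule sum.cong) (auto simp: d_def)
      also have "\<dots> = f x"
        using odd_funsD(2)[OF that, of x] finite_signed_points by (simp add: sum.delta')
      finally show "(\<Sum>a\<in>X. (\<lambda>x. f a * d a x)) x = f x"
        by (simp add: sum_apply[OF finite_signed_points])
    qed
    moreover have "(\<Sum>a\<in>X. (\<lambda>x. f a * d a x)) \<in> fs.span (d ` X)"
      by (intro fs.span_sum fs.span_scale fs.span_base) auto
    ultimately show ?thesis by simp
  qed
  then show ?thesis
    using finite_signed_points by (intro exI[of _ "d ` X"]) auto
qed

lemma independent_odd_finite:
  assumes "fs.independent B" "B \<subseteq> odd_funs"
  shows "finite B"
proof -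
  obtain S where S: "finite S" "odd_funs \<subseteq> fs.span S"
    using odd_funs_finite_span by blast
  then have "B \<subseteq> fs.span S"
    using assms(2) by blast
  then show ?thesis
    using fs.independent_span_bound[OF S(1) assms(1)] by blast
qed

lemma subspace_invariants: "fs.subspace (invariants w)"
  by (rule fs.subspaceI) (auto simp: invariants_def odd_funs_def)

lemma dim_invariants_less:
  assumes "invariants u \<subset> invariants v"
  shows "fs.dim (invariants u) < fs.dim (invariants v)"
proof -
  obtain B where B: "B \<subseteq> invariants u" "fs.independent B" "invariants u \<subseteq> fs.span B"
      "card B = fs.dim (invariants u)"
    using fs.basis_exists by blast
  obtain x where x: "x \<in> invariants v" "x \<notin> invariants u"
    using assms by blast
  have "fs.span B \<subseteq> invariants u"
    by (rule fs.span_minimal[OF B(1) subspace_invariants])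
  then have "x \<notin> fs.span B"
    using x by blast
  then have ind: "fs.independent (insert x B)" "x \<notin> B"
    using B(2) fs.independent_insertI fs.span_base by blast+
  have sub: "insert x B \<subseteq> invariants v"
    using B(1) assms x by blast
  obtain C where C: "insert x B \<subseteq> C" "C \<subseteq> invariants v" "fs.independent C" "invariants v \<subseteq> fs.span C"
    using fs.maximal_independent_subset_extend[OF sub ind(1)] by blast
  have "finite C"
    using C invariantsD(1) by (intro independent_odd_finite) auto
  then have "card (insert x B) \<le> card C"
    using C by (intro card_mono)
  moreover have "card C = fs.dim (invariants v)"
    using C by (intro fs.basis_card_eq_dim)
  moreover have "finite B"
    using \<open>finite C\<close> C(1) finite_subset[of B C] by blast
  then have "card (insert x B) = Suc (card B)"
    using ind(2) by simp
  ultimately show ?thesis using B by simp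
qed

text \<open>\<open>invariants v\<close> contains the part of \<open>invariants u\<close> cut out by
  one linear equation, so a single vector \<open>x\<close> separating \<open>a\<close> and
  \<open>b\<close> makes up for the rest.\<close>

lemma dim_invariants_le_Suc:
  assumes "\<And>f. f \<in> invariants u \<Longrightarrow> f a = f b \<Longrightarrow> f \<in> invariants v"
  shows "fs.dim (invariants u) \<le> Suc (fs.dim (invariants v))"
proof (cases "invariants u \<subseteq> invariants v")
  case True
  then consider "invariants u = invariants v" | "invariants u \<subset> invariants v"
    by blast
  then show ?thesis
  proof cases
    case 2
    from dim_invariants_less[OF 2] show ?thesis by simp
  qed simp
next
  case False
  then obtain x where x: "x \<in> invariants u" "x a \<noteq> x b"
    using assms by blast
  obtain B where B: "B \<subseteq> invariants v" "fs.independent B" "invariants v \<subseteq> fs.span B"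
      "card B = fs.dim (invariants v)"
    using fs.basis_exists by blast
  have fin: "finite B"
    using B invariantsD(1) by (intro independent_odd_finite) auto
  have "f \<in> fs.span (insert x B)" if f: "f \<in> invariants u" for f
  proof -
    define c where "c = (f a - f b) / (x a - x b)"
    have "(\<lambda>y. f y - c * x y) \<in> invariants u"
      using f x by auto
    moreover have "f a - c * x a = f b - c * x b"
      using x(2) by (simp add: c_def field_simps)
    ultimately have "(\<lambda>y. f y - c * x y) \<in> fs.span B"
      using assms B(3) by blast
    moreover have "(f - (\<lambda>y. c * x y)) = (\<lambda>y. f y - c * x y)"
      by (simp add: fun_eq_iff)
    ultimately have "f - (\<lambda>y. c * x y) \<in> fs.span B"
      by (simp only:)
    then show ?thesis
      unfolding fs.span_breakdown_eq by blast
  qed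
  then have "fs.dim (invariants u) \<le> card (insert x B)"
    using fin by (intro fs.dim_le_card) auto
  also have "\<dots> \<le> Suc (card B)"
    using fin by (simp add: card_insert_if)
  finally show ?thesis using B by simp
qed

lemma invariants_sswap_comp:
  assumes "f \<in> invariants w" "f a = f b" "a \<in> X" "b \<in> X" "a \<noteq> b"
  shows "f \<in> invariants (sswap a b \<circ> w)"
  using assms invariantsD(1)[OF assms(1)] by (intro invariants_comp invariants_sswap)

lemma sswap_sswap_comp:
  assumes "a \<in> X" "b \<in> X"
  shows "sswap a b \<circ> (sswap a b \<circ> w) = w"
proof -
  have "a \<noteq> 0" "b \<noteq> 0"
    using assms nonzero_signed_points by blast+
  then show ?thesis
    by (simp add: fun_eq_iff)
qed

text \<open>Each letter of a word costs at most one dimension, which bounds the length from below.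
  Conversely, the reflection taking \<open>w a\<close> back to \<open>a\<close> makes the coordinate
  function of \<open>a\<close> invariant and keeps all old invariants, so the codimension drops
  while the length changes by at most 1.\<close>

lemma dim_invariants_add_length:
  assumes "w \<in> G"
  shows "fs.dim (invariants w) + len w = fs.dim odd_funs"
proof (rule antisym)
  have lower: "fs.dim odd_funs \<le> fs.dim (invariants (product ts)) + length ts"
    if "set ts \<subseteq> reflections n" for ts
    using that
  proof (induction ts)
    case (Cons t ts)
    then obtain a b where ab: "a \<in> X" "b \<in> X" "a \<noteq> b" "t = sswap a b"
      using reflections_eq by auto
    have "fs.dim (invariants (product ts)) \<le> Suc (fs.dim (invariants (product (t # ts))))"
      using ab invariants_sswap_comp by (intro dim_invariants_le_Suc[where a = a and b = b]) auto
    moreover have "fs.dim odd_funs \<le> fs.dim (invariants (product ts)) + length ts"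
      using Cons by simp
    ultimately show ?case
      unfolding length_Cons by linarith
  qed (simp add: invariants_id)
  show "fs.dim odd_funs \<le> fs.dim (invariants w) + len w"
    using abs_length_word[OF assms] lower by metis
  show "fs.dim (invariants w) + len w \<le> fs.dim odd_funs"
    using assms
  proof (induction "fs.dim odd_funs - fs.dim (invariants w)" arbitrary: w rule: less_induct)
    case less
    note w = hyperoctahedralD[OF less.prems]
    show ?case
    proof (cases "w = id")
      case True
      then show ?thesis using invariants_id by simp
    next
      case False
      then obtain a where a: "w a \<noteq> a"
        by (auto simp: fun_eq_iff)
      have aX: "a \<in> X" "w a \<in> X"
        using a w by blast+
      define v where "v = sswap a (w a) \<circ> w"
      have vG: "v \<in> G"
        using aX less.prems by (simp add: v_def)
      have va: "v a = a"
        by (simp add: v_def)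
      have ne: "a \<noteq> - a"
        using nonzero_signed_points[OF aX(1)] by simp
      have "v x = a \<longleftrightarrow> x = a" "v x = - a \<longleftrightarrow> x = - a" for x
        using hyperoctahedralD(7)[OF vG, of x a] hyperoctahedralD(7)[OF vG, of x "- a"]
          hyperoctahedralD(4)[OF vG, of a] va by metis+
      moreover have "rho a (- a) \<in> odd_funs"
        using aX ne by (intro rho_odd) auto
      ultimately have "rho a (- a) \<in> invariants v"
        by (simp add: invariants_def rho_def)
      moreover have "rho a (- a) (w a) \<noteq> rho a (- a) a"
        using a by (simp add: rho_def)
      then have "rho a (- a) \<notin> invariants w"
        using invariantsD(2)[of "rho a (- a)" w a] by blast
      moreover have "invariants w \<subseteq> invariants v"
      proof
        fix f assume "f \<in> invariants w"
        then show "f \<in> invariants v"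
          unfolding v_def using aX a invariantsD(2)[of f w a]
          by (intro invariants_sswap_comp) simp_all
      qed
      ultimately have "invariants w \<subset> invariants v"
        by blast
      then have less': "fs.dim (invariants w) < fs.dim (invariants v)"
        by (rule dim_invariants_less)
      have le: "fs.dim (invariants v) \<le> fs.dim odd_funs"
      proof (cases "invariants v = odd_funs")
        case False
        then have "invariants v \<subset> invariants id"
          unfolding invariants_id using invariantsD(1) by blast
        from dim_invariants_less[OF this] show ?thesis
          by (simp add: invariants_id)
      qed simp
      have "fs.dim (invariants v) + len v \<le> fs.dim odd_funs"
        by (rule less.hyps[OF _ vG]) (use less' le in linarith)
      moreover have "len w \<le> Suc (len v)"
        using abs_length_comp[OF sswap_hyperoctahedral[OF aX] vG] sswap_sswap_comp[OF aX, of w]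
          abs_length_sswap[OF aX] a unfolding v_def[symmetric] by simp
      ultimately show ?thesis
        using less' by linarith
    qed
  qed
qed

text \<open>\<open>eqv w a b\<close> says that the root is orthogonal to the fixed space, so it is a
  coboundary. The equation \<open>x b = x a + 1\<close> is not a choice of scaling: it expresses
  that \<open>x\<close> and \<open>x \<circ> w\<close> have the same norm.\<close>

lemma coboundary_rho:
  assumes w: "w \<in> G" and ab: "a \<in> X" "b \<in> X" "a \<noteq> b" and eqv: "eqv w a b"
  obtains x where "x \<in> odd_funs" "\<And>y. x (w y) = x y + rho a b y" "x b = x a + 1"
proof -
  have "ip (rho a b) f = 0" if "f \<in> invariants w" for f
    using that eqv ip_rho[OF invariantsD(1)[OF that] ab] unfolding ip_sym[of "rho a b"] eqv_def by simp
  then obtain x where x: "x \<in> odd_funs" "\<And>y. x (w y) = x y + rho a b y"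
    using coboundary_exists[OF w rho_odd[OF ab]] by blast
  have "ip x x = ip (\<lambda>y. x y + rho a b y) (\<lambda>y. x y + rho a b y)"
    using ip_comp[OF w, of x x] by (simp add: x)
  then have "2 * ip x (rho a b) + ip (rho a b) (rho a b) = 0"
    by (simp add: ip_lin ip_sym[of "rho a b" x])
  moreover have "rho a b a = 1" "rho a b b = - 1"
    using ab nonzero_signed_points by (auto simp: rho_def)
  ultimately have "x b = x a + 1"
    using ip_rho[OF x(1) ab] ip_rho[OF rho_odd[OF ab] ab] by (auto split: if_splits)
  with x that show ?thesis by blast
qed

text \<open>Carter's lemma: \<open>t \<preceq> w\<close> iff the root of \<open>t\<close> is orthogonal to the fixed space of \<open>w\<close>.\<close>

lemma abs_length_sswap_comp:
  assumes w: "w \<in> G" and ab: "a \<in> X" "b \<in> X" "a \<noteq> b"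
  shows "eqv w a b \<Longrightarrow> len w = Suc (len (sswap a b \<circ> w))"
    and "\<not> eqv w a b \<Longrightarrow> len (sswap a b \<circ> w) = Suc (len w)"
proof -
  have *: "len w = Suc (len (sswap a b \<circ> w))" if eqv: "eqv w a b" and w: "w \<in> G" for w
  proof -
    let ?w = "sswap a b \<circ> w"
    have wG: "?w \<in> G"
      using w ab by simp
    have iG: "inv w \<in> G" using w by simp
    have "eqv (inv w) a b"
      using eqv w by (simp add: eqv_def invariants_inv)
    then obtain x where x: "x \<in> odd_funs" "\<And>y. x (inv w y) = x y + rho a b y" "x b = x a + 1"
      using coboundary_rho[OF iG ab] by blast
    \<comment> \<open>Since \<open>x b - x a = 1\<close>, adding the root is exactly what the
      reflection does to \<open>x\<close>. So \<open>x\<close> is a fixed vector that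
      \<open>sswap a b \<circ> w\<close> gains.\<close>
    have "x (inv w y) = x (sswap a b y)" for y
      using x odd_fun_sswap[OF x(1) ab] by simp
    then have "x (sswap a b (w y)) = x y" for y
      using w by (metis inv_comp_hyperoctahedral(3))
    then have "x \<in> invariants ?w"
      using x by (auto simp: invariants_def)
    moreover have "x \<notin> invariants w"
      using eqv x(3) by (auto simp: eqv_def)
    moreover have "invariants w \<subseteq> invariants ?w"
      using ab eqv by (auto simp: eqv_def intro!: invariants_sswap_comp)
    ultimately have "fs.dim (invariants w) < fs.dim (invariants ?w)"
      by (intro dim_invariants_less) blast
    moreover have "fs.dim (invariants ?w) \<le> Suc (fs.dim (invariants w))"
    proof (rule dim_invariants_le_Suc)
      fix f assume "f \<in> invariants ?w" "f a = f b"
      from invariants_sswap_comp[OF this ab] show "f \<in> invariants w"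
        unfolding sswap_sswap_comp[OF ab(1,2)] .
    qed
    ultimately show ?thesis
      using dim_invariants_add_length[OF w] dim_invariants_add_length[OF wG] by linarith
  qed
  show "eqv w a b \<Longrightarrow> len w = Suc (len (sswap a b \<circ> w))"
    using * w by blast
  assume "\<not> eqv w a b"
  then obtain f where f: "f \<in> invariants w" "f a \<noteq> f b"
    by (auto simp: eqv_def)
  let ?w = "sswap a b \<circ> w"
  have wG: "?w \<in> G"
    using w ab by simp
  \<comment> \<open>This reduces the claim to the first part, applied to \<open>?w\<close>: for
    \<open>g\<close> fixed by \<open>?w\<close>, a multiple of the root by \<open>g b - g a\<close>
    is a coboundary of \<open>inv w\<close>, hence orthogonal to \<open>f\<close>, whereas the root
    itself is not.\<close>
  have "eqv ?w a b"
    unfolding eqv_def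
  proof
    fix g assume g: "g \<in> invariants ?w"
    have "g (inv w y) = g y + (g b - g a) * rho a b y" for y
      using invariantsD(2)[OF g, of "inv w y"] odd_fun_sswap[OF invariantsD(1)[OF g] ab, of y] w
      by simp
    then have "(\<lambda>y. (g b - g a) * rho a b y) = (\<lambda>y. g (inv w y) - g y)"
      by simp
    moreover have "ip (\<lambda>y. g (inv w y) - g y) f = 0"
      using g f w by (intro ip_coboundary) (auto simp: invariants_inv dest: invariantsD(1))
    ultimately have "(g b - g a) * ip (rho a b) f = 0"
      using ip_lin(3)[of "g b - g a" "rho a b" f] by simp
    then show "g a = g b"
      using ip_rho[OF invariantsD(1)[OF f(1)] ab] f(2) ip_sym[of "rho a b" f] by (auto split: if_splits)
  qed
  from *[OF this wG] show "len (sswap a b \<circ> w) = Suc (len w)"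
    using sswap_sswap_comp[OF ab(1,2), of w] by simp
qed

end

section \<open>The absolute order\<close>

context signed_permutations
begin

abbreviation V where "V \<equiv> odd_funs"
abbreviation Inv where "Inv \<equiv> invariants"


text \<open>Stated through fixed spaces to be monotone in both arguments
  (\<open>complementary_mono\<close>); \<open>additive_iff_complementary\<close> ties it to
  lengths.\<close>

definition complementary :: "(int \<Rightarrow> int) \<Rightarrow> (int \<Rightarrow> int) \<Rightarrow> bool" where
  "complementary u v \<longleftrightarrow> (\<forall>f\<in>V. \<exists>g\<in>Inv u. \<exists>h\<in>Inv v. \<forall>x. f x = g x + h x)"

definition below :: "(int \<Rightarrow> int) \<Rightarrow> (int \<Rightarrow> int) \<Rightarrow> bool" where
  "below u w \<longleftrightarrow> u \<in> G \<and> w \<in> G \<and> abs_le n u w"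

lemma abs_length_inv:
  assumes "w \<in> G"
  shows "len (inv w) = len w"
  using dim_invariants_add_length[OF assms] dim_invariants_add_length[OF inv_hyperoctahedral[OF assms]]
    invariants_inv[OF assms] by simp

lemma abs_length_comp_sswap:
  assumes w: "w \<in> G" and ab: "a \<in> X" "b \<in> X" "a \<noteq> b"
  shows "eqv w a b \<Longrightarrow> len w = Suc (len (w \<circ> sswap a b))"
    and "\<not> eqv w a b \<Longrightarrow> len (w \<circ> sswap a b) = Suc (len w)"
proof -
  have nz: "a \<noteq> 0" "b \<noteq> 0"
    using ab nonzero_signed_points by blast+
  have inv_s: "inv (sswap a b) = sswap a b"
    using nz by (intro inv_unique_comp) (auto simp: fun_eq_iff)
  have wG: "w \<circ> sswap a b \<in> G"
    using w ab by simp
  have "inv (w \<circ> sswap a b) = sswap a b \<circ> inv w"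
    using hyperoctahedralD(1)[OF w] hyperoctahedralD(1)[OF sswap_hyperoctahedral[OF ab(1,2)]]
    by (simp add: o_inv_distrib inv_s)
  then have eq: "len (w \<circ> sswap a b) = len (sswap a b \<circ> inv w)"
    using abs_length_inv[OF wG] by simp
  have "eqv (inv w) a b \<longleftrightarrow> eqv w a b"
    by (simp add: eqv_def invariants_inv[OF w])
  then show "eqv w a b \<Longrightarrow> len w = Suc (len (w \<circ> sswap a b))"
    and "\<not> eqv w a b \<Longrightarrow> len (w \<circ> sswap a b) = Suc (len w)"
    unfolding eq using abs_length_sswap_comp[OF inv_hyperoctahedral[OF w] ab] abs_length_inv[OF w]
    by auto
qed

section \<open>Additivity of length and sums of fixed spaces\<close>

lemma complementaryI:
  assumes "\<And>f. f \<in> V \<Longrightarrow> \<exists>g h. g \<in> Inv u \<and> h \<in> Inv v \<and> (\<forall>x. f x = g x + h x)"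
  shows "complementary u v"
  using assms unfolding complementary_def by blast

lemma complementaryE:
  assumes "complementary u v" "f \<in> V"
  obtains g h where "g \<in> Inv u" "h \<in> Inv v" "\<And>x. f x = g x + h x"
  using assms unfolding complementary_def by blast

lemma complementary_mono:
  "complementary u v \<Longrightarrow> Inv u \<subseteq> Inv u' \<Longrightarrow> Inv v \<subseteq> Inv v' \<Longrightarrow> complementary u' v'"
  unfolding complementary_def by blast

lemma not_eqv_id: "a \<in> X \<Longrightarrow> b \<in> X \<Longrightarrow> a \<noteq> b \<Longrightarrow> \<not> eqv id a b"
  using rho_odd[of a b] nonzero_signed_points[of a] nonzero_signed_points[of b]
  unfolding eqv_def invariants_id by (intro notI) (auto simp: rho_def dest!: bspec[of _ _ "rho a b"])

text \<open>A leading reflection \<open>t\<close> of \<open>v\<close> is moved over to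
  \<open>u\<close>. Additivity makes \<open>u \<circ> t\<close> longer than \<open>u\<close>, so
  some \<open>y\<close> in \<open>Inv u\<close> separates \<open>a\<close> and \<open>b\<close>.
  Splitting \<open>y\<close> by the induction hypothesis leaves a part \<open>h'\<close> in both
  \<open>Inv u\<close> and \<open>Inv v'\<close> that still separates them, and shifting a multiple
  of \<open>h'\<close> between the summands turns a decomposition for \<open>u \<circ> t\<close> and
  \<open>v'\<close> into one for \<open>u\<close> and \<open>v\<close>.\<close>

lemma additive_imp_complementary:
  "u \<in> G \<Longrightarrow> v \<in> G \<Longrightarrow> len (u \<circ> v) = len u + len v \<Longrightarrow> complementary u v"
proof (induction "len v" arbitrary: u v)
  case 0
  then have v: "v = id"
    using abs_length_0 by metis
  have "(\<lambda>x. 0) \<in> Inv u"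
    by (auto simp: invariants_def odd_funs_def)
  moreover have "f \<in> Inv v" if "f \<in> V" for f
    using that by (simp add: v invariants_id)
  moreover have "f x = (\<lambda>x. 0) x + f x" for f :: "int \<Rightarrow> real" and x
    by simp
  ultimately show ?case
    by (intro complementaryI exI conjI allI)
next
  case (Suc k)
  note u = \<open>u \<in> G\<close> and v = \<open>v \<in> G\<close>
  have "v \<noteq> id"
    using Suc.hyps(2) by auto
  then obtain a b v' where ab: "a \<in> X" "b \<in> X" "a \<noteq> b" and v': "v' \<in> G" "v = sswap a b \<circ> v'"
      "len v = Suc (len v')"
    using abs_length_step[OF v] by metis
  define t where "t = sswap a b"
  have tG: "t \<in> G" "u \<circ> t \<in> G"
    using ab u by (auto simp: t_def)
  have uv: "u \<circ> v = (u \<circ> t) \<circ> v'"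
    by (simp add: v' t_def comp_assoc)
  have "len (u \<circ> v) \<le> len (u \<circ> t) + len v'"
    unfolding uv using tG v' by (intro abs_length_comp) auto
  then have ut: "\<not> eqv u a b" "len (u \<circ> t) = Suc (len u)"
    using abs_length_comp_sswap[OF u ab] Suc.prems v' unfolding t_def by force+
  then obtain y where y: "y \<in> Inv u" "y a \<noteq> y b"
    by (auto simp: eqv_def)
  have "u \<circ> t \<circ> t = u"
    using ab nonzero_signed_points by (auto simp: t_def fun_eq_iff)
  then have "eqv (u \<circ> t) a b"
    using abs_length_comp_sswap(2)[OF tG(2) ab] ut t_def by fastforce
  then have utInv: "Inv (u \<circ> t) \<subseteq> Inv u" "\<And>f. f \<in> Inv (u \<circ> t) \<Longrightarrow> f a = f b"
    using ab tG invariants_sswap[of _ a b] invariantsD(1)[of _ "u \<circ> t"]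
    unfolding eqv_def t_def by (auto intro: invariants_cancel_right)
  have compl: "complementary (u \<circ> t) v'"
    using Suc.hyps(2) Suc.prems v' ut tG uv by (intro Suc.hyps(1)) auto
  show ?case
  proof (rule complementaryI)
    fix f assume "f \<in> V"
    then obtain g h where gh: "g \<in> Inv (u \<circ> t)" "h \<in> Inv v'" "\<And>x. f x = g x + h x"
      using complementaryE[OF compl] by blast
    have "y \<in> V"
      using y invariantsD(1) by blast
    then obtain g' h' where gh': "g' \<in> Inv (u \<circ> t)" "h' \<in> Inv v'" "\<And>x. y x = g' x + h' x"
      using complementaryE[OF compl] by blast
    have "(\<lambda>x. y x - g' x) \<in> Inv u"
      using y(1) gh'(1) utInv(1) by (intro invariants_lin) blast+
    moreover have "h' = (\<lambda>x. y x - g' x)"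
      using gh'(3) by auto
    ultimately have h'u: "h' \<in> Inv u"
      by (simp only:)
    define c where "c = (h a - h b) / (h' a - h' b)"
    have "h' a \<noteq> h' b"
      using y(2) gh'(3) utInv(2)[OF gh'(1)] by simp
    then have "h a - c * h' a = h b - c * h' b"
      by (simp add: c_def field_simps)
    moreover have "(\<lambda>x. h x - c * h' x) \<in> Inv v'"
      using gh gh' by auto
    ultimately have "(\<lambda>x. h x - c * h' x) \<in> Inv v"
      unfolding v' using ab by (intro invariants_sswap_comp) auto
    moreover have "(\<lambda>x. g x + c * h' x) \<in> Inv u"
      using gh utInv h'u by auto
    moreover have "f x = (g x + c * h' x) + (h x - c * h' x)" for x
      using gh(3) by simp
    ultimately show "\<exists>g h. g \<in> Inv u \<and> h \<in> Inv v \<and> (\<forall>x. f x = g x + h x)"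
      by (intro exI conjI allI)
  qed
qed

text \<open>The same shift in the opposite direction, now with the part \<open>g'\<close> of a
  function in \<open>Inv v'\<close> separating \<open>a\<close> and \<open>b\<close>; it also shows
  that \<open>u \<circ> t\<close> is longer than \<open>u\<close>.\<close>

lemma complementary_imp_additive:
  "u \<in> G \<Longrightarrow> v \<in> G \<Longrightarrow> complementary u v \<Longrightarrow> len (u \<circ> v) = len u + len v"
proof (induction "len v" arbitrary: u v)
  case 0
  then have v: "v = id"
    using abs_length_0 by metis
  show ?case
    unfolding v comp_id abs_length_id by (rule add_0_right[symmetric])
next
  case (Suc k)
  note u = \<open>u \<in> G\<close> and v = \<open>v \<in> G\<close>
  have "v \<noteq> id"
    using Suc.hyps(2) by auto
  then obtain a b v' where ab: "a \<in> X" "b \<in> X" "a \<noteq> b" and v': "v' \<in> G" "v = sswap a b \<circ> v'"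
      "len v = Suc (len v')"
    using abs_length_step[OF v] by metis
  define t where "t = sswap a b"
  have tG: "t \<in> G" "u \<circ> t \<in> G"
    using ab u by (auto simp: t_def)
  have uv: "u \<circ> v = (u \<circ> t) \<circ> v'"
    by (simp add: v' t_def comp_assoc)
  have tv: "sswap a b \<circ> v = v'"
    using v' sswap_sswap_comp[OF ab(1,2)] by simp
  have "eqv v a b"
    using abs_length_sswap_comp(2)[OF v ab] tv v' by fastforce
  then have vInv: "\<And>f. f \<in> Inv v \<Longrightarrow> f a = f b" "Inv v \<subseteq> Inv v'"
    using invariants_sswap_comp[OF _ _ ab, of _ v] unfolding tv by (auto simp: eqv_def)
  have "\<not> eqv v' a b"
    using abs_length_sswap_comp(1)[OF v'(1) ab] v' by auto
  then obtain y where y: "y \<in> Inv v'" "y a \<noteq> y b"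
    by (auto simp: eqv_def)
  then have "y \<in> V"
    using invariantsD(1) by blast
  then obtain g' h' where gh': "g' \<in> Inv u" "h' \<in> Inv v" "\<And>x. y x = g' x + h' x"
    using complementaryE[OF Suc.prems(3)] by blast
  have "(\<lambda>x. y x - h' x) \<in> Inv v'"
    using y(1) gh'(2) vInv(2) by (intro invariants_lin) blast+
  moreover have "g' = (\<lambda>x. y x - h' x)"
    using gh'(3) by auto
  ultimately have g'v': "g' \<in> Inv v'"
    by (simp only:)
  have g'ne: "g' a \<noteq> g' b"
    using y gh'(3) vInv(1)[OF gh'(2)] by auto
  then have "\<not> eqv u a b"
    using gh' by (auto simp: eqv_def)
  then have ut: "len (u \<circ> t) = Suc (len u)"
    using abs_length_comp_sswap[OF u ab] by (simp add: t_def)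
  have "complementary (u \<circ> t) v'"
  proof (rule complementaryI)
    fix f assume "f \<in> V"
    then obtain g h where gh: "g \<in> Inv u" "h \<in> Inv v" "\<And>x. f x = g x + h x"
      using complementaryE[OF Suc.prems(3)] by blast
    define c where "c = (g a - g b) / (g' a - g' b)"
    have "g a - c * g' a = g b - c * g' b"
      using g'ne by (simp add: c_def field_simps)
    moreover have gu: "(\<lambda>x. g x - c * g' x) \<in> Inv u"
      using gh gh' by auto
    ultimately have "(\<lambda>x. g x - c * g' x) \<in> Inv (u \<circ> t)"
      unfolding t_def using ab invariantsD(1)[OF gu] by (intro invariants_comp invariants_sswap) auto
    moreover have "(\<lambda>x. h x + c * g' x) \<in> Inv v'"
      using gh vInv g'v' by auto
    moreover have "f x = (g x - c * g' x) + (h x + c * g' x)" for x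
      using gh(3) by simp
    ultimately show "\<exists>g h. g \<in> Inv (u \<circ> t) \<and> h \<in> Inv v' \<and> (\<forall>x. f x = g x + h x)"
      by (intro exI conjI allI)
  qed
  then have "len (u \<circ> t \<circ> v') = len (u \<circ> t) + len v'"
    using Suc.hyps(2) v' tG by (intro Suc.hyps(1)) auto
  then show ?case
    using uv ut v' by simp
qed

lemma additive_iff_complementary:
  "u \<in> G \<Longrightarrow> v \<in> G \<Longrightarrow> len (u \<circ> v) = len u + len v \<longleftrightarrow> complementary u v"
  using additive_imp_complementary complementary_imp_additive by blast

section \<open>The order relation and fixed spaces\<close>

lemma belowI: "u \<in> G \<Longrightarrow> v \<in> G \<Longrightarrow> len (u \<circ> v) = len u + len v \<Longrightarrow> below u (u \<circ> v)"
  by (simp add: below_def abs_le_def)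

lemma belowE:
  assumes "below u w"
  obtains v where "u \<in> G" "v \<in> G" "w \<in> G" "w = u \<circ> v" "len w = len u + len v" "complementary u v"
proof -
  have *: "u \<in> G" "w \<in> G" "inv u \<circ> w \<in> G" "w = u \<circ> (inv u \<circ> w)" "len w = len u + len (inv u \<circ> w)"
    using assms by (auto simp: below_def abs_le_def)
  then have "complementary u (inv u \<circ> w)"
    using additive_iff_complementary[of u "inv u \<circ> w"] by metis
  with * that show ?thesis by blast
qed

lemma belowD: "below u w \<Longrightarrow> u \<in> G" "below u w \<Longrightarrow> w \<in> G"
  by (auto simp: below_def)

lemma below_complementary: "u \<in> G \<Longrightarrow> v \<in> G \<Longrightarrow> complementary u v \<Longrightarrow> below u (u \<circ> v)"
  by (simp add: belowI complementary_imp_additive)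

lemma below_refl: "w \<in> G \<Longrightarrow> below w w"
  using belowI[of w id] by simp

lemma below_id: "w \<in> G \<Longrightarrow> below id w"
  using belowI[of id w] by simp

lemma below_length: "below u w \<Longrightarrow> len u \<le> len w"
  by (erule belowE) simp

lemma below_trans:
  assumes "below u v" "below v w"
  shows "below u w"
proof -
  obtain a where a: "u \<in> G" "a \<in> G" "v = u \<circ> a" "len v = len u + len a"
    using belowE[OF assms(1)] by metis
  obtain b where b: "b \<in> G" "w = v \<circ> b" "len w = len v + len b"
    using belowE[OF assms(2)] by metis
  have w: "w = u \<circ> (a \<circ> b)"
    by (simp add: a b comp_assoc)
  have "len w \<le> len u + len (a \<circ> b)" "len (a \<circ> b) \<le> len a + len b"
    unfolding w using a b by (auto intro: abs_length_comp)
  then have "len (u \<circ> (a \<circ> b)) = len u + len (a \<circ> b)"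
    using a(4) b(3) unfolding w by linarith
  then show ?thesis
    unfolding w using a b by (intro belowI) auto
qed

lemma below_length_eq:
  assumes "below u w" "len w \<le> len u"
  shows "u = w"
proof -
  obtain v where "v \<in> G" "w = u \<circ> v" "len w = len u + len v"
    using belowE[OF assms(1)] by metis
  with assms(2) abs_length_0[of v] show ?thesis by simp
qed

lemma below_antisym: "below u w \<Longrightarrow> below w u \<Longrightarrow> u = w"
  using below_length_eq below_length by blast

lemma complementary_orthogonal:
  assumes "complementary u v" "d \<in> V"
    and "\<And>g. g \<in> Inv u \<Longrightarrow> ip d g = 0" "\<And>h. h \<in> Inv v \<Longrightarrow> ip d h = 0"
  shows "d x = 0"
proof -
  obtain g h where gh: "g \<in> Inv u" "h \<in> Inv v" "\<And>x. d x = g x + h x"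
    using complementaryE[OF assms(1,2)] by blast
  have d: "(\<lambda>x. g x + h x) = d"
    using gh(3) by (intro ext) (rule sym)
  have "ip d d = ip d g + ip d h"
    using ip_lin(4)[of d g h] unfolding d .
  also have "\<dots> = 0"
    using assms(3)[OF gh(1)] assms(4)[OF gh(2)] by simp
  finally show ?thesis
    by (rule ip_definite[OF assms(2)])
qed

text \<open>If \<open>f\<close> is fixed by \<open>u \<circ> v\<close>, then
  \<open>f \<circ> u - f = f \<circ> inv v - f\<close>. As a coboundary of both \<open>u\<close> and
  \<open>inv v\<close> this function is orthogonal to both fixed spaces, which together span
  everything, so it vanishes.\<close>

lemma complementary_invariants:
  assumes "u \<in> G" "v \<in> G" "complementary u v"
  shows "Inv (u \<circ> v) = Inv u \<inter> Inv v"
proof (intro equalityI subsetI)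
  fix f assume f: "f \<in> Inv (u \<circ> v)"
  then have fV: "f \<in> V"
    using invariantsD(1) by blast
  define d where "d x = f (u x) - f x" for x
  have "d x = f (inv v x) - f x" for x
    using invariantsD(2)[OF f, of "inv v x"] inv_comp_hyperoctahedral(4)[OF assms(2), of x]
    by (simp add: d_def)
  then have d_eq: "d = (\<lambda>x. f (inv v x) - f x)"
    by (intro ext)
  have dV: "d \<in> V"
    unfolding d_def by (rule odd_funs_lin(2)[OF odd_funs_comp[OF fV assms(1)] fV])
  have "ip d g = 0" if "g \<in> Inv u" for g
    unfolding d_def by (rule ip_coboundary[OF assms(1) fV that])
  moreover have "ip d h = 0" if "h \<in> Inv v" for h
    unfolding d_eq using that assms(2)
    by (intro ip_coboundary fV) (simp_all add: invariants_inv)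
  ultimately have "d x = 0" for x
    by (rule complementary_orthogonal[OF assms(3) dV])
  then have "f (u x) = f x" for x
    by (simp add: d_def)
  then have "f \<in> Inv u"
    using fV by (simp add: invariants_def)
  moreover from f this have "f \<in> Inv v"
    by (rule invariants_cancel_left)
  ultimately show "f \<in> Inv u \<inter> Inv v"
    by (rule IntI)
next
  fix f assume "f \<in> Inv u \<inter> Inv v"
  then show "f \<in> Inv (u \<circ> v)"
    by (intro invariants_comp) auto
qed

lemma below_invariants:
  assumes "below u w"
  shows "Inv w \<subseteq> Inv u"
proof -
  obtain v where "u \<in> G" "v \<in> G" "w = u \<circ> v" "complementary u v"
    using belowE[OF assms] by metis
  then show ?thesis
    using complementary_invariants[of u v] by blast
qed

lemma below_eqv: "below u w \<Longrightarrow> eqv u a b \<Longrightarrow> eqv w a b"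
  using below_invariants unfolding eqv_def by blast

lemma abs_length_sswap_eq: "a \<in> X \<Longrightarrow> b \<in> X \<Longrightarrow> a \<noteq> b \<Longrightarrow> len (sswap a b) = 1"
  using abs_length_sswap_comp(2)[OF id_hyperoctahedral, of a b] not_eqv_id by simp

lemma sswap_below_iff:
  assumes "w \<in> G" "a \<in> X" "b \<in> X" "a \<noteq> b"
  shows "below (sswap a b) w \<longleftrightarrow> eqv w a b"
proof
  assume "eqv w a b"
  then have "len w = Suc (len (sswap a b \<circ> w))"
    using abs_length_sswap_comp assms by blast
  then have "below (sswap a b) (sswap a b \<circ> (sswap a b \<circ> w))"
    using abs_length_sswap_eq[OF assms(2-4)] assms sswap_sswap_comp[OF assms(2,3), of w]
    by (intro belowI) auto
  then show "below (sswap a b) w"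
    unfolding sswap_sswap_comp[OF assms(2,3), of w] .
next
  assume "below (sswap a b) w"
  moreover have "eqv (sswap a b) a b"
    unfolding eqv_def
  proof
    fix f assume "f \<in> Inv (sswap a b)"
    from invariantsD(2)[OF this, of a] show "f a = f b" by simp
  qed
  ultimately show "eqv w a b"
    using below_eqv by blast
qed

lemma sswap_comp_below:
  assumes "eqv w a b" "a \<in> X" "b \<in> X" "a \<noteq> b" "below u (sswap a b \<circ> w)" "w \<in> G"
  shows "below (sswap a b \<circ> u) w"
proof -
  obtain v where v: "u \<in> G" "v \<in> G" "sswap a b \<circ> w = u \<circ> v" "len (sswap a b \<circ> w) = len u + len v"
    using belowE[OF assms(5)] by metis
  have w: "w = (sswap a b \<circ> u) \<circ> v"
    using v(3) sswap_sswap_comp[OF assms(2,3), of w] by (simp add: comp_assoc)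
  have "len w = Suc (len u + len v)"
    using v abs_length_sswap_comp(1) assms by simp
  moreover have "len w \<le> len (sswap a b \<circ> u) + len v"
    unfolding w using v assms by (intro abs_length_comp) auto
  moreover have "len (sswap a b \<circ> u) \<le> Suc (len u)"
    using abs_length_comp[of "sswap a b" u] v abs_length_sswap_eq assms by simp
  ultimately have "len ((sswap a b \<circ> u) \<circ> v) = len (sswap a b \<circ> u) + len v"
    unfolding w[symmetric] by linarith
  then have "below (sswap a b \<circ> u) ((sswap a b \<circ> u) \<circ> v)"
    using v assms by (intro belowI) auto
  then show ?thesis
    unfolding w[symmetric] .
qed

text \<open>The Brady--Watt theorem: an element of an interval is determined by its fixed space.\<close>

lemma below_iff_invariants:
  assumes z: "below z w" and u: "below u w"
  shows "below z u \<longleftrightarrow> Inv u \<subseteq> Inv z"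
proof
  assume sub: "Inv u \<subseteq> Inv z"
  obtain z' where z': "z \<in> G" "z' \<in> G" "w = z \<circ> z'" "complementary z z'"
    using belowE[OF z] by metis
  obtain u' where u': "u \<in> G" "u' \<in> G" "w = u \<circ> u'" "complementary u u'"
    using belowE[OF u] by metis
  have wG: "w \<in> G"
    using z belowD by blast
  \<comment> \<open>The complements are ordered the other way round. For \<open>x\<close> in
    \<open>Inv z'\<close> let \<open>y = x \<circ> inv u'\<close>. Then \<open>y - x\<close> is
    orthogonal to \<open>Inv u'\<close> as a coboundary. Since
    \<open>y \<circ> inv u = x \<circ> inv w = x \<circ> inv z\<close>, it is also a difference of
    coboundaries of \<open>inv z\<close> and \<open>inv u\<close>, so it is orthogonal to
    \<open>Inv u\<close> as well.\<close>
  have sub': "Inv z' \<subseteq> Inv u'"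
  proof
    fix x assume x: "x \<in> Inv z'"
    then have xV: "x \<in> V"
      using invariantsD(1) by blast
    define y where "y p = x (inv u' p)" for p
    have yV: "y \<in> V"
      unfolding y_def by (rule odd_funs_comp[OF xV inv_hyperoctahedral[OF u'(2)]])
    have "inv w = inv u' \<circ> inv u"
      unfolding u'(3) by (intro o_inv_distrib hyperoctahedralD(1)[OF u'(1)] hyperoctahedralD(1)[OF u'(2)])
    then have yu: "y (inv u p) = x (inv w p)" for p
      by (simp add: y_def)
    have "inv w = inv z' \<circ> inv z"
      unfolding z'(3) by (intro o_inv_distrib hyperoctahedralD(1)[OF z'(1)] hyperoctahedralD(1)[OF z'(2)])
    then have zw: "inv w p = inv z' (inv z p)" for p
      by simp
    have xz: "x (inv w p) = x (inv z p)" for p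
    proof -
      have "x \<in> Inv (inv z')"
        using x z'(2) by (simp add: invariants_inv)
      then have "x (inv z' (inv z p)) = x (inv z p)"
        by (rule invariantsD(2))
      then show ?thesis
        unfolding zw .
    qed
    define d where "d p = y p - x p" for p
    have dV: "d \<in> V"
      unfolding d_def using xV yV by blast
    have "ip d g = 0" if g: "g \<in> Inv u" for g
    proof -
      have "g \<in> Inv (inv u)" "g \<in> Inv (inv z)"
        using g sub u'(1) z'(1) by (auto simp: invariants_inv)
      then have "ip (\<lambda>p. y (inv u p) - y p) g = 0" "ip (\<lambda>p. x (inv z p) - x p) g = 0"
        using u'(1) z'(1) by (simp_all add: ip_coboundary xV yV)
      then show ?thesis
        unfolding yu xz d_def ip_lin by linarith
    qed
    moreover have "ip d h = 0" if "h \<in> Inv u'" for h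
      unfolding d_def y_def using that u'(2) by (simp add: ip_coboundary xV invariants_inv)
    ultimately have "d p = 0" for p
      by (rule complementary_orthogonal[OF u'(4) dV])
    then have "x (inv u' p) = x p" for p
      by (simp add: d_def y_def)
    then have "x \<in> Inv (inv u')"
      using xV by (simp add: invariants_def)
    then show "x \<in> Inv u'"
      using u' by (simp add: invariants_inv)
  qed
  define v where "v = inv z \<circ> u"
  have vG: "v \<in> G" and uv: "u = z \<circ> v" 
    using z' u' by (auto simp: v_def)
  have "v \<circ> u' = inv z \<circ> (z \<circ> z')"
    unfolding v_def comp_assoc u'(3)[symmetric] z'(3)[symmetric] ..
  then have z'v: "z' = v \<circ> u'"
    using z'(1) by simp
  have "Inv z' \<subseteq> Inv v"
  proof
    fix x assume "x \<in> Inv z'"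
    with sub' show "x \<in> Inv v"
      using invariants_cancel_right[of x v u'] z'v u' by blast
  qed
  then have "complementary z v"
    using complementary_mono[OF z'(4)] by blast
  then show "below z u"
    unfolding uv using z' vG by (intro below_complementary) auto
qed (rule below_invariants)

text \<open>Along \<open>w = u \<circ> v\<close> an invariant of \<open>sswap i j \<circ> u\<close>
  splits into \<open>g\<close>, fixed by \<open>u\<close>, and \<open>h\<close>, fixed by
  \<open>sswap i j \<circ> w\<close>; both agree at \<open>k\<close> and \<open>l\<close>. Thus a
  product of two reflections below \<open>w\<close> is below each of their upper bounds.\<close>

lemma eqv_sswap_comp_down:
  assumes uw: "below u w" and ij: "i \<in> X" "j \<in> X" "i \<noteq> j" "eqv u i j"
    and kl: "eqv u k l" "eqv (sswap i j \<circ> w) k l"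
  shows "eqv (sswap i j \<circ> u) k l"
  unfolding eqv_def
proof
  fix f assume f: "f \<in> Inv (sswap i j \<circ> u)"
  obtain v where v: "u \<in> G" "v \<in> G" "w = u \<circ> v" "complementary u v"
    using belowE[OF uw] by metis
  obtain g h where gh: "g \<in> Inv u" "h \<in> Inv v" "\<And>x. f x = g x + h x"
    using complementaryE[OF v(4) invariantsD(1)[OF f]] by blast
  have "g \<in> Inv (sswap i j \<circ> u)"
    using gh(1) ij unfolding eqv_def by (intro invariants_sswap_comp) auto
  then have "(\<lambda>x. f x - g x) \<in> Inv (sswap i j \<circ> u)"
    using f by blast
  moreover have "h = (\<lambda>x. f x - g x)"
    using gh(3) by auto
  ultimately have "h \<in> Inv (sswap i j \<circ> u)"
    by (simp only:)
  from invariants_comp[OF this gh(2)] have "h \<in> Inv (sswap i j \<circ> w)"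
    by (simp add: v comp_assoc)
  then show "f k = f l"
    using kl gh unfolding eqv_def by metis
qed

text \<open>The fixed space of \<open>sswap i j \<circ> u\<close> contains that of \<open>u\<close>,
  so this element still complements \<open>v\<close> and stays below
  \<open>sswap i j \<circ> w\<close>.\<close>

lemma eqv_sswap_comp_up:
  assumes uw: "below u w" and ij: "i \<in> X" "j \<in> X" "i \<noteq> j" "eqv u i j"
    and kl: "eqv (sswap i j \<circ> u) k l"
  shows "eqv (sswap i j \<circ> w) k l"
proof -
  obtain v where v: "u \<in> G" "v \<in> G" "w = u \<circ> v" "complementary u v"
    using belowE[OF uw] by metis
  have "Inv u \<subseteq> Inv (sswap i j \<circ> u)"
    using ij unfolding eqv_def by (auto intro!: invariants_sswap_comp)
  then have "complementary (sswap i j \<circ> u) v"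
    using complementary_mono[OF v(4)] by blast
  then have "below (sswap i j \<circ> u) (sswap i j \<circ> u \<circ> v)"
    using v ij by (intro below_complementary) auto
  then have "below (sswap i j \<circ> u) (sswap i j \<circ> w)"
    by (simp add: v comp_assoc)
  then show ?thesis
    using kl by (rule below_eqv)
qed

end

section \<open>Restrictions and the Wall form\<close>

definition same_orbit :: "(int \<Rightarrow> int) \<Rightarrow> int \<Rightarrow> int \<Rightarrow> bool" where
  "same_orbit w a b \<longleftrightarrow> (\<exists>m. (w ^^ m) a = b)"

context signed_permutations
begin

lemma comp_sswap_below:
  assumes "w \<in> G" "a \<in> X" "b \<in> X" "a \<noteq> b" "eqv w a b"
  shows "below (w \<circ> sswap a b) w"
proof -
  have nz: "a \<noteq> 0" "b \<noteq> 0"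
    using assms nonzero_signed_points by blast+
  have "len w = len (w \<circ> sswap a b) + len (sswap a b)"
    using abs_length_comp_sswap(1)[OF assms] abs_length_sswap_eq[OF assms(2-4)] by simp
  then have "below (w \<circ> sswap a b) (w \<circ> sswap a b \<circ> sswap a b)"
    using assms nz by (intro belowI) auto
  then show ?thesis
    using nz by simp
qed

text \<open>As \<open>q\<close> is the predecessor of \<open>p\<close>,
  \<open>w \<circ> sswap p q\<close> is \<open>w\<close> with \<open>p\<close> cut out of its cycle,
  which leaves the remaining points of a balanced cycle balanced.\<close>

lemma eqv_comp_sswap_remove:
  assumes w: "w \<in> G" and p: "p \<in> X" "w p \<noteq> p" and q: "w q = p"
    and x: "eqv w x (- x)" "x \<noteq> p" "x \<noteq> - p"
  shows "eqv (w \<circ> sswap p q) x (- x)"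
  unfolding eqv_balanced_iff
proof
  note hw = hyperoctahedralD[OF w]
  fix f assume f: "f \<in> Inv (w \<circ> sswap p q)"
  have fV: "f \<in> V"
    using f invariantsD(1) by blast
  note odd = odd_funsD(1)[OF fV]
  have fw: "f (w (sswap p q y)) = f y" for y
    using invariantsD(2)[OF f, of y] by simp
  have p0: "p \<noteq> 0"
    using p nonzero_signed_points by blast
  have qp: "q \<noteq> p"
    using p q by auto
  \<comment> \<open>\<open>g\<close> will be \<open>f\<close> with its value at \<open>p\<close>
    replaced by the one at the predecessor \<open>q\<close>, which makes it invariant under
    \<open>w\<close>. If \<open>q = - p\<close>, the cycle is \<open>[p]\<close> and oddness allows
    only 0.\<close>
  define c where "c = (if q = - p then 0 else f q)"
  define g where "g y = f y - (f p - c) * rho p (- p) y" for y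
  have gV: "g \<in> V"
    unfolding g_def using fV p p0 by (intro odd_funs_lin rho_odd) auto
  have gp: "g p = c" "g (- p) = - c"
    using p0 odd by (auto simp: g_def rho_def)
  have gf: "g y = f y" if "y \<noteq> p" "y \<noteq> - p" for y
    using that by (simp add: g_def rho_def)
  have gq: "g (w q) = g q"
    using gp gf[of q] qp q by (auto simp: c_def)
  have gwp: "g (w p) = g p"
  proof (cases "q = - p")
    case True
    then have "w p = - p"
      using q hw(4)[of p] by simp
    with True gp show ?thesis by (simp add: c_def)
  next
    case False
    have "w p \<noteq> - p"
      using hw(4)[of q] hw(7)[of p "- q"] q False by auto
    then have "g (w p) = f (w p)"
      using gf p by blast
    also have "\<dots> = f q"
      using fw[of q] by simp
    finally show ?thesis
      using False gp by (simp add: c_def)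
  qed
  have "g (w y) = g y" for y
  proof -
    consider "y = p" | "y = q" | "y = - p" | "y = - q" | "y \<noteq> p" "y \<noteq> q" "y \<noteq> - p" "y \<noteq> - q"
      by blast
    then show ?thesis
    proof cases
      case 5
      have "w y \<noteq> p" "w y \<noteq> - p"
        using hw(7)[of y q] hw(7)[of y "- q"] hw(4)[of q] q 5 by auto
      then have "g (w y) = f (w y)"
        by (rule gf)
      also have "\<dots> = f y"
        using fw[of y] 5 by (simp add: sswap_fixes)
      also have "\<dots> = g y"
        using 5 gf by simp
      finally show ?thesis .
    qed (use gq gwp hw(4) odd_funsD(1)[OF gV] in simp_all)
  qed
  then have "g \<in> Inv w"
    using gV by (simp add: invariants_def)
  then have "g x = 0"
    using x(1) eqv_balanced_zero by blast
  then show "f x = 0"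
    using gf x by simp
qed

text \<open>Points outside \<open>I\<close> are cut out of their cycles one by one, and every cut
  goes down in the order. The clause on the sets \<open>A\<close> says that no cycles are merged; it
  keeps two balanced cycles apart in \<open>not_hook_imp_two_balanced\<close>.\<close>

lemma restriction_exists:
  assumes "w \<in> G" "\<And>x. x \<in> I \<Longrightarrow> - x \<in> I" "\<And>x. x \<in> I \<Longrightarrow> eqv w x (- x)"
  shows "\<exists>m. below m w \<and> (\<forall>x. x \<notin> I \<longrightarrow> m x = x) \<and> (\<forall>x\<in>I. eqv m x (- x)) \<and>
    (\<forall>x\<in>I. w x \<in> I \<longrightarrow> m x = w x) \<and>
    (\<forall>A. (\<forall>x\<in>A. - x \<in> A) \<longrightarrow> (\<forall>x. w x \<in> A \<longleftrightarrow> x \<in> A) \<longrightarrow> (\<forall>x. m x \<in> A \<longleftrightarrow> x \<in> A))"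
  using assms(1,3)
proof (induction "card {x. x \<notin> I \<and> w x \<noteq> x}" arbitrary: w rule: less_induct)
  case less
  note hw = hyperoctahedralD[OF less.prems(1)]
  show ?case
  proof (cases "\<exists>p. p \<notin> I \<and> w p \<noteq> p")
    case False
    then show ?thesis
      using less.prems below_refl by (intro exI[of _ w]) auto
  next
    case True
    then obtain p where p: "p \<notin> I" "w p \<noteq> p" by blast
    then have pX: "p \<in> X"
      using hw(3) by blast
    define q where "q = inv w p"
    have q: "w q = p"
      using less.prems(1) by (simp add: q_def)
    have qX: "q \<in> X"
      using hw(6)[of q] q pX by simp
    have qp: "q \<noteq> p"
      using q p by auto
    have nI: "- p \<notin> I"
      using p(1) assms(2)[of "- p"] by auto
    have p0: "p \<noteq> 0" "q \<noteq> 0"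
      using pX qX nonzero_signed_points by blast+
    define v where "v = w \<circ> sswap p q"
    have vG: "v \<in> G"
      using less.prems(1) pX qX by (simp add: v_def)
    have v: "v p = p" "v (- p) = - p"
      using q hyperoctahedralD(4)[OF vG, of p] by (simp_all add: v_def)
    have v_eq: "v x = w x" if "x \<noteq> p" "x \<noteq> - p" "x \<noteq> q" "x \<noteq> - q" for x
      using that by (simp add: v_def sswap_fixes)
    have wq: "w (- q) = - p"
      using hw(4) q by simp
    have "eqv w p q"
      unfolding eqv_def
    proof
      fix f assume "f \<in> Inv w"
      from invariantsD(2)[OF this, of q] show "f p = f q"
        using q by simp
    qed
    then have vw: "below v w"
      unfolding v_def using less.prems(1) pX qX qp by (intro comp_sswap_below) auto
    have "{x. x \<notin> I \<and> v x \<noteq> x} \<subseteq> {x. x \<notin> I \<and> w x \<noteq> x} - {p}"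
    proof
      fix x assume x: "x \<in> {x. x \<notin> I \<and> v x \<noteq> x}"
      then have "x \<noteq> p" "x \<noteq> - p"
        using v by auto
      moreover have "w x \<noteq> x"
        using x v_eq[of x] calculation q wq qp by (cases "x = q \<or> x = - q") auto
      ultimately show "x \<in> {x. x \<notin> I \<and> w x \<noteq> x} - {p}"
        using x by blast
    qed
    then have sub: "{x. x \<notin> I \<and> v x \<noteq> x} \<subset> {x. x \<notin> I \<and> w x \<noteq> x}"
      using p by blast
    have "finite {x. x \<notin> I \<and> w x \<noteq> x}"
      using hw(3) by (intro finite_subset[OF _ finite_signed_points]) blast
    then have "card {x. x \<notin> I \<and> v x \<noteq> x} < card {x. x \<notin> I \<and> w x \<noteq> x}"
      using sub by (rule psubset_card_mono)
    moreover have "eqv v x (- x)" if "x \<in> I" for x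
      unfolding v_def using that less.prems p nI pX q by (intro eqv_comp_sswap_remove) auto
    ultimately have "\<exists>m. below m v \<and> (\<forall>x. x \<notin> I \<longrightarrow> m x = x) \<and> (\<forall>x\<in>I. eqv m x (- x)) \<and>
      (\<forall>x\<in>I. v x \<in> I \<longrightarrow> m x = v x) \<and>
      (\<forall>A. (\<forall>x\<in>A. - x \<in> A) \<longrightarrow> (\<forall>x. v x \<in> A \<longleftrightarrow> x \<in> A) \<longrightarrow> (\<forall>x. m x \<in> A \<longleftrightarrow> x \<in> A))"
      by (rule less.hyps[OF _ vG])
    then obtain m where m: "below m v" "\<forall>x. x \<notin> I \<longrightarrow> m x = x" "\<forall>x\<in>I. eqv m x (- x)"
      and m4: "\<forall>x\<in>I. v x \<in> I \<longrightarrow> m x = v x"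
      and m5: "\<forall>A. (\<forall>x\<in>A. - x \<in> A) \<longrightarrow> (\<forall>x. v x \<in> A \<longleftrightarrow> x \<in> A) \<longrightarrow> (\<forall>x. m x \<in> A \<longleftrightarrow> x \<in> A)"
      by (elim exE conjE)
    have "m x = w x" if "x \<in> I" "w x \<in> I" for x
    proof -
      have "x \<noteq> p" "x \<noteq> - p" "x \<noteq> q" "x \<noteq> - q"
        using that p(1) nI q wq by auto
      then have "v x = w x"
        by (rule v_eq)
      with that m4 show ?thesis by simp
    qed
    moreover have "\<forall>x. m x \<in> A \<longleftrightarrow> x \<in> A"
      if A: "\<forall>x\<in>A. - x \<in> A" "\<forall>x. w x \<in> A \<longleftrightarrow> x \<in> A" for A
    proof (rule m5[THEN spec, THEN mp, THEN mp, OF A(1)], rule allI)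
      fix x
      have min: "- y \<in> A \<longleftrightarrow> y \<in> A" for y
        using A(1) by force
      have "q \<in> A \<longleftrightarrow> p \<in> A"
        using A(2) q by metis
      then have "sswap p q x \<in> A \<longleftrightarrow> x \<in> A"
        using min by (auto simp: sswap_def)
      then show "v x \<in> A \<longleftrightarrow> x \<in> A"
        using A(2) by (simp add: v_def)
    qed
    ultimately show ?thesis
      using m below_trans[OF m(1) vw] by (intro exI[of _ m]) blast
  qed
qed

section \<open>Orbits and balanced points\<close>

lemma same_orbit_refl: "same_orbit w a a"
  unfolding same_orbit_def by (intro exI[of _ 0]) simp

lemma same_orbit_image: "same_orbit w a (w a)"
  unfolding same_orbit_def by (intro exI[of _ 1]) simp

lemma same_orbit_trans:
  assumes "same_orbit w a b" "same_orbit w b c"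
  shows "same_orbit w a c"
proof -
  obtain k m where "(w ^^ k) a = b" "(w ^^ m) b = c"
    using assms unfolding same_orbit_def by blast
  then have "(w ^^ (m + k)) a = c"
    by (simp add: funpow_add)
  then show ?thesis
    unfolding same_orbit_def by blast
qed

lemma same_orbit_sym:
  assumes w: "w \<in> G" and "same_orbit w a b"
  shows "same_orbit w b a"
proof -
  obtain m where m: "(w ^^ m) a = b"
    using assms(2) unfolding same_orbit_def by blast
  obtain N where N: "w ^^ N = id" "N > m"
    using permutation_is_nilpotent'[OF hyperoctahedralD(8)[OF w]] by blast
  then have "(w ^^ (N - m)) b = a"
    using m funpow_add[of "N - m" m w] by (metis comp_apply id_apply le_add_diff_inverse2 less_imp_le)
  then show ?thesis
    unfolding same_orbit_def by blast
qed

lemma same_orbit_minus: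
  assumes "w \<in> G"
  shows "same_orbit w (- a) (- b) \<longleftrightarrow> same_orbit w a b"
proof -
  have "(w ^^ m) (- x) = - (w ^^ m) x" for m x
    by (induction m) (simp_all add: hyperoctahedralD(4)[OF assms])
  then show ?thesis
    by (simp add: same_orbit_def)
qed

lemma same_orbit_invariant:
  assumes "\<And>x. f (w x) = f x" "same_orbit w a b"
  shows "f b = f a"
proof -
  obtain m where m: "(w ^^ m) a = b"
    using assms(2) unfolding same_orbit_def by blast
  have "f ((w ^^ m) a) = f a"
    by (induction m) (simp_all add: assms(1))
  with m show ?thesis by simp
qed

lemma same_orbit_image_iff:
  assumes "w \<in> G"
  shows "same_orbit w a (w x) \<longleftrightarrow> same_orbit w a x"
  using same_orbit_image[of w x] same_orbit_sym[OF assms] same_orbit_trans by blast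

text \<open>When \<open>- a\<close> is not in the orbit of \<open>a\<close>, the orbit and its
  negative are disjoint, so a signed indicator function exists; it tells the orbit from all other
  points.\<close>

lemma paired_orbit_function:
  assumes w: "w \<in> G" and a: "a \<in> X" "\<not> same_orbit w a (- a)"
  obtains f where "f \<in> Inv w" "\<And>x. f x = 1 \<longleftrightarrow> same_orbit w a x"
proof -
  define f where "f x = (if same_orbit w a x then 1 else if same_orbit w a (- x) then - 1 else 0 :: real)" for x
  have not_both: "\<not> (same_orbit w a x \<and> same_orbit w a (- x))" for x
  proof
    assume "same_orbit w a x \<and> same_orbit w a (- x)"
    then have "same_orbit w a x" "same_orbit w (- a) x"
      using same_orbit_minus[OF w, of a "- x"] by auto
    then have "same_orbit w a (- a)"
      using same_orbit_sym[OF w] same_orbit_trans by blast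
    with a show False by blast
  qed
  have "x \<in> X" if "same_orbit w a x" for x
    using same_orbit_invariant[of "\<lambda>x. x \<in> X" w a x] that a hyperoctahedralD(6)[OF w] by simp
  then have "f \<in> V"
    using not_both uminus_signed_points by (fastforce simp: odd_funs_def f_def)
  moreover have "f (w x) = f x" for x
    using same_orbit_image_iff[OF w, of a x] same_orbit_image_iff[OF w, of a "- x"]
      hyperoctahedralD(4)[OF w, of x] by (simp add: f_def)
  ultimately have "f \<in> Inv w"
    by (simp add: invariants_def)
  moreover have "f x = 1 \<longleftrightarrow> same_orbit w a x" for x
    by (simp add: f_def)
  ultimately show ?thesis
    using that by blast
qed

lemma eqv_imp_same_orbit:
  assumes w: "w \<in> G" and a: "a \<in> X" and "\<not> same_orbit w a (- a)" "eqv w a b"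
  shows "same_orbit w a b"
proof -
  obtain f where f: "f \<in> Inv w" "\<And>x. f x = 1 \<longleftrightarrow> same_orbit w a x"
    using paired_orbit_function[OF w a assms(3)] by blast
  have "f a = 1"
    using f(2) same_orbit_refl by blast
  then have "f b = 1"
    using assms(4) f(1) unfolding eqv_def by force
  with f show ?thesis by blast
qed

lemma same_orbit_imp_eqv: "same_orbit w a b \<Longrightarrow> eqv w a b"
  unfolding eqv_def using same_orbit_invariant invariantsD(2) by metis

lemma balanced_iff_same_orbit:
  assumes "w \<in> G" "a \<in> X"
  shows "eqv w a (- a) \<longleftrightarrow> same_orbit w a (- a)"
  using assms eqv_imp_same_orbit same_orbit_imp_eqv by blast

text \<open>For \<open>a\<close> in a balanced cycle of \<open>w\<close>, \<open>wall w a x\<close> says that \<open>x\<close> is a preimage of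
  a multiple of the root \<open>e\<^sub>a\<close> under \<open>w - 1\<close>; then \<open>(a, b) \<mapsto> x b\<close> is the Wall form of \<open>w\<close>, which
  is compatible with the absolute order.\<close>

definition wall :: "(int \<Rightarrow> int) \<Rightarrow> int \<Rightarrow> (int \<Rightarrow> real) \<Rightarrow> bool" where
  "wall w a x \<longleftrightarrow> x \<in> V \<and> x a = 1 \<and> (\<forall>y. x (w y) = x y - 2 * rho a (- a) y)"

lemma wallD:
  assumes "wall w a x"
  shows "x \<in> V" "x a = 1" "x (w y) = x y - 2 * rho a (- a) y" "x (- y) = - x y"
  using assms odd_funsD(1) by (auto simp: wall_def)

lemma wall_exists:
  assumes "w \<in> G" "a \<in> X" "eqv w a (- a)"
  obtains x where "wall w a x"
proof -
  have a: "- a \<in> X" "a \<noteq> - a"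
    using assms(2) nonzero_signed_points[of a] by auto
  obtain x where x: "x \<in> V" "\<And>y. x (w y) = x y + rho a (- a) y" "x (- a) = x a + 1"
    using coboundary_rho[OF assms(1,2) a assms(3)] by blast
  \<comment> \<open>\<open>coboundary_rho\<close> gives \<open>x a = - 1 / 2\<close>; the factor -2
    scales this to 1.\<close>
  have "wall w a (\<lambda>y. (- 2) * x y)"
    unfolding wall_def using x odd_funsD(1)[OF x(1), of a] odd_funs_lin(3)[OF x(1), of "- 2"]
    by (simp add: algebra_simps)
  then show ?thesis using that by blast
qed

text \<open>\<open>x\<close> jumps only after \<open>a\<close> and \<open>- a\<close>, where the
  jumps by -2 and 2 exchange the values 1 and -1. So its square is invariant.\<close>

lemma wall_same_orbit:
  assumes "wall w a x" "same_orbit w a b"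
  shows "x b * x b = 1"
proof -
  have "x (w y) * x (w y) = x y * x y" for y
    using wallD[OF assms(1)] by (auto simp: rho_def)
  from same_orbit_invariant[of "\<lambda>y. x y * x y", OF this assms(2)] show ?thesis
    using wallD(2)[OF assms(1)] by simp
qed

text \<open>No jump of \<open>x\<close> occurs on the orbit of \<open>b\<close>, so \<open>x\<close>
  cut down to this orbit is an invariant of \<open>w\<close> and vanishes at the balanced point
  \<open>b\<close>.\<close>

lemma wall_other_orbit:
  assumes w: "w \<in> G" and x: "wall w a x" and b: "b \<in> X" "eqv w b (- b)" and "\<not> same_orbit w a b"
  shows "x b = 0"
proof -
  have bb: "same_orbit w b (- b)"
    using balanced_iff_same_orbit[OF w b(1)] b(2) by blast
  have neg: "same_orbit w b (- y)" if "same_orbit w b y" for y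
    using bb that same_orbit_minus[OF w, of b y] same_orbit_trans by blast
  have na: "\<not> same_orbit w b a" "\<not> same_orbit w b (- a)"
    using assms(5) same_orbit_sym[OF w] neg[of "- a"] by auto
  define h where "h y = (if same_orbit w b y then x y else 0)" for y
  have "same_orbit w b (- y) \<longleftrightarrow> same_orbit w b y" for y
    using neg[of y] neg[of "- y"] by auto
  then have "h \<in> V"
    using wallD(1)[OF x] by (auto simp: h_def odd_funs_def)
  moreover have "h (w y) = h y" for y
    using same_orbit_image_iff[OF w, of b y] wallD(3)[OF x, of y] na by (auto simp: h_def rho_def)
  ultimately have "h \<in> Inv w"
    by (simp add: invariants_def)
  then have "h b = 0"
    using b(2) eqv_balanced_zero by blast
  then show ?thesis
    using same_orbit_refl by (simp add: h_def)
qed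

lemma wall_nonzero_iff:
  assumes "w \<in> G" "wall w a x" "b \<in> X" "eqv w b (- b)"
  shows "x b \<noteq> 0 \<longleftrightarrow> same_orbit w a b"
  using wall_same_orbit[OF assms(2)] wall_other_orbit[OF assms] by force

text \<open>The symmetric part of the Wall form is the inner product up to scaling, and the roots of
  \<open>[a]\<close> and \<open>[b]\<close> are orthogonal. Concretely, expand the invariance of
  \<open>ip x y\<close> under \<open>w\<close>.\<close>

lemma wall_antisym:
  assumes w: "w \<in> G" and a: "a \<in> X" "wall w a x" and b: "b \<in> X" "wall w b y"
    and ab: "a \<noteq> b" "a \<noteq> - b"
  shows "x b = - y a"
proof -
  have nz: "a \<noteq> - a" "b \<noteq> - b" "- a \<in> X" "- b \<in> X"
    using a(1) b(1) nonzero_signed_points[of a] nonzero_signed_points[of b] by auto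
  note rV = rho_odd[OF a(1) nz(3) nz(1)] rho_odd[OF b(1) nz(4) nz(2)]
  have ipr: "ip x (rho b (- b)) = 2 * x b" "ip y (rho a (- a)) = 2 * y a"
      "ip (rho a (- a)) (rho b (- b)) = 0"
    using ip_rho[OF wallD(1)[OF a(2)] b(1) nz(4) nz(2)] ip_rho[OF wallD(1)[OF b(2)] a(1) nz(3) nz(1)]
      ip_rho[OF rV(1) b(1) nz(4) nz(2)] wallD(4)[OF a(2), of b] wallD(4)[OF b(2), of a] ab
    by (auto simp: rho_def)
  have "ip x y = ip (\<lambda>p. x p - 2 * rho a (- a) p) (\<lambda>p. y p - 2 * rho b (- b) p)"
    using ip_comp[OF w, of x y] wallD(3)[OF a(2)] wallD(3)[OF b(2)] by simp
  also have "\<dots> = ip x y - 2 * ip x (rho b (- b)) - 2 * ip y (rho a (- a))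
      + 4 * ip (rho a (- a)) (rho b (- b))"
    unfolding ip_lin ip_sym[of "rho a (- a)" y] by (simp add: algebra_simps)
  finally show ?thesis
    using ipr by simp
qed

text \<open>Write \<open>x = h + g\<close> with \<open>h\<close> fixed by \<open>z\<close> and
  \<open>g\<close> by \<open>v\<close>. Then \<open>h\<close> has the jumps of \<open>x'\<close>
  under \<open>z \<circ> v\<close>, so \<open>h - x'\<close> is fixed by \<open>z \<circ> v\<close>
  and hence by \<open>v\<close>. Both \<open>g\<close> and \<open>h - x'\<close> vanish at points
  balanced for \<open>v\<close>.\<close>

lemma wall_right_factor:
  assumes z: "z \<in> G" and v: "v \<in> G" and compl: "complementary z v"
    and x: "wall v a x" and x': "wall (z \<circ> v) a x'" and b: "eqv v b (- b)"
  shows "x b = x' b"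
proof -
  obtain g h where gh: "h \<in> Inv z" "g \<in> Inv v" "\<And>p. x p = h p + g p"
    using complementaryE[OF compl wallD(1)[OF x]] by blast
  have "h (z (v p)) = h p - 2 * rho a (- a) p" for p
    using invariantsD(2)[OF gh(1), of "v p"] invariantsD(2)[OF gh(2), of p] gh(3)[of "v p"] gh(3)[of p]
      wallD(3)[OF x, of p] by simp
  then have "h ((z \<circ> v) p) - x' ((z \<circ> v) p) = h p - x' p" for p
    using wallD(3)[OF x', of p] by simp
  moreover have "(\<lambda>p. h p - x' p) \<in> V"
    using invariantsD(1)[OF gh(1)] wallD(1)[OF x'] by blast
  ultimately have "(\<lambda>p. h p - x' p) \<in> Inv (z \<circ> v)"
    by (simp add: invariants_def)
  then have "(\<lambda>p. h p - x' p) \<in> Inv v"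
    using complementary_invariants[OF z v compl] by blast
  from eqv_balanced_zero[OF b this] eqv_balanced_zero[OF b gh(2)] show ?thesis
    using gh(3)[of b] by simp
qed

text \<open>For a balanced point, \<open>w a \<noteq> - a\<close> says that its cycle has length at
  least 2. So at most one balanced cycle is longer than 1.\<close>

definition hook :: "(int \<Rightarrow> int) \<Rightarrow> bool" where
  "hook w \<longleftrightarrow> (\<forall>a\<in>X. \<forall>b\<in>X. eqv w a (- a) \<longrightarrow> eqv w b (- b) \<longrightarrow> w a \<noteq> - a \<longrightarrow> w b \<noteq> - b
      \<longrightarrow> same_orbit w a b)"

section \<open>Heredity of the hook property\<close>

lemma balanced_not_fixed:
  assumes "w \<in> G" "a \<in> X" "eqv w a (- a)"
  shows "w a \<noteq> a"
proof
  assume "w a = a"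
  then have "(w x = a) = (x = a)" for x
    using hyperoctahedralD(7)[OF assms(1), of x a] by simp
  moreover have "same_orbit w a (- a)"
    using balanced_iff_same_orbit[OF assms(1,2)] assms(3) by blast
  ultimately have "(- a = a) = (a = a)"
    by (rule same_orbit_invariant)
  then show False
    using nonzero_signed_points[OF assms(2)] by simp
qed

lemma big_orbit:
  assumes w: "w \<in> G" and "same_orbit w a b" "b \<noteq> a" "b \<noteq> - a"
  shows "w a \<noteq> - a"
proof
  assume wa: "w a = - a"
  then have "w (- a) = a"
    using hyperoctahedralD(4)[OF w, of a] by simp
  then have "(w x = a \<or> w x = - a) = (x = a \<or> x = - a)" for x
    using wa hyperoctahedralD(7)[OF w, of x a] hyperoctahedralD(7)[OF w, of x "- a"] by auto
  from same_orbit_invariant[of "\<lambda>x. x = a \<or> x = - a", OF this assms(2)] show False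
    using assms by simp
qed

text \<open>The nonzero Wall entry at \<open>a\<close> and \<open>v a\<close> survives in
  \<open>z \<circ> v\<close>, so long balanced cycles of \<open>v\<close> lie in long ones of
  \<open>z \<circ> v\<close>. There they share one cycle, and the resulting nonzero entry at
  \<open>a\<close> and \<open>b\<close> is carried back to \<open>v\<close>.\<close>

lemma hook_right_factor:
  assumes z: "z \<in> G" and v: "v \<in> G" and compl: "complementary z v" and hook: "hook (z \<circ> v)"
  shows "hook v"
  unfolding hook_def
proof (intro ballI impI)
  let ?w = "z \<circ> v"
  have w: "?w \<in> G" using z v by simp
  have bal: "eqv ?w a (- a)" if "eqv v a (- a)" for a
    using that complementary_invariants[OF z v compl] by (auto simp: eqv_def)
  have big: "?w a \<noteq> - a" if a: "a \<in> X" "eqv v a (- a)" "v a \<noteq> - a" for a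
  proof -
    obtain x where x: "wall v a x"
      using wall_exists[OF v a(1,2)] by blast
    obtain x' where x': "wall ?w a x'"
      using wall_exists[OF w a(1) bal[OF a(2)]] by blast
    have va: "v a \<in> X" "eqv v (v a) (- v a)"
    proof -
      show "v a \<in> X"
        using a(1) hyperoctahedralD(6)[OF v] by blast
      show "eqv v (v a) (- v a)"
        unfolding eqv_balanced_iff
      proof
        fix f assume f: "f \<in> Inv v"
        show "f (v a) = 0"
          using invariantsD(2)[OF f, of a] eqv_balanced_zero[OF a(2) f] by simp
      qed
    qed
    have "x (v a) \<noteq> 0"
      using wall_nonzero_iff[OF v x va] same_orbit_image by blast
    then have "x' (v a) \<noteq> 0"
      using wall_right_factor[OF z v compl x x' va(2)] by simp
    then have "same_orbit ?w a (v a)"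
      using wall_nonzero_iff[OF w x' va(1) bal[OF va(2)]] by blast
    then show ?thesis
      using big_orbit[OF w] balanced_not_fixed[OF v a(1,2)] a(3) by blast
  qed
  fix a b assume a: "a \<in> X" "eqv v a (- a)" "v a \<noteq> - a" and b: "b \<in> X" "eqv v b (- b)" "v b \<noteq> - b"
  obtain x where x: "wall v a x"
    using wall_exists[OF v a(1,2)] by blast
  obtain x' where x': "wall ?w a x'"
    using wall_exists[OF w a(1) bal[OF a(2)]] by blast
  have "same_orbit ?w a b"
    using hook big[OF a] big[OF b] bal[OF a(2)] bal[OF b(2)] a(1) b(1) unfolding hook_def by blast
  then have "x' b \<noteq> 0"
    using wall_nonzero_iff[OF w x' b(1) bal[OF b(2)]] by blast
  then have "x b \<noteq> 0"
    using wall_right_factor[OF z v compl x x' b(2)] by simp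
  then show "same_orbit v a b"
    using wall_nonzero_iff[OF v x b(1,2)] by blast
qed

end

section \<open>Crossing reflections\<close>

context signed_permutations
begin

text \<open>A step of the walk along the orbit is disturbed only if \<open>r\<close> moves the point
  it arrives at; hence the start \<open>p\<close> is exempt.\<close>

lemma arc_constant:
  assumes f: "f \<in> Inv (r \<circ> u)" and "p \<le> q"
    and "\<And>m. p < m \<Longrightarrow> m \<le> q \<Longrightarrow> r ((u ^^ m) i) = (u ^^ m) i"
  shows "f ((u ^^ p) i) = f ((u ^^ q) i)"
  using assms(2,3)
proof (induction q rule: dec_induct)
  case (step m)
  have "f ((r \<circ> u) ((u ^^ m) i)) = f ((u ^^ m) i)"
    by (rule invariantsD(2)[OF f])
  moreover have "r ((u ^^ Suc m) i) = (u ^^ Suc m) i"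
    using step.prems[of "Suc m"] step.hyps by simp
  moreover have "f ((u ^^ p) i) = f ((u ^^ m) i)"
    using step.IH step.prems by simp
  ultimately show ?case by simp
qed simp

text \<open>The product is the paired 4-cycle \<open>((i, k, j, l))\<close>; its steps from
  \<open>l\<close>, \<open>j\<close> and \<open>k\<close> already identify all four values.\<close>

lemma invariants_sswap_product:
  assumes "i \<in> X" "j \<in> X" "k \<in> X" "l \<in> X" "distinct [i, j, k, l]"
    and "i \<noteq> - j" "i \<noteq> - k" "i \<noteq> - l" "j \<noteq> - k" "j \<noteq> - l" "k \<noteq> - l"
  shows "Inv (sswap i k \<circ> (sswap k j \<circ> sswap j l)) = {f \<in> V. f i = f j \<and> f i = f k \<and> f i = f l}"
    (is "Inv ?z = ?F")
proof (intro equalityI subsetI)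
  fix f assume f: "f \<in> Inv ?z"
  have "sswap k j l = l" "sswap i k l = l" "sswap j l k = k" "sswap i k j = j"
    by (rule sswap_fixes; use assms(5-11) in auto)+
  then have "?z l = i" "?z j = l" "?z k = j"
    by simp_all
  then have "f i = f l" "f l = f j" "f j = f k"
    using invariantsD(2)[OF f, of l] invariantsD(2)[OF f, of j] invariantsD(2)[OF f, of k] by simp_all
  then show "f \<in> ?F"
    using invariantsD(1)[OF f] by simp
next
  fix f assume f: "f \<in> ?F"
  then show "f \<in> Inv ?z"
    using assms by (intro invariants_comp invariants_sswap) auto
qed

section \<open>Arcs of a paired cycle\<close>

context
  fixes u :: "int \<Rightarrow> int" and i :: int
  assumes u: "u \<in> G" and i: "i \<in> X" and paired: "\<not> same_orbit u i (- i)"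
begin

abbreviation period where "period \<equiv> least_power u i"
abbreviation pt where "pt m \<equiv> (u ^^ m) i"

lemma period: "pt period = i" "period > 0"
  using least_power_of_permutation[OF hyperoctahedralD(8)[OF u]] by auto

lemma pt_inj:
  assumes "p < period" "q < period"
  shows "pt p = pt q \<longleftrightarrow> p = q"
proof
  assume eq: "pt p = pt q"
  have "distinct (map pt [0..<period])"
    by (rule cycle_of_permutation[OF hyperoctahedralD(8)[OF u]])
  then have "inj_on pt {0..<period}"
    by (simp add: distinct_map)
  then show "p = q"
    using eq assms by (auto dest: inj_onD)
qed simp

lemma pt_exists:
  assumes "same_orbit u i x"
  obtains p where "p < period" "x = pt p"
proof -
  obtain m where m: "pt m = x"
    using assms unfolding same_orbit_def by blast
  then have "x \<in> set (support u i)"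
    unfolding support_set[OF hyperoctahedralD(8)[OF u]] by blast
  then show ?thesis
    using that by auto
qed

lemma pt_not_minus: "pt p \<noteq> - pt q"
proof
  assume eq: "pt p = - pt q"
  have "same_orbit u i (pt p)" "same_orbit u i (pt q)"
    by (auto simp: same_orbit_def)
  then have "same_orbit u i (pt p)" "same_orbit u (- i) (pt p)"
    using same_orbit_minus[OF u, of i "pt q"] eq by auto
  then show False
    using same_orbit_sym[OF u] same_orbit_trans paired by blast
qed

lemma pt_signed: "pt p \<in> X"
proof -
  have "same_orbit u i (pt p)"
    by (auto simp: same_orbit_def)
  then show ?thesis
    using same_orbit_invariant[of "\<lambda>x. x \<in> X" u i "pt p"] hyperoctahedralD(6)[OF u] i by simp
qed

lemma sswap_pt:
  assumes "a < period" "b < period" "m < period" "m \<noteq> a" "m \<noteq> b"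
  shows "sswap (pt a) (pt b) (pt m) = pt m"
  using assms pt_inj pt_not_minus by (intro sswap_fixes) auto

text \<open>The reflection on the left cuts the cycle just before \<open>pt a\<close> and just
  before \<open>pt b\<close>. An arc survives unless such an index lies strictly after its start and
  not after its end.\<close>

lemma eqv_arc:
  assumes "p \<le> q" "q < period" "a < period" "b < period"
    and "a \<le> p \<or> q < a" "b \<le> p \<or> q < b"
  shows "eqv (sswap (pt a) (pt b) \<circ> u) (pt p) (pt q)"
  unfolding eqv_def
proof
  fix f assume "f \<in> Inv (sswap (pt a) (pt b) \<circ> u)"
  then show "f (pt p) = f (pt q)"
    by (rule arc_constant) (use assms in \<open>auto intro!: sswap_pt\<close>)
qed

text \<open>The last step of this arc arrives at \<open>i = pt 0\<close>, hence neither cut may have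
  index 0.\<close>

lemma eqv_arc_wrap:
  assumes "p < period" "0 < a" "a \<le> p" "0 < b" "b \<le> p"
  shows "eqv (sswap (pt a) (pt b) \<circ> u) (pt p) i"
  unfolding eqv_def
proof
  fix f assume f: "f \<in> Inv (sswap (pt a) (pt b) \<circ> u)"
  have "f (pt p) = f (pt period)"
  proof (rule arc_constant[OF f])
    fix m assume m: "p < m" "m \<le> period"
    show "sswap (pt a) (pt b) (pt m) = pt m"
    proof (cases "m = period")
      case True
      then have "pt m = pt 0"
        using period by simp
      then show ?thesis
        using sswap_pt[of a b 0] assms period by simp
    qed (use m assms sswap_pt in auto)
  qed (use assms in simp)
  then show "f (pt p) = f i"
    using period by simp
qed

text \<open>The hypotheses force the order \<open>i, k, j, l\<close> on the cycle. The needed arcs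
  then avoid the cuts, and the 4-cycle through the points in this order is obtained below
  \<open>u\<close> by adding one reflection at a time.\<close>

lemma crossing_aux:
  assumes jkl: "j = pt a" "k = pt b" "l = pt c" and less: "b < a" "a \<le> c" "c < period"
    and ne: "sswap i j \<noteq> sswap k l" and neqv: "\<not> eqv (sswap k l \<circ> u) i j"
  shows "eqv (sswap i k \<circ> u) j l \<and> eqv (sswap i l \<circ> u) j k \<and> distinct [i, j, k, l] \<and>
    (\<exists>z. below z u \<and> Inv z = {f \<in> V. f i = f j \<and> f i = f k \<and> f i = f l})"
proof -
  have i0: "i = pt 0" by simp
  \<comment> \<open>If \<open>k = i\<close>, the two chords coincide or \<open>{k, l}\<close> leaves
    the arc from \<open>i\<close> to \<open>j\<close> uncut.\<close>
  have b: "0 < b"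
  proof (rule ccontr)
    assume "\<not> 0 < b"
    then have b0: "b = 0" by simp
    show False
    proof (cases "a = c")
      case True
      then show False
        using ne jkl b0 by simp
    next
      case False
      have "eqv (sswap (pt 0) (pt c) \<circ> u) (pt 0) (pt a)"
        using less False by (intro eqv_arc) auto
      then show False
        using neqv jkl b0 by simp
    qed
  qed
  \<comment> \<open>If \<open>l = j\<close>, the arc from \<open>j\<close> onwards to
    \<open>i\<close> is not cut by \<open>{k, l}\<close>.\<close>
  have ac: "a < c"
  proof (rule ccontr)
    assume "\<not> a < c"
    then have "a = c" using less by simp
    then have "eqv (sswap k l \<circ> u) j i"
      unfolding jkl using less b by (intro eqv_arc_wrap) auto
    with neqv eqv_sym show False by blast
  qed
  have lt: "b < period" "a < period" "0 < period"
    using less by auto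
  have dist: "i \<noteq> j" "i \<noteq> k" "i \<noteq> l" "j \<noteq> k" "j \<noteq> l" "k \<noteq> l"
    unfolding jkl using pt_inj[of 0] pt_inj[of a b] pt_inj[of a c] pt_inj[of b c] lt less ac b by auto
  have neg: "i \<noteq> - j" "i \<noteq> - k" "i \<noteq> - l" "j \<noteq> - k" "j \<noteq> - l" "k \<noteq> - l"
    unfolding jkl using pt_not_minus[of 0] pt_not_minus by auto
  have X4: "i \<in> X" "j \<in> X" "k \<in> X" "l \<in> X"
    unfolding jkl using i pt_signed by auto
  have "eqv (sswap (pt 0) (pt b) \<circ> u) (pt a) (pt c)"
    using less lt b by (intro eqv_arc) auto
  then have e1: "eqv (sswap i k \<circ> u) j l"
    by (simp add: jkl)
  have "eqv (sswap (pt 0) (pt c) \<circ> u) (pt b) (pt a)"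
    using less lt b ac by (intro eqv_arc) auto
  then have e2: "eqv (sswap i l \<circ> u) j k"
    using eqv_sym by (simp add: jkl)
  have "eqv (sswap (pt 0) (pt b) \<circ> u) (pt b) (pt a)"
    using less lt b by (intro eqv_arc) auto
  then have e3: "eqv (sswap i k \<circ> u) k j"
    by (simp add: jkl)
  have e4: "eqv (sswap k j \<circ> (sswap i k \<circ> u)) j l"
    unfolding eqv_def
  proof
    fix f assume "f \<in> Inv (sswap k j \<circ> (sswap i k \<circ> u))"
    then have f: "f \<in> Inv (sswap k j \<circ> sswap i k \<circ> u)"
      by (simp add: comp_assoc)
    show "f j = f l"
      unfolding jkl
    proof (rule arc_constant[OF f])
      fix m assume m: "a < m" "m \<le> c"
      have "sswap (pt 0) (pt b) (pt m) = pt m" "sswap (pt b) (pt a) (pt m) = pt m"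
        using sswap_pt[of 0 b m] sswap_pt[of b a m] m less lt b by simp_all
      then show "(sswap k j \<circ> sswap i k) (pt m) = pt m"
        by (simp add: jkl)
    qed (use less in simp)
  qed
  have "eqv u i k"
    unfolding jkl by (rule same_orbit_imp_eqv) (auto simp: same_orbit_def)
  then have "below (sswap i k \<circ> (sswap k j \<circ> sswap j l)) u"
    using u X4 dist e3 e4 by (intro sswap_comp_below sswap_below_iff[THEN iffD2]) auto
  moreover have "Inv (sswap i k \<circ> (sswap k j \<circ> sswap j l)) = {f \<in> V. f i = f j \<and> f i = f k \<and> f i = f l}"
    using X4 dist neg by (intro invariants_sswap_product) auto
  ultimately show ?thesis
    using e1 e2 dist by auto
qed

end

text \<open>Two reflections whose supports lie in one paired cycle of \<open>u\<close>, and whose product in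
  neither order is below \<open>u\<close>, are crossing chords \<open>{i, j}\<close>, \<open>{k, l}\<close> of that cycle.\<close>

lemma crossing:
  assumes u: "u \<in> G" and X4: "i \<in> X" "j \<in> X" "k \<in> X" "l \<in> X"
    and paired: "\<not> eqv u i (- i)" and eqv: "eqv u i j" "eqv u i k" "eqv u i l"
    and ij: "i \<noteq> j" and kl: "k \<noteq> l" and ne: "sswap i j \<noteq> sswap k l"
    and neqv: "\<not> eqv (sswap i j \<circ> u) k l" "\<not> eqv (sswap k l \<circ> u) i j"
  shows "eqv (sswap i k \<circ> u) j l \<and> eqv (sswap i l \<circ> u) j k \<and> distinct [i, j, k, l] \<and>
    (\<exists>z. below z u \<and> Inv z = {f \<in> V. f i = f j \<and> f i = f k \<and> f i = f l})"
proof -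
  have so: "\<not> same_orbit u i (- i)"
    using paired balanced_iff_same_orbit[OF u X4(1)] by blast
  have orb: "same_orbit u i x" if "eqv u i x" for x
    using eqv_imp_same_orbit[OF u X4(1) so that] .
  obtain a where a: "a < least_power u i" "j = (u ^^ a) i"
    using pt_exists[OF u X4(1) so orb[OF eqv(1)]] .
  obtain b where b: "b < least_power u i" "k = (u ^^ b) i"
    using pt_exists[OF u X4(1) so orb[OF eqv(2)]] .
  obtain c where c: "c < least_power u i" "l = (u ^^ c) i"
    using pt_exists[OF u X4(1) so orb[OF eqv(3)]] .
  have arc: "eqv (sswap i j \<circ> u) ((u ^^ p) i) ((u ^^ q) i)"
    if "p \<le> q" "q < least_power u i" "a \<le> p \<or> q < a" for p q
    using eqv_arc[OF u X4(1) so that(1,2), of 0 a] that a by simp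
  \<comment> \<open>The chord \<open>{i, j}\<close> separates the indices below \<open>a\<close>
    from the others; \<open>k\<close> and \<open>l\<close> on the same side would be joined by an
    uncut arc.\<close>
  have same_side: False if "(b < a \<and> c < a) \<or> (a \<le> b \<and> a \<le> c)"
  proof (cases "b \<le> c")
    case True
    then show False
      using arc[of b c] that b c neqv(1) by auto
  next
    case False
    then show False
      using arc[of c b] that b c neqv(1) eqv_sym by auto
  qed
  have nz: "k \<noteq> 0" "l \<noteq> 0"
    using X4 nonzero_signed_points by blast+
  show ?thesis
  proof (cases "b < a")
    case True
    then show ?thesis
      using same_side crossing_aux[OF u X4(1) so a(2) b(2) c(2) True _ c(1) ne neqv(2)] by fastforce
  next
    case False
    then have "c < a" "a \<le> b"
      using same_side by force+
    from crossing_aux[OF u X4(1) so a(2) c(2) b(2) this b(1)] show ?thesis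
      using ne neqv(2) sswap_sym[OF nz] by (auto simp: conj_commute)
  qed
qed

text \<open>Blocks are classes of \<open>eqv\<close> up to sign; the balanced cycles all lie in one
  block. Cutting an invariant of \<open>sswap i j \<circ> u\<close> down to the block of
  \<open>k\<close> discards the points moved by the reflection, so an invariant of \<open>u\<close>
  remains.\<close>

lemma eqv_different_blocks:
  assumes u: "u \<in> G" and X4: "i \<in> X" "j \<in> X" "k \<in> X" "l \<in> X"
    and eqv: "eqv u i j" "eqv u k l" and neqv: "\<not> eqv u i k" "\<not> eqv u i (- k)"
  shows "eqv (sswap i j \<circ> u) k l"
  unfolding eqv_def
proof
  fix f assume f: "f \<in> Inv (sswap i j \<circ> u)"
  define B where "B y \<longleftrightarrow> eqv u k y \<or> eqv u k (- y)" for y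
  define g where "g y = (if B y then f y else 0)" for y
  have "\<not> B i"
    using neqv eqv_sym eqv_minus[of u i "- k"] eqv_minus_right[of u i k] unfolding B_def
    by (metis add.inverse_inverse)
  moreover have "B j \<longleftrightarrow> B i"
    unfolding B_def using eqv(1) eqv_minus[of u i j] eqv_trans eqv_sym by metis
  moreover have Bm: "B (- y) \<longleftrightarrow> B y" for y
    unfolding B_def by auto
  ultimately have nB: "\<not> B i" "\<not> B j" "\<not> B (- i)" "\<not> B (- j)"
    by auto
  have Bu: "B (u y) \<longleftrightarrow> B y" for y
    unfolding B_def using eqv_image[of u y] eqv_image[of u "- y"] hyperoctahedralD(4)[OF u, of y]
      eqv_trans eqv_sym by metis
  have "g \<in> V"
    using invariantsD(1)[OF f] Bm by (auto simp: odd_funs_def g_def)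
  moreover have "g (u y) = g y" for y
  proof (cases "B y")
    case True
    then have "u y \<noteq> i" "u y \<noteq> j" "u y \<noteq> - i" "u y \<noteq> - j"
      using nB Bu by metis+
    then have "f (u y) = f y"
      using invariantsD(2)[OF f, of y] by (simp add: sswap_fixes)
    then show ?thesis
      using True Bu by (simp add: g_def)
  qed (simp add: g_def Bu)
  ultimately have "g \<in> Inv u"
    by (simp add: invariants_def)
  then have "g k = g l"
    using eqv(2) by (auto simp: eqv_def)
  moreover have "B k" "B l"
    using eqv(2) eqv_refl by (auto simp: B_def)
  ultimately show "f k = f l"
    by (simp add: g_def)
qed

section \<open>Sign conflicts and the Wall form\<close>

lemma eqv_balanced_trans: "eqv w a (- a) \<Longrightarrow> eqv w a b \<Longrightarrow> eqv w b (- b)"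
  using eqv_minus eqv_sym eqv_trans by metis

lemma wall_minus:
  assumes "a \<in> X" "wall w a x"
  shows "wall w (- a) (\<lambda>y. - x y)"
proof -
  have "(\<lambda>y. (- 1) * x y) \<in> V"
    using wallD(1)[OF assms(2)] by blast
  moreover have "rho (- a) a y = - rho a (- a) y" for y
    using nonzero_signed_points[OF assms(1)] by (auto simp: rho_def)
  ultimately show ?thesis
    using wallD[OF assms(2)] by (simp add: wall_def)
qed

text \<open>\<open>x - y\<close> is the fixed vector gained through \<open>sswap p q\<close>: by
  antisymmetry of the Wall form its values at \<open>q\<close> and \<open>p\<close> differ by -2, so
  the reflection acts on it as \<open>inv w\<close> does. The Wall form is taken for
  \<open>inv w\<close> because reflections multiply \<open>w\<close> from the left.\<close>

lemma wall_diff: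
  assumes w: "w \<in> G" and pq: "p \<in> X" "q \<in> X" "p \<noteq> q" "p \<noteq> - q"
    and x: "wall (inv w) p x" and y: "wall (inv w) q y"
  shows "x (inv w z) - y (inv w z) = x z - y z - 2 * rho p q z"
    and "(\<lambda>z. x z - y z) \<in> Inv (sswap p q \<circ> w)"
proof -
  have nz: "p \<noteq> 0" "q \<noteq> 0"
    using pq nonzero_signed_points by blast+
  have rho: "rho p (- p) z - rho q (- q) z = rho p q z" for z
    using pq nz by (auto simp: rho_def)
  show *: "x (inv w z) - y (inv w z) = x z - y z - 2 * rho p q z" for z
    using wallD(3)[OF x, of z] wallD(3)[OF y, of z] rho[of z] by simp
  define d where "d z = x z - y z" for z
  have dV: "d \<in> V"
    unfolding d_def using wallD(1)[OF x] wallD(1)[OF y] by blast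
  have "x q = - y p"
    using wall_antisym[OF inv_hyperoctahedral[OF w] pq(1) x pq(2) y pq(3,4)] .
  then have "d q - d p = - 2"
    using wallD(2)[OF x] wallD(2)[OF y] by (simp add: d_def)
  then have "d (sswap p q z) = d (inv w z)" for z
    using odd_fun_sswap[OF dV pq(1-3), of z] *[of z] by (simp add: d_def)
  then have "d (sswap p q (w z)) = d z" for z
    using w by simp
  then have "d \<in> Inv (sswap p q \<circ> w)"
    using dV by (simp add: invariants_def)
  then show "(\<lambda>z. x z - y z) \<in> Inv (sswap p q \<circ> w)"
    unfolding d_def .
qed

lemma hook_inv:
  assumes w: "w \<in> G" and hook: "hook w"
  shows "hook (inv w)"
proof -
  have orb: "same_orbit (inv w) a b" if "same_orbit w a b" for a b
  proof -
    have "same_orbit (inv w) a (w x) = same_orbit (inv w) a x" for x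
      using same_orbit_image_iff[OF inv_hyperoctahedral[OF w], of a "w x"] w by simp
    from same_orbit_invariant[of "same_orbit (inv w) a", OF this that] show ?thesis
      using same_orbit_refl by simp
  qed
  have "w a \<noteq> - a" if "inv w a \<noteq> - a" for a
  proof
    assume "w a = - a"
    then have "w (- a) = a"
      using hyperoctahedralD(4)[OF w, of a] by simp
    then have "inv w a = - a"
      using w by (metis inv_comp_hyperoctahedral(3))
    with that show False by simp
  qed
  moreover have "eqv (inv w) a b \<longleftrightarrow> eqv w a b" for a b
    by (simp add: eqv_def invariants_inv[OF w])
  ultimately show ?thesis
    using hook orb unfolding hook_def by metis
qed

text \<open>Each of \<open>e1\<close> to \<open>e4\<close> says that a sum or difference of two Wall
  preimages agrees at two points. With antisymmetry they yield \<open>x\<^sub>i j = 0\<close>,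
  \<open>x\<^sub>i k = x\<^sub>j l\<close> and \<open>x\<^sub>i l = x\<^sub>j k\<close>. So
  \<open>i\<close> and \<open>j\<close> lie in different cycles, and a nonzero common value would
  make both cycles longer than 1, against \<open>hook w\<close>. If all values are 0, the vector
  gained through \<open>sswap i j\<close> vanishes at \<open>k\<close> and \<open>l\<close>, as do
  the invariants of \<open>w\<close>.\<close>

lemma hook_no_conflict:
  assumes w: "w \<in> G" and hook: "hook w" and X4: "i \<in> X" "j \<in> X" "k \<in> X" "l \<in> X"
    and bal: "eqv w i (- i)" "eqv w j (- j)" "eqv w k (- k)" "eqv w l (- l)"
    and ne: "i \<noteq> j" "i \<noteq> k" "i \<noteq> l" "j \<noteq> k" "j \<noteq> l" "k \<noteq> l"
      "i \<noteq> - j" "i \<noteq> - k" "i \<noteq> - l" "j \<noteq> - k" "j \<noteq> - l" "k \<noteq> - l"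
    and e1: "eqv (sswap i k \<circ> w) j l" and e2: "eqv (sswap i l \<circ> w) j k"
    and e3: "eqv (sswap i (- k) \<circ> w) j (- l)" and e4: "eqv (sswap i (- l) \<circ> w) j (- k)"
  shows "eqv (sswap i j \<circ> w) k l"
proof -
  let ?v = "inv w"
  have v: "?v \<in> G"
    using w by simp
  have bal': "eqv ?v i (- i)" "eqv ?v j (- j)" "eqv ?v k (- k)" "eqv ?v l (- l)"
    using bal by (simp_all add: eqv_def invariants_inv[OF w])
  obtain x\<^sub>i where xi: "wall ?v i x\<^sub>i"
    using wall_exists[OF v X4(1) bal'(1)] .
  obtain x\<^sub>j where xj: "wall ?v j x\<^sub>j"
    using wall_exists[OF v X4(2) bal'(2)] .
  obtain x\<^sub>k where xk: "wall ?v k x\<^sub>k"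
    using wall_exists[OF v X4(3) bal'(3)] .
  obtain x\<^sub>l where xl: "wall ?v l x\<^sub>l"
    using wall_exists[OF v X4(4) bal'(4)] .
  have diff: "x c - y c = x d - y d"
    if "eqv (sswap p q \<circ> w) c d" "p \<in> X" "q \<in> X" "p \<noteq> q" "p \<noteq> - q" "wall ?v p x" "wall ?v q y"
    for p q c d x y
    using bspec[OF that(1)[unfolded eqv_def] wall_diff(2)[OF w that(2-7)]] .
  have "x\<^sub>i j - x\<^sub>k j = x\<^sub>i l - x\<^sub>k l"
    using diff[OF e1 X4(1,3) ne(2,8) xi xk] .
  moreover have "x\<^sub>i j + x\<^sub>k j = - x\<^sub>i l - x\<^sub>k l"
    using diff[OF e3 X4(1) _ _ _ xi wall_minus[OF X4(3) xk]] X4 ne wallD(4)[OF xi] wallD(4)[OF xk] by simp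
  moreover have "x\<^sub>i j - x\<^sub>l j = x\<^sub>i k - x\<^sub>l k"
    using diff[OF e2 X4(1,4) ne(3,9) xi xl] .
  moreover have "x\<^sub>i j + x\<^sub>l j = - x\<^sub>i k - x\<^sub>l k"
    using diff[OF e4 X4(1) _ _ _ xi wall_minus[OF X4(4) xl]] X4 ne wallD(4)[OF xi] wallD(4)[OF xl] by simp
  moreover have "x\<^sub>k l = - x\<^sub>l k" "x\<^sub>j l = - x\<^sub>l j" "x\<^sub>j k = - x\<^sub>k j"
    using wall_antisym[OF v X4(3) xk X4(4) xl ne(6,12)] wall_antisym[OF v X4(2) xj X4(4) xl ne(5,11)]
      wall_antisym[OF v X4(2) xj X4(3) xk ne(4,10)] by auto
  ultimately have eqs: "x\<^sub>i j = 0" "x\<^sub>i k = x\<^sub>j l" "x\<^sub>i l = x\<^sub>j k"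
    by linarith+
  have nij: "\<not> same_orbit ?v i j"
    using wall_nonzero_iff[OF v xi X4(2) bal'(2)] eqs(1) by blast
  have ik: "\<not> (same_orbit ?v i c \<and> same_orbit ?v j d)"
    if "c \<noteq> i" "c \<noteq> - i" "d \<noteq> j" "d \<noteq> - j" for c d
    using big_orbit[OF v] that nij hook_inv[OF w hook] bal'(1,2) X4(1,2) unfolding hook_def by blast
  have zero: "x\<^sub>i k = 0" "x\<^sub>i l = 0"
  proof -
    have "same_orbit ?v i k \<longleftrightarrow> x\<^sub>i k \<noteq> 0" "same_orbit ?v j l \<longleftrightarrow> x\<^sub>j l \<noteq> 0"
      "same_orbit ?v i l \<longleftrightarrow> x\<^sub>i l \<noteq> 0" "same_orbit ?v j k \<longleftrightarrow> x\<^sub>j k \<noteq> 0"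
      using wall_nonzero_iff[OF v xi X4(3) bal'(3)] wall_nonzero_iff[OF v xj X4(4) bal'(4)]
        wall_nonzero_iff[OF v xi X4(4) bal'(4)] wall_nonzero_iff[OF v xj X4(3) bal'(3)] by simp_all
    moreover have "k \<noteq> - i" "l \<noteq> - i" "k \<noteq> - j" "l \<noteq> - j"
      using ne(8-11) by auto
    ultimately show "x\<^sub>i k = 0" "x\<^sub>i l = 0"
      using ik[of k l] ik[of l k] eqs(2,3) ne(2-5) by auto
  qed
  show ?thesis
    unfolding eqv_def
  proof
    fix f assume f: "f \<in> Inv (sswap i j \<circ> w)"
    \<comment> \<open>\<open>f\<close> is an invariant of \<open>w\<close> up to a multiple of
      \<open>x\<^sub>i - x\<^sub>j\<close>; \<open>c\<close> makes the jumps along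
      \<open>rho i j\<close> cancel.\<close>
    define c where "c = (f j - f i) / 2"
    define g where "g z = f z + c * (x\<^sub>i z - x\<^sub>j z)" for z
    have "(\<lambda>z. x\<^sub>i z - x\<^sub>j z) \<in> V"
      by (rule odd_funs_lin(2)[OF wallD(1)[OF xi] wallD(1)[OF xj]])
    then have gV: "g \<in> V"
      unfolding g_def by (intro odd_funs_lin(1)[OF invariantsD(1)[OF f]] odd_funs_lin(3))
    have g_v: "g (?v z) = g z" for z
    proof -
      have "f (?v z) = f (sswap i j z)"
        using invariantsD(2)[OF f, of "?v z"] unfolding comp_apply inv_comp_hyperoctahedral(4)[OF w] ..
      also have "\<dots> = f z + (f j - f i) * rho i j z"
        by (rule odd_fun_sswap[OF invariantsD(1)[OF f] X4(1,2) ne(1)])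
      finally have "f (?v z) = f z + 2 * c * rho i j z"
        by (simp add: c_def)
      then have "g (?v z) = f z + 2 * c * rho i j z + c * (x\<^sub>i z - x\<^sub>j z - 2 * rho i j z)"
        unfolding g_def wall_diff(1)[OF w X4(1,2) ne(1,7) xi xj, of z] by (rule arg_cong)
      then show ?thesis
        by (simp add: g_def algebra_simps)
    qed
    then have "g \<in> Inv ?v"
      using gV by (simp add: invariants_def)
    then have "g k = 0" "g l = 0"
      using bal'(3,4) eqv_balanced_zero by blast+
    then show "f k = f l"
      using eqs zero by (simp add: g_def)
  qed
qed

end

section \<open>Joins and meets below a hook element\<close>

context signed_permutations
begin

definition is_join :: "(int \<Rightarrow> int) \<Rightarrow> (int \<Rightarrow> int) \<Rightarrow> (int \<Rightarrow> int) \<Rightarrow> (int \<Rightarrow> int) \<Rightarrow> bool" where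
  "is_join w s t m \<longleftrightarrow> below m w \<and> below s m \<and> below t m \<and>
     (\<forall>u. below u w \<longrightarrow> below s u \<longrightarrow> below t u \<longrightarrow> below m u)"

lemma is_join_sym: "is_join w s t m \<longleftrightarrow> is_join w t s m"
  by (auto simp: is_join_def)

context
  fixes w i j k l
  assumes w: "w \<in> G" and X4: "i \<in> X" "j \<in> X" "k \<in> X" "l \<in> X" and ij: "i \<noteq> j" and kl: "k \<noteq> l"
begin

lemma is_join_sswapI:
  assumes "below m w" "eqv m i j" "eqv m k l"
    and "\<And>u. below u w \<Longrightarrow> eqv u i j \<Longrightarrow> eqv u k l \<Longrightarrow> below m u"
  shows "is_join w (sswap i j) (sswap k l) m"
  using assms sswap_below_iff[OF _ X4(1,2) ij] sswap_below_iff[OF _ X4(3,4) kl] belowD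
  unfolding is_join_def by metis

text \<open>Minimality holds because \<open>eqv_sswap_comp_down\<close> carries the condition
  \<open>prod\<close> from \<open>w\<close> to every upper bound.\<close>

lemma join_of_product:
  assumes ne: "sswap i j \<noteq> sswap k l" and eqv: "eqv w i j" "eqv w k l" and prod: "eqv (sswap i j \<circ> w) k l"
  shows "is_join w (sswap i j) (sswap k l) (sswap i j \<circ> sswap k l)" (is "is_join w ?s ?t ?m")
proof -
  have bel: "below ?m u" if "u \<in> G" "eqv u i j" "eqv (?s \<circ> u) k l" for u
    using that X4 ij kl by (intro sswap_comp_below sswap_below_iff[THEN iffD2]) auto
  have mG: "?m \<in> G"
    using X4 by simp
  have nz: "i \<noteq> 0" "j \<noteq> 0" "k \<noteq> 0" "l \<noteq> 0"
    using X4 nonzero_signed_points by blast+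
  have m_id: "?m \<noteq> id"
  proof
    assume "?m = id"
    then have "?s \<circ> ?m = ?s" by simp
    then show False
      using ne nz by simp
  qed
  then have len_m: "len ?m \<noteq> 0"
    using abs_length_0[OF mG] by blast
  \<comment> \<open>Otherwise \<open>?s \<circ> ?m = ?t\<close>, of length 1, would be longer than
    \<open>?m\<close>, which is not the identity.\<close>
  have "eqv ?m i j"
  proof (rule ccontr)
    assume "\<not> eqv ?m i j"
    from abs_length_sswap_comp(2)[OF mG X4(1,2) ij this] show False
      using len_m nz abs_length_sswap_eq[OF X4(3,4) kl] by simp
  qed
  moreover have "eqv ?m k l"
  proof (rule ccontr)
    assume "\<not> eqv ?m k l"
    from abs_length_comp_sswap(2)[OF mG X4(3,4) kl this] show False
      using len_m nz abs_length_sswap_eq[OF X4(1,2) ij] by simp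
  qed
  ultimately show ?thesis
    using bel[OF w eqv(1) prod] bel eqv_sswap_comp_down[OF _ X4(1,2) ij _ _ prod] belowD
    by (intro is_join_sswapI) blast+
qed

text \<open>The join is the restriction of \<open>w\<close> to the supports: the invariants of an
  upper bound vanish there, and the restriction moves nothing else.\<close>

lemma join_of_balanced:
  assumes bal: "eqv w i (- i)" "eqv w j (- j)" "eqv w k (- k)" "eqv w l (- l)"
    and ub: "\<And>u. below u w \<Longrightarrow> eqv u i j \<Longrightarrow> eqv u k l \<Longrightarrow>
      eqv u i (- i) \<and> eqv u j (- j) \<and> eqv u k (- k) \<and> eqv u l (- l)"
  shows "\<exists>m. is_join w (sswap i j) (sswap k l) m"
proof -
  define I where "I = {i, j, k, l, - i, - j, - k, - l}"
  have "\<exists>m. below m w \<and> (\<forall>x. x \<notin> I \<longrightarrow> m x = x) \<and> (\<forall>x\<in>I. eqv m x (- x)) \<and>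
    (\<forall>x\<in>I. w x \<in> I \<longrightarrow> m x = w x) \<and>
    (\<forall>A. (\<forall>x\<in>A. - x \<in> A) \<longrightarrow> (\<forall>x. w x \<in> A \<longleftrightarrow> x \<in> A) \<longrightarrow> (\<forall>x. m x \<in> A \<longleftrightarrow> x \<in> A))"
    using bal by (intro restriction_exists[OF w]) (auto simp: I_def eqv_minus_right intro: eqv_sym)
  then obtain m where m: "below m w" "\<forall>x. x \<notin> I \<longrightarrow> m x = x" "\<forall>x\<in>I. eqv m x (- x)"
    by (elim exE conjE)
  note mG = belowD(1)[OF m(1)]
  have zero: "f x = 0" if "f \<in> Inv m" "x \<in> I" for f x
    using eqv_balanced_zero that m(3) by blast
  have eqv_I: "eqv m x y" if "x \<in> I" "y \<in> I" for x y
    unfolding eqv_def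
  proof
    fix f assume "f \<in> Inv m"
    from zero[OF this] that show "f x = f y" by simp
  qed
  have "eqv m i j" "eqv m k l"
    by (rule eqv_I; simp add: I_def)+
  moreover have "below m u" if u: "below u w" "eqv u i j" "eqv u k l" for u
  proof -
    have "Inv u \<subseteq> Inv m"
    proof
      fix f assume f: "f \<in> Inv u"
      have "f i = 0" "f j = 0" "f k = 0" "f l = 0"
        using ub[OF u] by (auto intro: eqv_balanced_zero[OF _ f])
      then have f0: "f x = 0" if "x \<in> I" for x
        using that invariantsD(3)[OF f] unfolding I_def by auto
      have "f (m x) = f x" for x
      proof (cases "x \<in> I")
        case True
        have "m x \<in> I"
        proof (rule ccontr)
          assume nI: "m x \<notin> I"
          then have "m (m x) = m x"
            using m(2) by blast
          then show False
            using hyperoctahedralD(7)[OF mG] True nI by simp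
        qed
        with True f0 show ?thesis by simp
      qed (use m(2) in simp)
      then show "f \<in> Inv m"
        using invariantsD(1)[OF f] by (simp add: invariants_def)
    qed
    then show ?thesis
      using below_iff_invariants[OF m(1) u(1)] by blast
  qed
  ultimately show ?thesis
    using m(1) is_join_sswapI by blast
qed

text \<open>The fixed space of the 4-cycle \<open>z\<close> found in \<open>v\<close> only asks for
  four equal values. An upper bound satisfies this if the points are balanced in it or
  \<open>k\<close> is tied to \<open>i\<close> with the same sign as in \<open>v\<close>; the
  opposite sign is what \<open>hook_no_conflict\<close> rules out.\<close>

lemma join_of_crossing:
  assumes hook: "hook w" and ne: "sswap i j \<noteq> sswap k l"
    and neqv: "\<not> eqv (sswap i j \<circ> w) k l" "\<not> eqv (sswap k l \<circ> w) i j"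
    and blocks: "\<And>u. below u w \<Longrightarrow> eqv u i j \<Longrightarrow> eqv u k l \<Longrightarrow> eqv u i k \<or> eqv u i (- k)"
    and v: "below v w" "eqv v i j" "eqv v k l" "eqv v i k" "\<not> eqv v i (- i)"
  shows "\<exists>m. is_join w (sswap i j) (sswap k l) m"
proof -
  have neqv': "\<not> eqv (sswap i j \<circ> u) k l" "\<not> eqv (sswap k l \<circ> u) i j"
    if "below u w" "eqv u i j" "eqv u k l" for u
    using eqv_sswap_comp_up[OF that(1) X4(1,2) ij that(2)]
      eqv_sswap_comp_up[OF that(1) X4(3,4) kl that(3)] neqv by blast+
  have vil: "eqv v i l"
    using v eqv_trans by blast
  obtain z where e12: "eqv (sswap i k \<circ> v) j l" "eqv (sswap i l \<circ> v) j k" and dist: "distinct [i, j, k, l]"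
    and z: "below z v" "Inv z = {f \<in> V. f i = f j \<and> f i = f k \<and> f i = f l}"
    using crossing[OF belowD(1)[OF v(1)] X4 v(5,2,4) vil ij kl ne neqv'[OF v(1-3)]] by blast
  have zw: "below z w"
    using below_trans[OF z(1) v(1)] .
  have dist': "i \<noteq> k" "i \<noteq> l" "j \<noteq> k" "j \<noteq> l"
    using dist by auto
  have sub: "below z u" if "below u w" "Inv u \<subseteq> Inv z" for u
    using below_iff_invariants[OF zw that(1)] that(2) by blast
  have "below z u" if u: "below u w" "eqv u i j" "eqv u k l" for u
  proof (cases "eqv u i (- i)")
    case True
    then have "eqv u j (- j)" "eqv u i k \<or> eqv u i (- k)"
      using u blocks eqv_balanced_trans by blast+
    then have "eqv u k (- k)"
      using True eqv_balanced_trans[of u i k] eqv_balanced_trans[of u i "- k"] eqv_sym[of u "- k" k]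
      by auto
    then have "eqv u l (- l)"
      using u eqv_balanced_trans by blast
    have "Inv u \<subseteq> Inv z"
    proof
      fix f assume f: "f \<in> Inv u"
      have "f i = 0" "f j = 0" "f k = 0" "f l = 0"
        using True \<open>eqv u j (- j)\<close> \<open>eqv u k (- k)\<close> \<open>eqv u l (- l)\<close>
        by (auto intro: eqv_balanced_zero[OF _ f])
      then show "f \<in> Inv z"
        using invariantsD(1)[OF f] by (simp add: z(2))
    qed
    then show ?thesis
      by (rule sub[OF u(1)])
  next
    case paired: False
    note uG = belowD(1)[OF u(1)]
    show ?thesis
    proof (cases "eqv u i k")
      case True
      then have "eqv u i l"
        using u eqv_trans by blast
      have "Inv u \<subseteq> Inv z"
      proof
        fix f assume f: "f \<in> Inv u"
        have "f i = f j" "f i = f k" "f i = f l"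
          using u(2) True \<open>eqv u i l\<close> f by (simp_all add: eqv_def)
        then show "f \<in> Inv z"
          using invariantsD(1)[OF f] by (simp add: z(2))
      qed
      then show ?thesis
        by (rule sub[OF u(1)])
    next
      case False
      then have eqv_k: "eqv u i (- k)"
        using blocks[OF u] by blast
      have eqv_l: "eqv u i (- l)"
        using eqv_k u(3) eqv_minus[of u k l] eqv_trans by blast
      have nz: "k \<noteq> 0" "l \<noteq> 0"
        using X4 nonzero_signed_points by blast+
      have neg: "- k \<in> X" "- l \<in> X" "- k \<noteq> - l" "sswap i j \<noteq> sswap (- k) (- l)"
        "\<not> eqv (sswap i j \<circ> u) (- k) (- l)" "\<not> eqv (sswap (- k) (- l) \<circ> u) i j"
        using X4 kl ne neqv'[OF u] by (simp_all add: sswap_minus[OF nz] eqv_minus)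
      have e34: "eqv (sswap i (- k) \<circ> u) j (- l)" "eqv (sswap i (- l) \<circ> u) j (- k)"
        and dist2: "distinct [i, j, - k, - l]"
        using crossing[OF uG X4(1,2) neg(1,2) paired u(2) eqv_k eqv_l ij neg(3-6)] by blast+
      have ne_minus: "i \<noteq> - j" "i \<noteq> - k" "i \<noteq> - l" "j \<noteq> - k" "j \<noteq> - l" "k \<noteq> - l"
      proof -
        show "i \<noteq> - k" "i \<noteq> - l" "j \<noteq> - k" "j \<noteq> - l"
          using dist2 by auto
        show "i \<noteq> - j"
          using u(2) paired by auto
        show "k \<noteq> - l"
        proof
          assume "k = - l"
          then have "eqv v i (- l)" using v by simp
          then have "eqv v i (- i)"
            using vil eqv_minus[of v i l] eqv_sym eqv_trans by blast
          with v show False by blast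
        qed
      qed
      \<comment> \<open>\<open>v\<close> ties \<open>i\<close> to \<open>k\<close> and
        \<open>u\<close> ties \<open>i\<close> to \<open>- k\<close>. In \<open>w\<close> both ties
        hold, so all four points are balanced.\<close>
      have wik: "eqv w i k" "eqv w i (- k)" "eqv w i l" "eqv w i j" "eqv w k l"
        using below_eqv[OF v(1)] below_eqv[OF u(1)] v vil eqv_k by blast+
      then have bk: "eqv w k (- k)"
        using eqv_sym eqv_trans by blast
      then have bal: "eqv w i (- i)" "eqv w j (- j)" "eqv w l (- l)"
        using wik eqv_balanced_trans eqv_sym by blast+
      have "eqv (sswap i j \<circ> w) k l"
      proof (rule hook_no_conflict[OF w hook X4 bal(1,2) bk bal(3)])
        show "eqv (sswap i k \<circ> w) j l"
          using eqv_sswap_comp_up[OF v(1) X4(1,3) dist'(1) v(4) e12(1)] .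
        show "eqv (sswap i l \<circ> w) j k"
          using eqv_sswap_comp_up[OF v(1) X4(1,4) dist'(2) vil e12(2)] .
        show "eqv (sswap i (- k) \<circ> w) j (- l)"
          using eqv_sswap_comp_up[OF u(1) X4(1) neg(1) ne_minus(2) eqv_k e34(1)] .
        show "eqv (sswap i (- l) \<circ> w) j (- k)"
          using eqv_sswap_comp_up[OF u(1) X4(1) neg(2) ne_minus(3) eqv_l e34(2)] .
      qed (use dist ne_minus in auto)
      with neqv show ?thesis by blast
    qed
  qed
  moreover have "eqv z i j" "eqv z k l"
    unfolding eqv_def z(2) by auto
  ultimately show ?thesis
    using zw is_join_sswapI by blast
qed

end

lemma join_of_reflections:
  assumes w: "w \<in> G" and hook: "hook w" and X4: "i \<in> X" "j \<in> X" "k \<in> X" "l \<in> X"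
    and ij: "i \<noteq> j" and kl: "k \<noteq> l" and ne: "sswap i j \<noteq> sswap k l" and eqv: "eqv w i j" "eqv w k l"
  shows "\<exists>m. is_join w (sswap i j) (sswap k l) m"
proof -
  have nz: "k \<noteq> 0" "l \<noteq> 0"
    using X4 nonzero_signed_points by blast+
  consider "eqv (sswap i j \<circ> w) k l" | "eqv (sswap k l \<circ> w) i j"
    | "\<not> eqv (sswap i j \<circ> w) k l" "\<not> eqv (sswap k l \<circ> w) i j"
    by blast
  then show ?thesis
  proof cases
    case 1
    then show ?thesis
      using join_of_product[OF w X4 ij kl ne eqv] by blast
  next
    case 2
    then show ?thesis
      using join_of_product[OF w X4(3,4,1,2) kl ij ne[symmetric] eqv(2,1)] is_join_sym by blast
  next
    case 3
    \<comment> \<open>If the supports were in different blocks of \<open>u\<close>, the product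
      would be below \<open>u\<close> and thus below \<open>w\<close>, contrary to the present
      case.\<close>
    have blocks: "eqv u i k \<or> eqv u i (- k)" if "below u w" "eqv u i j" "eqv u k l" for u
      using eqv_different_blocks[OF belowD(1)[OF that(1)] X4 that(2,3)]
        eqv_sswap_comp_up[OF that(1) X4(1,2) ij that(2)] 3(1) by blast
    have same: "eqv u j (- j) \<and> eqv u k (- k) \<and> eqv u l (- l)"
      if u: "below u w" "eqv u i j" "eqv u k l" and bal: "eqv u i (- i)" for u
    proof -
      have "eqv u k (- k)"
        using blocks[OF u] bal eqv_balanced_trans[of u i k] eqv_balanced_trans[of u i "- k"]
          eqv_sym[of u "- k" k] by auto
      then show ?thesis
        using u bal eqv_balanced_trans by blast
    qed
    show ?thesis
    proof (cases "\<forall>u. below u w \<longrightarrow> eqv u i j \<longrightarrow> eqv u k l \<longrightarrow> eqv u i (- i)")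
      case True
      then have "eqv w i (- i)"
        using below_refl[OF w] eqv by blast
      then show ?thesis
        using same[OF below_refl[OF w] eqv] same True by (intro join_of_balanced[OF w X4 ij kl]) blast+
    next
      case False
      then obtain v where v: "below v w" "eqv v i j" "eqv v k l" "\<not> eqv v i (- i)"
        by blast
      show ?thesis
      proof (cases "eqv v i k")
        case True
        show ?thesis
          by (rule join_of_crossing[OF w X4 ij kl hook ne 3 blocks v(1-3) True v(4)])
      next
        case False
        then have vk: "eqv v i (- k)"
          using blocks[OF v(1-3)] by blast
        \<comment> \<open>Negating both \<open>k\<close> and \<open>l\<close> leaves the reflection
          unchanged and reverses the sign of the tie to \<open>i\<close>.\<close>
        have neg: "- k \<in> X" "- l \<in> X" "- k \<noteq> - l" "sswap i j \<noteq> sswap (- k) (- l)"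
          "\<not> eqv (sswap i j \<circ> w) (- k) (- l)" "\<not> eqv (sswap (- k) (- l) \<circ> w) i j"
          using X4 kl ne 3 by (simp_all add: sswap_minus[OF nz] eqv_minus)
        have vkl: "eqv v (- k) (- l)"
          using v(3) by (simp add: eqv_minus)
        have "\<exists>m. is_join w (sswap i j) (sswap (- k) (- l)) m"
        proof (rule join_of_crossing[OF w X4(1,2) neg(1,2) ij neg(3) hook neg(4-6) _ v(1,2) vkl vk v(4)])
          fix u assume "below u w" "eqv u i j" "eqv u (- k) (- l)"
          then show "eqv u i (- k) \<or> eqv u i (- (- k))"
            using blocks[of u] by (auto simp: eqv_minus)
        qed
        then show ?thesis
          by (simp add: sswap_minus[OF nz])
      qed
    qed
  qed
qed

text \<open>Together with \<open>below_left_cancel\<close> this makes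
  \<open>p \<mapsto> z \<circ> p\<close> an isomorphism from \<open>[e, inv z \<circ> w]\<close>
  onto \<open>[z, w]\<close>.\<close>

lemma below_left_mult:
  assumes z: "below z (z \<circ> q)" and p: "below p q" and "z \<in> G"
  shows "below z (z \<circ> p)" "below (z \<circ> p) (z \<circ> q)"
proof -
  obtain b where b: "p \<in> G" "b \<in> G" "q = p \<circ> b" "len q = len p + len b"
    using belowE[OF p] by metis
  have q: "q \<in> G" "z \<circ> q = z \<circ> p \<circ> b"
    using b by (auto simp: comp_assoc)
  have "len (z \<circ> q) = len z + len q"
    using z inv_comp_hyperoctahedral(6)[OF assms(3), of q] unfolding below_def abs_le_def by metis
  moreover have "len (z \<circ> q) \<le> len (z \<circ> p) + len b" "len (z \<circ> p) \<le> len z + len p"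
    unfolding q(2) using b assms(3) by (auto intro!: abs_length_comp)
  ultimately have "len (z \<circ> p) = len z + len p" "len (z \<circ> p \<circ> b) = len (z \<circ> p) + len b"
    using b(4) q(2) by simp_all
  then show "below z (z \<circ> p)" "below (z \<circ> p) (z \<circ> q)"
    unfolding q(2) using b assms(3) by (auto intro!: belowI)
qed

lemma below_left_cancel:
  assumes "below z p" "below p q"
  shows "below (inv z \<circ> p) (inv z \<circ> q)"
proof -
  obtain a where a: "z \<in> G" "a \<in> G" "p = z \<circ> a" "len p = len z + len a"
    using belowE[OF assms(1)] by metis
  obtain b where b: "b \<in> G" "q = p \<circ> b" "len q = len p + len b"
    using belowE[OF assms(2)] by metis
  have q: "q = z \<circ> (a \<circ> b)"
    by (simp add: a b comp_assoc)
  have "len q \<le> len z + len (a \<circ> b)" "len (a \<circ> b) \<le> len a + len b"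
    unfolding q using a b by (auto intro!: abs_length_comp)
  then have "below a (a \<circ> b)"
    using a b by (intro belowI) auto
  moreover have "inv z \<circ> p = a" "inv z \<circ> q = a \<circ> b"
    using a(1) unfolding a(3) q by simp_all
  ultimately show ?thesis by simp
qed

section \<open>From reflections to arbitrary elements\<close>

lemma cover_exists:
  assumes "below z x" "z \<noteq> x"
  obtains i j where "i \<in> X" "j \<in> X" "i \<noteq> j" "below z (z \<circ> sswap i j)" "below (z \<circ> sswap i j) x"
    "len (z \<circ> sswap i j) = Suc (len z)"
proof -
  obtain a where a: "z \<in> G" "a \<in> G" "x = z \<circ> a" "len x = len z + len a"
    using belowE[OF assms(1)] by metis
  then have "a \<noteq> id"
    using assms by auto
  then obtain i j b where ij: "i \<in> X" "j \<in> X" "i \<noteq> j" and b: "b \<in> G" "a = sswap i j \<circ> b" "len a = Suc (len b)"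
    using abs_length_step[OF a(2)] by metis
  have "below (sswap i j) a"
    unfolding b(2) using ij b abs_length_sswap_eq by (intro belowI) auto
  then have "below z (z \<circ> sswap i j)" "below (z \<circ> sswap i j) x"
    using below_left_mult[of z a] assms(1) a by auto
  moreover have "len (z \<circ> sswap i j) = Suc (len z)"
    using calculation(1) abs_length_sswap_eq[OF ij] a(1) by (simp add: below_def abs_le_def)
  ultimately show ?thesis
    using that ij by blast
qed

lemma join_of_covers:
  assumes w: "w \<in> G" and hook: "hook w" and X4: "i \<in> X" "j \<in> X" "k \<in> X" "l \<in> X"
    and ij: "i \<noteq> j" and kl: "k \<noteq> l" and ne: "z \<circ> sswap i j \<noteq> z \<circ> sswap k l"
    and zs: "below z (z \<circ> sswap i j)" "below (z \<circ> sswap i j) w"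
    and zt: "below z (z \<circ> sswap k l)" "below (z \<circ> sswap k l) w"
  shows "\<exists>m. is_join w (z \<circ> sswap i j) (z \<circ> sswap k l) m"
proof -
  have zw: "below z w"
    using below_trans[OF zs] .
  obtain v where v: "z \<in> G" "v \<in> G" "w = z \<circ> v" "complementary z v"
    using belowE[OF zw] by metis
  have zv: "below z (z \<circ> v)"
    using zw v(3) by simp
  have inv_w: "inv z \<circ> w = v"
    unfolding v(3) using v(1) by simp
  have cancel: "below s (inv z \<circ> r)" if "below z (z \<circ> s)" "below (z \<circ> s) r" for s r
    using below_left_cancel[OF that] v(1) by simp
  have "eqv v i j" "eqv v k l"
    using cancel[OF zs] cancel[OF zt] inv_w sswap_below_iff[OF v(2)] X4 ij kl by auto
  moreover have "hook v"
    using hook_right_factor[OF v(1,2,4)] hook v(3) by blast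
  moreover have "sswap i j \<noteq> sswap k l"
    using ne by auto
  ultimately obtain m where m: "is_join v (sswap i j) (sswap k l) m"
    using join_of_reflections[OF v(2) _ X4 ij kl] by blast
  then have mb: "below m v" "below (sswap i j) m" "below (sswap k l) m"
    and least: "\<And>u. below u v \<Longrightarrow> below (sswap i j) u \<Longrightarrow> below (sswap k l) u \<Longrightarrow> below m u"
    by (auto simp: is_join_def)
  note zm = below_left_mult[OF zv mb(1) v(1)]
  have "below (z \<circ> m) r" if r: "below r w" "below (z \<circ> sswap i j) r" "below (z \<circ> sswap k l) r" for r
  proof -
    have zr: "below z r"
      using below_trans[OF zs(1) r(2)] .
    have "below (inv z \<circ> r) v"
      using below_left_cancel[OF zr r(1)] inv_w by simp
    then have "below m (inv z \<circ> r)"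
      using least cancel[OF zs(1) r(2)] cancel[OF zt(1) r(3)] by blast
    moreover have "z \<circ> (inv z \<circ> r) = r"
      using v(1) by simp
    ultimately show ?thesis
      using below_left_mult(2)[of z "inv z \<circ> r" m] zr v(1) by simp
  qed
  moreover have "below (z \<circ> m) w"
    using zm v(3) by simp
  ultimately have "is_join w (z \<circ> sswap i j) (z \<circ> sswap k l) (z \<circ> m)"
    using below_left_mult(2)[OF zm(1) mb(2) v(1)] below_left_mult(2)[OF zm(1) mb(3) v(1)]
    unfolding is_join_def by blast
  then show ?thesis by blast
qed

text \<open>Induction on the corank of a common lower bound \<open>z\<close>, joining first two covers of \<open>z\<close>.\<close>

lemma join_exists:
  assumes w: "w \<in> G" and hook: "hook w"
  shows "below z x \<Longrightarrow> below z y \<Longrightarrow> below x w \<Longrightarrow> below y w \<Longrightarrow> \<exists>m. is_join w x y m"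
proof (induction "len w - len z" arbitrary: z x y rule: less_induct)
  case less
  note z = less.prems
  have "z \<in> G"
    using z belowD by blast
  consider "z = x" | "z = y" | "z \<noteq> x" "z \<noteq> y" by blast
  then show ?case
  proof cases
    case 1
    then have "is_join w x y y"
      using z below_refl belowD by (auto simp: is_join_def)
    then show ?thesis by blast
  next
    case 2
    then have "is_join w x y x"
      using z below_refl belowD by (auto simp: is_join_def)
    then show ?thesis by blast
  next
    case 3
    obtain i j where ij: "i \<in> X" "j \<in> X" "i \<noteq> j" and x1: "below z (z \<circ> sswap i j)"
      "below (z \<circ> sswap i j) x" "len (z \<circ> sswap i j) = Suc (len z)"
      using cover_exists[OF z(1) 3(1)] .
    obtain k l where kl: "k \<in> X" "l \<in> X" "k \<noteq> l" and y1: "below z (z \<circ> sswap k l)"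
      "below (z \<circ> sswap k l) y" "len (z \<circ> sswap k l) = Suc (len z)"
      using cover_exists[OF z(2) 3(2)] .
    have x1w: "below (z \<circ> sswap i j) w" and y1w: "below (z \<circ> sswap k l) w"
      using below_trans[OF x1(2) z(3)] below_trans[OF y1(2) z(4)] .
    have IH1: "\<exists>m. is_join w p q m"
      if "below (z \<circ> sswap i j) p" "below (z \<circ> sswap i j) q" "below p w" "below q w" for p q
      using less.hyps[OF _ that] x1(3) below_length[OF x1w] by simp
    have IH2: "\<exists>m. is_join w p q m"
      if "below (z \<circ> sswap k l) p" "below (z \<circ> sswap k l) q" "below p w" "below q w" for p q
      using less.hyps[OF _ that] y1(3) below_length[OF y1w] by simp
    show ?thesis
    proof (cases "z \<circ> sswap i j = z \<circ> sswap k l")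
      case True
      then show ?thesis
        using IH1[of x y] x1(2) y1(2) z by simp
    next
      case False
      \<comment> \<open>The next two joins come from the induction hypothesis: \<open>x\<close> and
        \<open>m1\<close> lie above the first cover of \<open>z\<close>, \<open>m2\<close> and
        \<open>y\<close> above the second.\<close>
      obtain m1 where m1: "is_join w (z \<circ> sswap i j) (z \<circ> sswap k l) m1"
        using join_of_covers[OF w hook ij(1,2) kl(1,2) ij(3) kl(3) False x1(1) x1w y1(1) y1w] by blast
      then obtain m2 where m2: "is_join w x m1 m2"
        using IH1[of x m1] x1(2) z(3) unfolding is_join_def by blast
      then have "below (z \<circ> sswap k l) m2" "below m2 w"
        using m1 below_trans[of "z \<circ> sswap k l" m1 m2] unfolding is_join_def by blast+
      then obtain m3 where m3: "is_join w m2 y m3"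
        using IH2[of m2 y] y1(2) z(4) by blast
      have "below x m2" "below m2 m3" "below y m3" "below m3 w"
        using m2 m3 unfolding is_join_def by blast+
      moreover have "below m3 u" if u: "below u w" "below x u" "below y u" for u
      proof -
        have "below (z \<circ> sswap i j) u" "below (z \<circ> sswap k l) u"
          using below_trans[OF x1(2) u(2)] below_trans[OF y1(2) u(3)] .
        then have "below m1 u"
          using m1 u(1) unfolding is_join_def by blast
        then have "below m2 u"
          using m2 u unfolding is_join_def by blast
        then show ?thesis
          using m3 u unfolding is_join_def by blast
      qed
      ultimately have "is_join w x y m3"
        using below_trans[of x m2 m3] unfolding is_join_def by blast
      then show ?thesis by blast
    qed
  qed
qed

text \<open>A longest common lower bound is the greatest one: its join with any other is again a
  common lower bound and cannot be longer.\<close>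

lemma meet_exists:
  assumes w: "w \<in> G" and hook: "hook w" and xy: "below x w" "below y w"
  shows "\<exists>m. below m x \<and> below m y \<and> (\<forall>u. below u x \<longrightarrow> below u y \<longrightarrow> below u m)"
proof -
  define L where "L u \<longleftrightarrow> below u x \<and> below u y" for u
  have "L id"
    using below_id[OF belowD(1)[OF xy(1)]] below_id[OF belowD(1)[OF xy(2)]] by (simp add: L_def)
  moreover have "\<forall>u. L u \<longrightarrow> len u < Suc (len x)"
    using below_length by (auto simp: L_def less_Suc_eq_le)
  ultimately have "\<exists>m. L m \<and> (\<forall>u. L u \<longrightarrow> len u \<le> len m)"
    by (rule ex_has_greatest_nat)
  then obtain m where m: "L m" "\<And>u. L u \<Longrightarrow> len u \<le> len m"
    by blast
  have "below u m" if u: "L u" for u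
  proof -
    have "below m w" "below u w"
      using m(1) u below_trans[OF _ xy(1)] unfolding L_def by blast+
    then obtain j where j: "is_join w m u j"
      using join_exists[OF w hook below_id[OF belowD(1)] below_id[OF belowD(1)]] by blast
    then have "L j"
      using m(1) u xy unfolding is_join_def L_def by blast
    then have "m = j"
      using m(2) j below_length_eq unfolding is_join_def by blast
    with j show ?thesis
      unfolding is_join_def by blast
  qed
  with m(1) show ?thesis
    unfolding L_def by blast
qed

end

section \<open>The lattice criterion\<close>

context signed_permutations
begin

section \<open>The interval as an ordered structure\<close>

lemma abs_interval_eq: "w \<in> G \<Longrightarrow> abs_interval n w = {z. below z w}"
  using below_id unfolding abs_interval_def below_def by auto

lemma interval_poset_sel:
  assumes "w \<in> G"
  shows "carrier (interval_poset n w) = {z. below z w}" "gorder.le (interval_poset n w) = abs_le n"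
    "eq (interval_poset n w) = (=)"
  using abs_interval_eq[OF assms] by (simp_all add: interval_poset_def)

lemma abs_le_iff_below: "below x w \<Longrightarrow> below y w \<Longrightarrow> abs_le n x y \<longleftrightarrow> below x y"
  by (simp add: below_def)

lemma interval_partial_order:
  assumes w: "w \<in> G"
  shows "partial_order (interval_poset n w)"
proof -
  have 1: "abs_le n x x" if "below x w" for x
    using below_refl[OF belowD(1)[OF that]] by (simp add: below_def)
  have 2: "x = y" if "abs_le n x y" "abs_le n y x" "below x w" "below y w" for x y
    using that below_antisym abs_le_iff_below by metis
  have 3: "abs_le n x z" if "abs_le n x y" "abs_le n y z" "below x w" "below y w" "below z w" for x y z
    using that below_trans abs_le_iff_below by metis
  show ?thesis
    by (unfold_locales; unfold interval_poset_sel[OF w] mem_Collect_eq; metis 1 2 3)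
qed

lemma least_Upper_iff:
  assumes w: "w \<in> G" and xy: "below x w" "below y w"
  shows "least (interval_poset n w) m (Upper (interval_poset n w) {x, y}) \<longleftrightarrow> is_join w x y m"
proof -
  have Upper: "Upper (interval_poset n w) {x, y} = {u. below u w \<and> below x u \<and> below y u}"
  proof (intro equalityI subsetI)
    fix u assume "u \<in> Upper (interval_poset n w) {x, y}"
    then have "below u w" "abs_le n x u" "abs_le n y u"
      using xy unfolding Upper_def interval_poset_sel[OF w] by auto
    then show "u \<in> {u. below u w \<and> below x u \<and> below y u}"
      using xy abs_le_iff_below by blast
  next
    fix u assume "u \<in> {u. below u w \<and> below x u \<and> below y u}"
    then show "u \<in> Upper (interval_poset n w) {x, y}"
      unfolding Upper_def interval_poset_sel[OF w] by (auto simp: below_def)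
  qed
  have le: "below m u \<longleftrightarrow> abs_le n m u" if "below u w" "below m w" for u
    using that abs_le_iff_below by blast
  show ?thesis
    unfolding least_def Upper interval_poset_sel[OF w] is_join_def using le by auto
qed

lemma greatest_Lower_iff:
  assumes w: "w \<in> G" and xy: "below x w" "below y w"
  shows "greatest (interval_poset n w) m (Lower (interval_poset n w) {x, y}) \<longleftrightarrow>
    below m x \<and> below m y \<and> (\<forall>u. below u x \<longrightarrow> below u y \<longrightarrow> below u m)"
proof -
  have Lower: "Lower (interval_poset n w) {x, y} = {l. below l x \<and> below l y}"
  proof (intro equalityI subsetI)
    fix l assume "l \<in> Lower (interval_poset n w) {x, y}"
    then have "below l w" "abs_le n l x" "abs_le n l y"
      using xy unfolding Lower_def interval_poset_sel[OF w] by auto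
    then show "l \<in> {l. below l x \<and> below l y}"
      using xy abs_le_iff_below by blast
  next
    fix l assume "l \<in> {l. below l x \<and> below l y}"
    then have l: "below l x" "below l y" "below l w"
      using below_trans[OF _ xy(1)] by blast+
    then have "abs_le n l x" "abs_le n l y"
      by (simp_all add: below_def)
    with l show "l \<in> Lower (interval_poset n w) {x, y}"
      unfolding Lower_def interval_poset_sel[OF w] by auto
  qed
  have le: "below l w \<and> (below l m \<longleftrightarrow> abs_le n l m)" if "below l x" "below m x" for l
    using below_trans[OF _ xy(1)] that abs_le_iff_below by blast
  have sub: "{l. below l x \<and> below l y} \<subseteq> {l. below l w}"
    using below_trans[OF _ xy(1)] by blast
  show ?thesis
    unfolding greatest_def Lower interval_poset_sel[OF w] using le sub by auto
qed

lemma hook_imp_lattice: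
  assumes w: "w \<in> G" and hook: "hook w"
  shows "Lattice.lattice (interval_poset n w)"
proof -
  interpret partial_order "interval_poset n w"
    by (rule interval_partial_order[OF w])
  show ?thesis
  proof unfold_locales
    fix x y assume "x \<in> carrier (interval_poset n w)" "y \<in> carrier (interval_poset n w)"
    then have xy: "below x w" "below y w"
      by (simp_all add: interval_poset_sel[OF w])
    show "\<exists>s. least (interval_poset n w) s (Upper (interval_poset n w) {x, y})"
      unfolding least_Upper_iff[OF w xy]
      using join_exists[OF w hook below_id[OF belowD(1)[OF xy(1)]] below_id[OF belowD(1)[OF xy(2)]] xy] .
    show "\<exists>s. greatest (interval_poset n w) s (Lower (interval_poset n w) {x, y})"
      unfolding greatest_Lower_iff[OF w xy] using meet_exists[OF w hook xy] .
  qed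
qed

lemma lattice_join:
  assumes "w \<in> G" "Lattice.lattice (interval_poset n w)" "below x w" "below y w"
  shows "\<exists>m. is_join w x y m"
proof -
  interpret Lattice.lattice "interval_poset n w"
    by (rule assms(2))
  show ?thesis
    using sup_of_two_exists[of x y] assms(3,4) least_Upper_iff[OF assms(1,3,4)]
    by (simp add: interval_poset_sel[OF assms(1)])
qed

text \<open>\<open>[a, b][c, d] = ((a, b, c, d))((b, - d))\<close>, stated pointwise since
  \<open>u\<close> may have further cycles. Renaming the points to \<open>b, - a, d, - c\<close>
  gives the second 4-cycle below \<open>u\<close>.\<close>

lemma four_cycle:
  assumes u: "u \<in> G" and abcd: "b \<in> X" "d \<in> X" "b \<noteq> - d"
    and ua: "u a = b" and ub: "u b = - a" and uc: "u c = d" and ud: "u d = - c"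
    and dist: "a \<noteq> b" "a \<noteq> d" "c \<noteq> b" "c \<noteq> d" "a \<noteq> - b" "a \<noteq> - d" "c \<noteq> - b" "c \<noteq> - d"
  defines "z \<equiv> u \<circ> sswap b (- d)"
  shows "below z u" "z a = b" "z b = c" "z c = d" "z d = a"
    and "\<And>x. x \<noteq> b \<Longrightarrow> x \<noteq> d \<Longrightarrow> x \<noteq> - b \<Longrightarrow> x \<noteq> - d \<Longrightarrow> z x = u x"
proof -
  note hu = hyperoctahedralD[OF u]
  have bal: "eqv u b (- b)" "eqv u d (- d)"
    unfolding eqv_balanced_iff
  proof safe
    fix f assume f: "f \<in> Inv u"
    show "f b = 0"
      using invariantsD(2)[OF f, of a] invariantsD(2)[OF f, of b] invariantsD(3)[OF f, of a] ua ub by simp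
    show "f d = 0"
      using invariantsD(2)[OF f, of c] invariantsD(2)[OF f, of d] invariantsD(3)[OF f, of c] uc ud by simp
  qed
  have "eqv u b (- d)"
    unfolding eqv_def
  proof
    fix f assume f: "f \<in> Inv u"
    show "f b = f (- d)"
      using eqv_balanced_zero[OF bal(1) f] eqv_balanced_zero[OF bal(2) f] invariantsD(3)[OF f, of d] by simp
  qed
  then show "below z u"
    unfolding z_def using u abcd by (intro comp_sswap_below) auto
  show "z x = u x" if "x \<noteq> b" "x \<noteq> d" "x \<noteq> - b" "x \<noteq> - d" for x
    using that by (simp add: z_def sswap_fixes)
  then show "z a = b" "z c = d"
    using dist ua uc by auto
  show "z b = c"
    using hu(4)[of d] ud by (simp add: z_def)
  have "sswap b (- d) d = - b"
    using abcd nonzero_signed_points by (auto simp: sswap_def)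
  then show "z d = a"
    using hu(4)[of b] ub by (simp add: z_def)
qed

definition ind :: "int \<Rightarrow> int \<Rightarrow> int \<Rightarrow> int \<Rightarrow> int \<Rightarrow> real" where
  "ind a b c d x = (if x \<in> {a, b, c, d} then 1 else if - x \<in> {a, b, c, d} then - 1 else 0)"

lemma ind_invariant:
  assumes z: "z \<in> G" and X4: "a \<in> X" "b \<in> X" "c \<in> X" "d \<in> X"
    and cyc: "z a = b" "z b = c" "z c = d" "z d = a"
    and ne: "a \<noteq> - b" "a \<noteq> - c" "a \<noteq> - d" "b \<noteq> - c" "b \<noteq> - d" "c \<noteq> - d"
  shows "ind a b c d \<in> Inv z"
proof -
  note hz = hyperoctahedralD[OF z]
  have nz: "a \<noteq> 0" "b \<noteq> 0" "c \<noteq> 0" "d \<noteq> 0"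
    using X4 nonzero_signed_points by blast+
  have img: "z x \<in> {a, b, c, d} \<longleftrightarrow> x \<in> {a, b, c, d}" for x
  proof -
    have "z x \<in> z ` {d, a, b, c} \<longleftrightarrow> x \<in> {d, a, b, c}"
      by (rule inj_image_mem_iff[OF hz(2)])
    then show ?thesis
      using cyc by auto
  qed
  have excl: "\<not> (x \<in> {a, b, c, d} \<and> - x \<in> {a, b, c, d})" for x
    using ne nz by auto
  have "ind a b c d (- x) = - ind a b c d x" for x
    using excl[of x] unfolding ind_def by auto
  moreover have "ind a b c d x = 0" if "x \<notin> X" for x
  proof -
    have "x \<notin> {a, b, c, d}" "- x \<notin> {a, b, c, d}"
      using that X4 uminus_signed_points[of x] by blast+
    then show ?thesis by (simp add: ind_def)
  qed
  moreover have "ind a b c d (z x) = ind a b c d x" for x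
    using img[of x] img[of "- x"] unfolding ind_def hz(4) by presburger
  ultimately show ?thesis
    unfolding invariants_def odd_funs_def by blast
qed

lemma eqv_of_cycle: "z a = b \<Longrightarrow> eqv z a b"
  using eqv_image[of z a] eqv_sym by auto

text \<open>The obstruction: below \<open>[a, b][c, d]\<close> the two reflections \<open>((a, c))\<close> and \<open>((b, d))\<close> have
  the upper bounds \<open>((a, b, c, d))\<close> and \<open>((b, -a, d, -c))\<close>, whose only common lower
  candidate \<open>((a, c))((b, d))\<close> is not below \<open>[a, b][c, d]\<close>.\<close>

lemma two_balanced_no_join:
  assumes u: "u \<in> G" and X4: "a \<in> X" "b \<in> X" "c \<in> X" "d \<in> X"
    and ua: "u a = b" and ub: "u b = - a" and uc: "u c = d" and ud: "u d = - c"
    and ne: "a \<noteq> b" "a \<noteq> c" "a \<noteq> d" "b \<noteq> c" "b \<noteq> d" "c \<noteq> d"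
      "a \<noteq> - b" "a \<noteq> - c" "a \<noteq> - d" "b \<noteq> - c" "b \<noteq> - d" "c \<noteq> - d"
    and uw: "below u w"
  shows "\<not> is_join w (sswap a c) (sswap b d) m"
proof
  assume join: "is_join w (sswap a c) (sswap b d) m"
  note hu = hyperoctahedralD[OF u]
  have minus: "- a \<in> X" "- c \<in> X" "u (- a) = - b" "u (- c) = - d"
    using X4 hu(4) ua uc by auto
  have ne': "b \<noteq> a" "c \<noteq> a" "d \<noteq> a" "c \<noteq> b" "d \<noteq> b" "d \<noteq> c" "b \<noteq> - a" "c \<noteq> - a" "d \<noteq> - a" "c \<noteq> - b"
    "d \<noteq> - b" "d \<noteq> - c" "- a \<noteq> b" "- a \<noteq> c" "- a \<noteq> d" "- c \<noteq> a" "- c \<noteq> b" "- c \<noteq> d"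
    using ne by auto
  define z where "z = u \<circ> sswap b (- d)"
  define z' where "z' = u \<circ> sswap (- a) c"
  note z = four_cycle[OF u X4(2,4) ne(11) ua ub uc ud ne(1,3) ne'(4) ne(6,7,9) ne'(10) ne(12), folded z_def]
  have "below z' u \<and> z' b = - a \<and> z' (- a) = d \<and> z' d = - c \<and> z' (- c) = b"
    using four_cycle[OF u minus(1,2) _ ub minus(3) ud minus(4)] ne ne' unfolding z'_def by auto
  then have z': "below z' u" "z' b = - a" "z' (- a) = d" "z' d = - c" "z' (- c) = b"
    by blast+
  note zG = belowD(1)[OF z(1)] and z'G = belowD(1)[OF z'(1)]
  have eqv_z: "eqv z a c" "eqv z b d"
    using eqv_of_cycle[of z a b, OF z(2)] eqv_of_cycle[of z b c, OF z(3)] eqv_of_cycle[of z c d, OF z(4)]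
      eqv_trans by blast+
  have "eqv z' (- a) (- c)" "eqv z' b d"
    using eqv_of_cycle[of z' b "- a", OF z'(2)] eqv_of_cycle[of z' "- a" d, OF z'(3)]
      eqv_of_cycle[of z' d "- c", OF z'(4)] eqv_trans by blast+
  then have eqv_z': "eqv z' a c" "eqv z' b d"
    by (simp_all add: eqv_minus)
  have "below m z" "below m z'" and m: "below m w" "below (sswap a c) m" "below (sswap b d) m"
    using join below_trans[OF z(1) uw] below_trans[OF z'(1) uw] eqv_z eqv_z'
      sswap_below_iff[OF zG X4(1,3) ne(2)] sswap_below_iff[OF zG X4(2,4) ne(5)]
      sswap_below_iff[OF z'G X4(1,3) ne(2)] sswap_below_iff[OF z'G X4(2,4) ne(5)]
    unfolding is_join_def by blast+
  note mG = belowD(1)[OF m(1)]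
  note hm = hyperoctahedralD[OF mG]
  \<comment> \<open>\<open>m\<close> preserves the signed indicators of both 4-cycles, and their
    joint values distinguish \<open>a\<close>, \<open>c\<close> from \<open>b\<close>,
    \<open>d\<close>. So \<open>m\<close> maps each of the two pairs to itself.\<close>
  define g where "g = ind a b c d"
  define g' where "g' = ind b (- a) d (- c)"
  have "g \<in> Inv z"
    unfolding g_def by (rule ind_invariant[OF zG X4 z(2-5) ne(7-12)])
  then have g: "g \<in> Inv m"
    using below_invariants[OF \<open>below m z\<close>] by blast
  have "g' \<in> Inv z'"
    unfolding g'_def using X4 z' ne ne' by (intro ind_invariant[OF z'G]) auto
  then have g': "g' \<in> Inv m"
    using below_invariants[OF \<open>below m z'\<close>] by blast
  have g_m: "g (m x) = g x" "g' (m x) = g' x" for x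
    using invariantsD(2)[OF g] invariantsD(2)[OF g'] by auto
  have g_vals: "g a = 1" "g b = 1" "g c = 1" "g d = 1"
    by (simp_all add: g_def ind_def)
  have g'_vals: "g' a = - 1" "g' b = 1" "g' c = - 1" "g' d = 1"
    using ne ne' X4 nonzero_signed_points by (auto simp: g'_def ind_def)
  have g_1: "x \<in> {a, b, c, d}" if "g x = 1" for x
    using that by (simp add: g_def ind_def split: if_splits)
  have ac: "x = a \<or> x = c" if "g x = 1" "g' x = - 1" for x
    using g_1[OF that(1)] that(2) g'_vals by auto
  have bd: "x = b \<or> x = d" if "g x = 1" "g' x = 1" for x
    using g_1[OF that(1)] that(2) g'_vals by auto
  have m_in: "m a \<in> {a, c}" "m c \<in> {a, c}" "m b \<in> {b, d}" "m d \<in> {b, d}"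
    using ac[of "m a"] ac[of "m c"] bd[of "m b"] bd[of "m d"] g_vals g'_vals unfolding g_m by simp_all
  \<comment> \<open>If \<open>m\<close> fixed \<open>x\<close>, the coordinate function of
    \<open>x\<close> would be an invariant of \<open>m\<close> separating \<open>x\<close> from
    \<open>y\<close>.\<close>
  have moved: "m x \<noteq> x" if xy: "x \<in> X" "x \<noteq> y" "x \<noteq> - y" "eqv m x y" for x y
  proof
    assume "m x = x"
    then have "m p = x \<longleftrightarrow> p = x" "m p = - x \<longleftrightarrow> p = - x" for p
      using hm(7)[of p x] hm(7)[of p "- x"] hm(4)[of x] by simp_all
    moreover have "rho x (- x) \<in> V"
      using xy(1) nonzero_signed_points[of x] by (intro rho_odd) auto
    ultimately have "rho x (- x) \<in> Inv m"
      by (simp add: invariants_def rho_def)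
    then have "rho x (- x) x = rho x (- x) y"
      using xy(4) by (simp add: eqv_def)
    then show False
      using xy by (auto simp: rho_def split: if_splits)
  qed
  have eqv_m: "eqv m a c" "eqv m b d"
    using m sswap_below_iff[OF mG X4(1,3) ne(2)] sswap_below_iff[OF mG X4(2,4) ne(5)] by blast+
  have "m a = c" "m b = d"
    using m_in moved[OF X4(1) ne(2) ne(8) eqv_m(1)] moved[OF X4(2) ne(5) ne(11) eqv_m(2)] by auto
  then have mv: "m a = c" "m c = a" "m b = d" "m d = b"
    using m_in hm(7)[of a c] hm(7)[of b d] ne by auto
  have "below m u"
    using below_trans[OF \<open>below m z\<close> z(1)] .
  then obtain v where v: "v \<in> G" "u = m \<circ> v" "complementary m v"
    using belowE by metis
  have mv_eq: "m (v x) = u x" for x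
    by (simp add: v(2))
  have "m (v a) = m d" "m (v d) = m (- a)" "m (v c) = m b" "m (v b) = m (- c)"
    unfolding mv_eq hm(4) mv ua ub uc ud by simp_all
  then have vv: "v a = d" "v d = - a" "v c = b" "v b = - c"
    unfolding hm(7) by simp_all
  \<comment> \<open>\<open>v\<close> acts on the four points as \<open>[a, d][c, b]\<close>, so its
    invariants vanish there, while those of \<open>m\<close> agree at \<open>a\<close> and
    \<open>c\<close>. Hence no sum of the two separates \<open>a\<close> from \<open>c\<close>,
    against \<open>complementary m v\<close>.\<close>
  have zero: "f a = 0" "f c = 0" if f: "f \<in> Inv v" for f
    using invariantsD(2)[OF f, of a] invariantsD(2)[OF f, of d] invariantsD(2)[OF f, of c]
      invariantsD(2)[OF f, of b] invariantsD(3)[OF f, of a] invariantsD(3)[OF f, of c] vv by simp_all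
  have "rho a (- a) \<in> V"
    using X4(1) nonzero_signed_points[of a] by (intro rho_odd) auto
  then obtain p q where pq: "p \<in> Inv m" "q \<in> Inv v" "\<And>x. rho a (- a) x = p x + q x"
    using complementaryE[OF v(3)] by blast
  have "rho a (- a) a = rho a (- a) c"
    using pq(3)[of a] pq(3)[of c] zero[OF pq(2)] invariantsD(2)[OF pq(1), of a] mv by simp
  then show False
    using ne by (simp add: rho_def split: if_splits)
qed

text \<open>Two long balanced cycles contain steps from \<open>a\<close> to \<open>b = w a\<close>
  and from \<open>c\<close> to \<open>d = w c\<close>; restricting \<open>w\<close> to these points
  and their negatives leaves \<open>[a, b][c, d]\<close>.\<close>

lemma not_hook_imp_two_balanced:
  assumes w: "w \<in> G" and "\<not> hook w"
  obtains u a b c d where "below u w" "a \<in> X" "b \<in> X" "c \<in> X" "d \<in> X"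
    "u a = b" "u b = - a" "u c = d" "u d = - c"
    "a \<noteq> b" "a \<noteq> c" "a \<noteq> d" "b \<noteq> c" "b \<noteq> d" "c \<noteq> d"
    "a \<noteq> - b" "a \<noteq> - c" "a \<noteq> - d" "b \<noteq> - c" "b \<noteq> - d" "c \<noteq> - d"
proof -
  note hw = hyperoctahedralD[OF w]
  obtain a c where ac: "a \<in> X" "c \<in> X" "eqv w a (- a)" "eqv w c (- c)" "w a \<noteq> - a" "w c \<noteq> - c"
    "\<not> same_orbit w a c"
    using assms(2) unfolding hook_def by blast
  define b where "b = w a"
  define d where "d = w c"
  have bd: "b \<in> X" "d \<in> X"
    using ac hw(6) by (auto simp: b_def d_def)
  have bal: "eqv w b (- b)" "eqv w d (- d)"
    using eqv_balanced_trans[OF ac(3) eqv_of_cycle[of w a b, OF b_def[symmetric]]]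
      eqv_balanced_trans[OF ac(4) eqv_of_cycle[of w c d, OF d_def[symmetric]]] by blast+
  have ab: "a \<noteq> b" "a \<noteq> - b" "c \<noteq> d" "c \<noteq> - d"
    using balanced_not_fixed[OF w ac(1,3)] balanced_not_fixed[OF w ac(2,4)] ac(5,6) 
    by (auto simp: b_def d_def)
  define A where "A = {x. same_orbit w a x}"
  define C where "C = {x. same_orbit w c x}"
  have orbit_minus: "same_orbit w p (- x)" if "same_orbit w p (- p)" "same_orbit w p x" for p x
    using that same_orbit_minus[OF w, of p x] same_orbit_trans by blast
  have a_minus: "same_orbit w a (- a)" "same_orbit w c (- c)"
    using balanced_iff_same_orbit[OF w ac(1)] balanced_iff_same_orbit[OF w ac(2)] ac by blast+
  have A: "\<forall>x\<in>A. - x \<in> A" "\<forall>x. w x \<in> A \<longleftrightarrow> x \<in> A" and C: "\<forall>x\<in>C. - x \<in> C" "\<forall>x. w x \<in> C \<longleftrightarrow> x \<in> C"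
    using orbit_minus a_minus same_orbit_image_iff[OF w] by (auto simp: A_def C_def)
  have mem: "a \<in> A" "b \<in> A" "- a \<in> A" "- b \<in> A" "c \<in> C" "d \<in> C" "- c \<in> C" "- d \<in> C"
    using A C same_orbit_refl same_orbit_image by (auto simp: A_def C_def b_def d_def)
  have disj: "x \<notin> C" if "x \<in> A" for x
    using that ac(7) same_orbit_sym[OF w] same_orbit_trans unfolding A_def C_def by blast
  have not_mem: "c \<notin> A" "d \<notin> A" "- c \<notin> A" "- d \<notin> A" "a \<notin> C" "b \<notin> C" "- a \<notin> C" "- b \<notin> C"
    using disj mem by blast+
  have ne: "a \<noteq> c" "a \<noteq> d" "b \<noteq> c" "b \<noteq> d" "a \<noteq> - c" "a \<noteq> - d" "b \<noteq> - c" "b \<noteq> - d"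
    using not_mem mem by auto
  define I where "I = {a, b, c, d, - a, - b, - c, - d}"
  have "\<exists>m. below m w \<and> (\<forall>x. x \<notin> I \<longrightarrow> m x = x) \<and> (\<forall>x\<in>I. eqv m x (- x)) \<and>
    (\<forall>x\<in>I. w x \<in> I \<longrightarrow> m x = w x) \<and>
    (\<forall>A. (\<forall>x\<in>A. - x \<in> A) \<longrightarrow> (\<forall>x. w x \<in> A \<longleftrightarrow> x \<in> A) \<longrightarrow> (\<forall>x. m x \<in> A \<longleftrightarrow> x \<in> A))"
    using bal ac by (intro restriction_exists[OF w]) (auto simp: I_def eqv_minus_right intro: eqv_sym)
  then obtain u where u: "below u w" and fix_u: "\<forall>x. x \<notin> I \<longrightarrow> u x = x" and bal_u: "\<forall>x\<in>I. eqv u x (- x)"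
    and eq_u: "\<forall>x\<in>I. w x \<in> I \<longrightarrow> u x = w x"
    and pres: "\<forall>A. (\<forall>x\<in>A. - x \<in> A) \<longrightarrow> (\<forall>x. w x \<in> A \<longleftrightarrow> x \<in> A) \<longrightarrow> (\<forall>x. u x \<in> A \<longleftrightarrow> x \<in> A)"
    by (elim exE conjE)
  note uG = belowD(1)[OF u]
  note hu = hyperoctahedralD[OF uG]
  have u_A: "u x \<in> A \<longleftrightarrow> x \<in> A" and u_C: "u x \<in> C \<longleftrightarrow> x \<in> C" for x
    using pres[THEN spec, THEN mp, THEN mp, OF A] pres[THEN spec, THEN mp, THEN mp, OF C] by blast+
  have ua: "u a = b" "u c = d"
    using eq_u by (auto simp: I_def b_def d_def)
  have u_I: "u x \<in> I" if "x \<in> I" for x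
  proof (rule ccontr)
    assume nI: "u x \<notin> I"
    then have "u (u x) = u x"
      using fix_u by blast
    with hu(7) nI that show False by simp
  qed
  \<comment> \<open>Injectivity leaves only \<open>p\<close> and \<open>- p\<close> for
    \<open>u q\<close>, and \<open>p\<close> would close an orbit without \<open>- p\<close>,
    although \<open>p\<close> is balanced.\<close>
  have second: "u q = - p" if pq: "u p = q" "p \<in> X" "p \<noteq> q" "p \<noteq> - q" "eqv u p (- p)" "u q \<in> {p, q, - p, - q}" for p q
  proof -
    have "u q \<noteq> q" "u q \<noteq> - q"
      using hu(7)[of q p] hu(7)[of q "- p"] hu(4)[of p] pq by auto
    moreover have "u q \<noteq> p"
    proof
      assume "u q = p"
      then have "(u x = p \<or> u x = q) = (x = p \<or> x = q)" for x
        using hu(7)[of x p] hu(7)[of x q] pq(1) by auto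
      moreover have "same_orbit u p (- p)"
        using balanced_iff_same_orbit[OF uG pq(2)] pq(5) by blast
      ultimately have "(- p = p \<or> - p = q) = (p = p \<or> p = q)"
        by (rule same_orbit_invariant)
      then show False
        using pq(4) nonzero_signed_points[OF pq(2)] by auto
    qed
    ultimately show ?thesis
      using pq(6) by blast
  qed
  have "u b \<in> {a, b, - a, - b}"
  proof -
    have "u b \<in> A" "u b \<in> I"
      using u_A[of b] mem u_I[of b] by (auto simp: I_def)
    moreover from this have "u b \<notin> {c, d, - c, - d}"
      using not_mem by auto
    ultimately show ?thesis
      unfolding I_def by auto
  qed
  then have ub: "u b = - a"
    using second[OF ua(1) ac(1) ab(1,2)] bal_u by (simp add: I_def)
  have "u d \<in> {c, d, - c, - d}"
  proof -
    have "u d \<in> C" "u d \<in> I"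
      using u_C[of d] mem u_I[of d] by (auto simp: I_def)
    moreover from this have "u d \<notin> {a, b, - a, - b}"
      using not_mem by auto
    ultimately show ?thesis
      unfolding I_def by auto
  qed
  then have ud: "u d = - c"
    using second[OF ua(2) ac(2) ab(3,4)] bal_u by (simp add: I_def)
  show ?thesis
    by (rule that[OF u ac(1) bd(1) ac(2) bd(2) ua(1) ub ua(2) ud]) (fact ab ne)+
qed

lemma lattice_iff_hook:
  assumes w: "w \<in> G"
  shows "Lattice.lattice (interval_poset n w) \<longleftrightarrow> hook w"
proof
  assume lat: "Lattice.lattice (interval_poset n w)"
  show "hook w"
  proof (rule ccontr)
    assume "\<not> hook w"
    obtain u a b c d where uw: "below u w" and X4: "a \<in> X" "b \<in> X" "c \<in> X" "d \<in> X" and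
      u: "u a = b" "u b = - a" "u c = d" "u d = - c" and
      ne: "a \<noteq> b" "a \<noteq> c" "a \<noteq> d" "b \<noteq> c" "b \<noteq> d" "c \<noteq> d"
      "a \<noteq> - b" "a \<noteq> - c" "a \<noteq> - d" "b \<noteq> - c" "b \<noteq> - d" "c \<noteq> - d"
      using not_hook_imp_two_balanced[OF w \<open>\<not> hook w\<close>] .
    note uG = belowD(1)[OF uw]
    have "eqv u a b" "eqv u b (- a)" "eqv u c d" "eqv u d (- c)"
      by (rule eqv_of_cycle, rule u)+
    then have bal: "eqv u a (- a)" "eqv u c (- c)"
      using eqv_trans by blast+
    have zero: "f a = 0" "f b = 0" "f c = 0" "f d = 0" if f: "f \<in> Inv u" for f
      using eqv_balanced_zero[OF bal(1) f] eqv_balanced_zero[OF bal(2) f]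
        invariantsD(2)[OF f, of a] invariantsD(2)[OF f, of c] u by simp_all
    have "eqv u a c" "eqv u b d"
      unfolding eqv_def using zero by metis+
    then have "below (sswap a c) w" "below (sswap b d) w"
      using sswap_below_iff[OF uG X4(1,3) ne(2)] sswap_below_iff[OF uG X4(2,4) ne(5)] below_trans[OF _ uw]
      by blast+
    then obtain m where "is_join w (sswap a c) (sswap b d) m"
      using lattice_join[OF w lat] by blast
    then show False
      using two_balanced_no_join[OF uG X4 u ne uw] by blast
  qed
qed (rule hook_imp_lattice[OF w])

end

section \<open>Cycle decompositions and hook partitions\<close>

context signed_permutations
begin

text \<open>In a decreasing list of positive parts, a single part different from 1 must come
  first.\<close>

lemma hook_partition_sorted_iff:
  assumes "\<forall>x\<in>#M. 1 \<le> x"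
  shows "hook_partition (rev (sorted_list_of_multiset M)) \<longleftrightarrow> size (filter_mset (\<lambda>x. x \<noteq> 1) M) \<le> 1"
proof -
  define p where "p = rev (sorted_list_of_multiset M)"
  have M: "set p = set_mset M"
    by (simp add: p_def)
  have size: "size (filter_mset (\<lambda>x. x \<noteq> 1) M) = length (filter (\<lambda>x. x \<noteq> 1) p)"
    by (metis p_def mset_filter mset_rev mset_sorted_list_of_multiset size_mset)
  have sorted: "sorted (rev p)"
    by (simp add: p_def)
  show ?thesis
    unfolding p_def[symmetric] size
  proof
    assume "hook_partition p"
    then show "length (filter (\<lambda>x. x \<noteq> 1) p) \<le> 1"
      by (auto simp: hook_partition_def)
  next
    assume short: "length (filter (\<lambda>x. x \<noteq> 1) p) \<le> 1"
    show "hook_partition p"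
    proof (cases p)
      case Nil
      then show ?thesis by (simp add: hook_partition_def)
    next
      case (Cons k q)
      have ge: "1 \<le> k" "\<forall>x\<in>set q. 1 \<le> x"
        using assms M Cons by auto
      have "x = 1" if x: "x \<in> set q" for x
      proof (rule ccontr)
        assume ne: "x \<noteq> 1"
        have "x \<le> k"
          using sorted x unfolding Cons by (simp add: sorted_append)
        then have "k \<noteq> 1"
          using ge x ne by force
        then have "filter (\<lambda>x. x \<noteq> 1) q = []"
          using short unfolding Cons by simp
        then show False
          using x ne by (simp add: filter_empty_conv)
      qed
      then have "q = replicate (length q) 1"
        by (metis replicate_length_same)
      then show ?thesis
        unfolding hook_partition_def Cons using ge(1) by metis
    qed
  qed
qed

section \<open>Cycles of a decomposition as orbits\<close>

lemma product_fixes: "(\<And>f. f \<in> set fs \<Longrightarrow> f x = x) \<Longrightarrow> product fs x = x"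
  by (induction fs) auto

lemma balanced_cycle_fixes: "\<bar>x\<bar> \<notin> abs ` set b \<Longrightarrow> balanced_cycle b x = x"
  unfolding balanced_cycle_def by (rule id_outside_supp) (auto simp: image_iff)

lemma paired_cycle_fixes:
  assumes "\<bar>x\<bar> \<notin> abs ` set p"
  shows "paired_cycle p x = x"
proof -
  have "x \<notin> set p" "x \<notin> set (map uminus p)"
    using assms by (auto simp: image_iff)
  then show ?thesis
    by (simp add: paired_cycle_def id_outside_supp)
qed

lemma distinct_append_uminus_iff:
  fixes b :: "int list"
  assumes "0 \<notin> set b"
  shows "distinct (b @ map uminus b) \<longleftrightarrow> distinct (map abs b)"
proof
  assume dist: "distinct (b @ map uminus b)"
  then have "x = y" if "x \<in> set b" "y \<in> set b" "\<bar>x\<bar> = \<bar>y\<bar>" for x y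
    using that by (auto simp: abs_eq_iff)
  then show "distinct (map abs b)"
    using dist by (auto simp: distinct_map intro: inj_onI)
next
  assume dist: "distinct (map abs b)"
  have "x \<noteq> - y" if "x \<in> set b" "y \<in> set b" for x y
  proof
    assume "x = - y"
    moreover from this have "x = y"
      using dist that by (auto simp: distinct_map dest!: inj_onD[of abs "set b" x y])
    ultimately show False
      using that assms by auto
  qed
  then show "distinct (b @ map uminus b)"
    using dist by (auto simp: distinct_map)
qed

definition signed_orbit :: "(int \<Rightarrow> int) \<Rightarrow> int \<Rightarrow> int \<Rightarrow> bool" where
  "signed_orbit w a x \<longleftrightarrow> same_orbit w a x \<or> same_orbit w a (- x)"

text \<open>The cycle of \<open>w\<close> through \<open>a\<close>, whether paired or balanced;
  taking the orbit up to sign makes the definition uniform.\<close>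

definition orbit_part :: "(int \<Rightarrow> int) \<Rightarrow> int \<Rightarrow> int \<Rightarrow> int" where
  "orbit_part w a x = (if signed_orbit w a x then w x else x)"

definition orbit_rest :: "(int \<Rightarrow> int) \<Rightarrow> int \<Rightarrow> int \<Rightarrow> int" where
  "orbit_rest w a x = (if signed_orbit w a x then x else w x)"

lemma same_orbit_signed: "w \<in> G \<Longrightarrow> same_orbit w a x \<Longrightarrow> a \<in> X \<Longrightarrow> x \<in> X"
  using same_orbit_invariant[of "\<lambda>x. x \<in> X" w a x] hyperoctahedralD(6) by blast

lemma support_eq_orbit:
  assumes "w \<in> G"
  shows "set (support w a) = {x. same_orbit w a x}"
  unfolding support_set[OF hyperoctahedralD(8)[OF assms]] same_orbit_def by auto

lemma cycle_of_support:
  assumes "w \<in> G"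
  shows "cycle_of_list (support w a) x = (if same_orbit w a x then w x else x)"
proof (cases "same_orbit w a x")
  case True
  then have "x \<in> set (support w a)"
    using support_eq_orbit[OF assms] by blast
  then show ?thesis
    using cycle_restrict[OF hyperoctahedralD(8)[OF assms]] True by simp
next
  case False
  then have "x \<notin> set (support w a)"
    using support_eq_orbit[OF assms] by blast
  then show ?thesis
    using False by (simp add: id_outside_supp)
qed

text \<open>If \<open>- a\<close> is reached after \<open>k\<close> steps, fewer than the period,
  then the period divides \<open>2 * k\<close> and so equals it. The second half of the orbit is the
  negative of the first, as in \<open>balanced_cycle\<close>.\<close>

lemma balanced_orbit_list:
  assumes w: "w \<in> G" and a: "a \<in> X" "same_orbit w a (- a)"
  obtains b where "b \<noteq> []" "set b \<subseteq> {x. same_orbit w a x}" "distinct (map abs b)"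
    "balanced_cycle b = orbit_part w a"
proof -
  note perm = hyperoctahedralD(8)[OF w]
  define N where "N = least_power w a"
  have "- a \<in> set (support w a)"
    using support_eq_orbit[OF w] a(2) by blast
  then obtain k where k: "k < N" "(w ^^ k) a = - a"
    unfolding N_def by auto
  have pow_minus: "(w ^^ m) (- x) = - (w ^^ m) x" for m x
    by (induction m) (simp_all add: hyperoctahedralD(4)[OF w])
  have shift: "(w ^^ (k + m)) a = - (w ^^ m) a" for m
    by (metis add.commute comp_apply funpow_add k(2) pow_minus)
  have "(w ^^ (k + k)) a = a"
    unfolding shift k(2) by simp
  then have "N dvd k + k"
    unfolding N_def using least_power_dvd[OF perm] by blast
  moreover have "k \<noteq> 0"
    using k(2) nonzero_signed_points[OF a(1)] by (intro notI) simp
  moreover have "N = k + k" if "k + k = N * c" "k \<noteq> 0" for c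
  proof -
    have "N * c < N * 2"
      using k(1) that(1) by linarith
    then have "c < 2" by simp
    moreover have "c \<noteq> 0"
      using that by (intro notI) simp
    ultimately have "c = 1" by linarith
    then show ?thesis using that(1) by simp
  qed
  ultimately have N: "N = k + k"
    by (elim dvdE) blast
  define b where "b = map (\<lambda>m. (w ^^ m) a) [0..<k]"
  have "[0..<N] = [0..<k] @ map (\<lambda>m. m + k) [0..<k]"
    unfolding N map_add_upt by (rule upt_add_eq_append) simp
  then have "support w a = b @ map (\<lambda>m. (w ^^ (m + k)) a) [0..<k]"
    unfolding N_def[symmetric] b_def by (simp only: map_append map_map comp_def)
  also have "map (\<lambda>m. (w ^^ (m + k)) a) [0..<k] = map uminus b"
    unfolding b_def by (simp add: shift[unfolded add.commute[of k]])
  finally have supp: "support w a = b @ map uminus b" .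
  have set_b: "set b \<subseteq> {x. same_orbit w a x}"
    using support_eq_orbit[OF w, of a] unfolding supp by auto
  then have "0 \<notin> set b"
    using same_orbit_signed[OF w _ a(1)] nonzero_signed_points by blast
  moreover have "distinct (b @ map uminus b)"
    using cycle_of_permutation[OF perm, of a] unfolding supp .
  ultimately have "distinct (map abs b)"
    using distinct_append_uminus_iff by blast
  moreover have "balanced_cycle b x = orbit_part w a x" for x
  proof -
    have "same_orbit w a (- x) \<longleftrightarrow> same_orbit w a x" for x
      using a(2) same_orbit_minus[OF w, of a x] same_orbit_minus[OF w, of a "- x"] same_orbit_trans by auto
    then show ?thesis
      unfolding balanced_cycle_def supp[symmetric] cycle_of_support[OF w]
      by (simp add: orbit_part_def signed_orbit_def)
  qed
  moreover have "b \<noteq> []"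
    using \<open>k \<noteq> 0\<close> by (simp add: b_def)
  ultimately show ?thesis
    using that set_b by blast
qed

lemma paired_orbit_list:
  assumes w: "w \<in> G" and a: "a \<in> X" "\<not> same_orbit w a (- a)"
  obtains p where "p \<noteq> []" "set p \<subseteq> {x. same_orbit w a x}" "distinct (map abs p)"
    "paired_cycle p = orbit_part w a"
proof -
  define p where "p = support w a"
  have set_p: "set p = {x. same_orbit w a x}"
    unfolding p_def by (rule support_eq_orbit[OF w])
  have dist: "distinct p"
    unfolding p_def by (rule cycle_of_permutation[OF hyperoctahedralD(8)[OF w]])
  have excl: "\<not> same_orbit w a (- x)" if "same_orbit w a x" for x
  proof
    assume "same_orbit w a (- x)"
    then have "same_orbit w (- a) x"
      using same_orbit_minus[OF w, of a "- x"] by simp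
    then show False
      using a(2) that same_orbit_sym[OF w] same_orbit_trans by blast
  qed
  have "x = y" if "same_orbit w a x" "same_orbit w a y" "\<bar>x\<bar> = \<bar>y\<bar>" for x y
    using that excl[of y] by (auto simp: abs_eq_iff)
  then have "distinct (map abs p)"
    using dist set_p by (auto simp: distinct_map intro: inj_onI)
  moreover have "paired_cycle p x = orbit_part w a x" for x
  proof -
    \<comment> \<open>The cycle of the negated list is the conjugate of the cycle under
      negation.\<close>
    have "bij (uminus :: int \<Rightarrow> int)" "inv (uminus :: int \<Rightarrow> int) = uminus"
      by (auto intro!: o_bij[of uminus] inv_unique_comp)
    then have "cycle_of_list (map uminus p) y = - cycle_of_list p (- y)" for y
      using conjugation_of_cycle[OF dist, of uminus] by (metis comp_apply)
    then have eq: "paired_cycle p x = cycle_of_list p (- cycle_of_list p (- x))"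
      by (simp add: paired_cycle_def)
    have cyc: "cycle_of_list p y = (if same_orbit w a y then w y else y)" for y
      unfolding p_def by (rule cycle_of_support[OF w])
    have im: "same_orbit w a (w x) \<longleftrightarrow> same_orbit w a x" "w (- x) = - w x"
      using same_orbit_image_iff[OF w] hyperoctahedralD(4)[OF w] by blast+
    consider "same_orbit w a x" "\<not> same_orbit w a (- x)" | "same_orbit w a (- x)" "\<not> same_orbit w a x"
      | "\<not> same_orbit w a x" "\<not> same_orbit w a (- x)"
      using excl by blast
    then show ?thesis
      unfolding eq cyc orbit_part_def signed_orbit_def by cases (simp_all add: im)
  qed
  moreover have "p \<noteq> []"
    using set_p same_orbit_refl[of w a] by auto
  ultimately show ?thesis
    using that set_p by blast
qed

lemma signed_orbit_image:
  assumes "w \<in> G"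
  shows "signed_orbit w a (w x) \<longleftrightarrow> signed_orbit w a x"
  using same_orbit_image_iff[OF assms, of a x] same_orbit_image_iff[OF assms, of a "- x"]
    hyperoctahedralD(4)[OF assms, of x] by (simp add: signed_orbit_def)

lemma signed_orbit_minus: "signed_orbit w a (- x) \<longleftrightarrow> signed_orbit w a x"
  by (auto simp: signed_orbit_def)

lemma orbit_part_rest:
  assumes "w \<in> G"
  shows "orbit_part w a \<circ> orbit_rest w a = w" "orbit_rest w a \<circ> orbit_part w a = w"
  using signed_orbit_image[OF assms, of a] by (auto simp: orbit_part_def orbit_rest_def)

lemma hyperoctahedral_injI:
  assumes "inj f" "\<And>x. x \<notin> X \<Longrightarrow> f x = x" "\<And>x. f (- x) = - f x"
  shows "f \<in> G"
proof -
  have "f x \<in> X" if "x \<in> X" for x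
  proof (rule ccontr)
    assume nX: "f x \<notin> X"
    then have "f (f x) = f x"
      by (rule assms(2))
    then have "f x = x"
      using assms(1) by (simp add: inj_eq)
    with nX that show False by simp
  qed
  then have "f ` X = X"
    using endo_inj_surj[OF finite_signed_points, of f] assms(1) by (simp add: image_subset_iff inj_on_subset)
  then have "y \<in> range f" for y
    using assms(2)[of y] by (cases "y \<in> X") (auto, metis rangeI)
  then have "bij f"
    using assms(1) by (auto simp: bij_def)
  then show ?thesis
    using assms(2,3) by (simp add: hyperoctahedral_iff)
qed

lemma orbit_part_hyperoctahedral:
  assumes w: "w \<in> G"
  shows "orbit_part w a \<in> G" "orbit_rest w a \<in> G"
proof -
  note hw = hyperoctahedralD[OF w]
  have im: "signed_orbit w a (w x) \<longleftrightarrow> signed_orbit w a x" for x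
    by (rule signed_orbit_image[OF w])
  have "inj (orbit_part w a)" "inj (orbit_rest w a)"
    using hw(7) im by (auto simp: orbit_part_def orbit_rest_def split: if_splits intro!: injI)
  then show "orbit_part w a \<in> G" "orbit_rest w a \<in> G"
    using hw(3,4) by (auto intro!: hyperoctahedral_injI simp: orbit_part_def orbit_rest_def signed_orbit_minus)
qed

lemma distinct_abs_append:
  assumes "distinct (map abs xs)" "distinct (map abs ys)"
    and "\<And>x. x \<in> set xs \<Longrightarrow> P x" "\<And>x. x \<in> set ys \<Longrightarrow> \<not> P x" "\<And>x :: int. P (- x) \<longleftrightarrow> P x"
  shows "distinct (map abs (xs @ ys))"
proof -
  have "\<bar>x\<bar> \<noteq> \<bar>y\<bar>" if "x \<in> set xs" "y \<in> set ys" for x y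
    using assms(3)[OF that(1)] assms(4)[OF that(2)] assms(5)[of x] by (auto simp: abs_eq_iff)
  then show ?thesis
    using assms(1,2) by (auto simp: image_iff)
qed

text \<open>The old entries are moved by \<open>orbit_rest w a\<close>, hence lie off the signed
  orbit of \<open>a\<close>. Both orders of composing part and rest give \<open>w\<close>, so a
  balanced cycle can go to the front and a paired one to the end.\<close>

lemma cycle_decomposition_extend:
  assumes w: "w \<in> G" and a: "a \<in> X"
    and rest: "cycle_decomposition n (orbit_rest w a) bs ps"
      "set (concat (bs @ ps)) \<subseteq> {x. orbit_rest w a x \<noteq> x}"
    and b: "b \<noteq> []" "set b \<subseteq> {x. same_orbit w a x}" "distinct (map abs b)"
  shows "balanced_cycle b = orbit_part w a \<Longrightarrow> cycle_decomposition n w (b # bs) ps"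
    and "paired_cycle b = orbit_part w a \<Longrightarrow> cycle_decomposition n w bs (ps @ [b])"
proof -
  have out: "\<not> signed_orbit w a x" if "x \<in> set (concat (bs @ ps))" for x
    using rest(2) that by (auto simp: orbit_rest_def split: if_splits)
  have "signed_orbit w a x" if "x \<in> set b" for x
    using b(2) that by (auto simp: signed_orbit_def)
  then have dist: "distinct (map abs (b @ concat (bs @ ps)))"
    using rest(1) b(3) out signed_orbit_minus unfolding cycle_decomposition_def
    by (intro distinct_abs_append[where P = "signed_orbit w a"]) blast+
  have bX: "set b \<subseteq> X"
    using b(2) same_orbit_signed[OF w _ a] by blast
  show "cycle_decomposition n w (b # bs) ps" if "balanced_cycle b = orbit_part w a"
    using rest(1) b(1) bX dist orbit_part_rest(1)[OF w, of a] that
    unfolding cycle_decomposition_def by simp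
  have "concat (bs @ ps @ [b]) = concat (bs @ ps) @ b"
    by simp
  then have "distinct (map abs (concat (bs @ ps @ [b])))"
    using dist unfolding map_append distinct_append by (simp only: map_append distinct_append) blast
  then show "cycle_decomposition n w bs (ps @ [b])" if "paired_cycle b = orbit_part w a"
    using rest(1) b(1) bX orbit_part_rest(2)[OF w, of a] that
    unfolding cycle_decomposition_def by (simp add: comp_assoc)
qed

text \<open>The bound on the entries strengthens the induction: it keeps the lists of the rest
  disjoint from the cycle that is added.\<close>

lemma cycle_decomposition_exists:
  "w \<in> G \<Longrightarrow> \<exists>bs ps. cycle_decomposition n w bs ps \<and> set (concat (bs @ ps)) \<subseteq> {x. w x \<noteq> x}"
proof (induction "card {x. w x \<noteq> x}" arbitrary: w rule: less_induct)
  case less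
  note w = less.prems
  note hw = hyperoctahedralD[OF w]
  show ?case
  proof (cases "\<exists>a. w a \<noteq> a")
    case False
    then have "w = id" by auto
    then show ?thesis
      by (intro exI[of _ "[]"]) (simp add: cycle_decomposition_def)
  next
    case True
    then obtain a where a: "w a \<noteq> a" by blast
    then have aX: "a \<in> X"
      using hw(3) by blast
    let ?v = "orbit_rest w a"
    have sub: "{x. ?v x \<noteq> x} \<subseteq> {x. w x \<noteq> x}"
      by (auto simp: orbit_rest_def)
    have "signed_orbit w a a"
      using same_orbit_refl by (simp add: signed_orbit_def)
    then have "{x. ?v x \<noteq> x} \<subset> {x. w x \<noteq> x}"
      using sub a by (auto simp: orbit_rest_def)
    moreover have "finite {x. w x \<noteq> x}"
      using hw(3) by (intro finite_subset[OF _ finite_signed_points]) blast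
    ultimately have "card {x. ?v x \<noteq> x} < card {x. w x \<noteq> x}"
      by (intro psubset_card_mono)
    then obtain bs ps where rest: "cycle_decomposition n ?v bs ps" "set (concat (bs @ ps)) \<subseteq> {x. ?v x \<noteq> x}"
      using less.hyps[OF _ orbit_part_hyperoctahedral(2)[OF w]] by blast
    have moved: "same_orbit w a x \<Longrightarrow> w x \<noteq> x" for x
    proof
      assume "same_orbit w a x" "w x = x"
      moreover from this(2) have "(w y = x) = (y = x)" for y
        using hw(7)[of y x] by simp
      ultimately have "(x = x) = (a = x)"
        by (intro same_orbit_invariant[of "\<lambda>y. y = x" w a x])
      with \<open>w x = x\<close> a show False by simp
    qed
    show ?thesis
    proof (cases "same_orbit w a (- a)")
      case True
      obtain b where b: "b \<noteq> []" "set b \<subseteq> {x. same_orbit w a x}" "distinct (map abs b)"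
        "balanced_cycle b = orbit_part w a"
        using balanced_orbit_list[OF w aX True] .
      have "cycle_decomposition n w (b # bs) ps"
        by (rule cycle_decomposition_extend(1)[OF w aX rest b])
      moreover have "set (concat ((b # bs) @ ps)) \<subseteq> {x. w x \<noteq> x}"
        using rest(2) sub b(2) moved by auto
      ultimately show ?thesis by blast
    next
      case False
      obtain p where p: "p \<noteq> []" "set p \<subseteq> {x. same_orbit w a x}" "distinct (map abs p)"
        "paired_cycle p = orbit_part w a"
        using paired_orbit_list[OF w aX False] .
      have "cycle_decomposition n w bs (ps @ [p])"
        by (rule cycle_decomposition_extend(2)[OF w aX rest p])
      moreover have "set (concat (bs @ ps @ [p])) \<subseteq> {x. w x \<noteq> x}"
        using rest(2) sub p(2) moved by auto
      ultimately show ?thesis by blast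
    qed
  qed
qed

lemma orbit_part_in_balanced_cycles:
  assumes w: "w \<in> G" and a: "a \<in> X" "same_orbit w a (- a)"
  shows "orbit_part w a \<in> balanced_cycles n w"
proof -
  obtain bs ps where rest: "cycle_decomposition n (orbit_rest w a) bs ps"
    "set (concat (bs @ ps)) \<subseteq> {x. orbit_rest w a x \<noteq> x}"
    using cycle_decomposition_exists[OF orbit_part_hyperoctahedral(2)[OF w]] by blast
  obtain b where b: "b \<noteq> []" "set b \<subseteq> {x. same_orbit w a x}" "distinct (map abs b)"
    "balanced_cycle b = orbit_part w a"
    using balanced_orbit_list[OF w a] .
  have "cycle_decomposition n w (b # bs) ps"
    by (rule cycle_decomposition_extend(1)[OF w a(1) rest b])
  then show ?thesis
    unfolding balanced_cycles_def b(4)[symmetric] by fastforce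
qed

lemma cycle_of_list_funpow:
  assumes "distinct L" "m < length L"
  shows "(cycle_of_list L ^^ m) (hd L) = L ! m"
proof -
  have "L \<noteq> []" using assms by auto
  then have "hd L = L ! 0"
    by (rule hd_conv_nth)
  then have "(cycle_of_list L ^^ m) (hd L) = map (cycle_of_list L ^^ m) L ! 0"
    using \<open>L \<noteq> []\<close> by simp
  also have "\<dots> = rotate m L ! 0"
    unfolding cyclic_rotation[OF assms(1)] ..
  also have "\<dots> = L ! m"
    using assms(2) \<open>L \<noteq> []\<close> by (simp add: nth_rotate)
  finally show ?thesis .
qed

text \<open>The other lists have other absolute values, so on the entries of \<open>b\<close> and
  their negatives \<open>w\<close> acts as \<open>balanced_cycle b\<close>, and these form one
  orbit. Hence balanced cycles do not depend on the decomposition.\<close>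

lemma balanced_cycle_is_orbit_part:
  assumes dec: "cycle_decomposition n w bs ps" and b: "b \<in> set bs"
  shows "hd b \<in> X" "same_orbit w (hd b) (- hd b)" "balanced_cycle b = orbit_part w (hd b)"
proof -
  define L where "L = b @ map uminus b"
  define a where "a = hd b"
  have dec': "[] \<notin> set (bs @ ps)" "set (concat (bs @ ps)) \<subseteq> X" "distinct (map abs (concat (bs @ ps)))"
    "w = product (map balanced_cycle bs @ map paired_cycle ps)"
    using dec by (auto simp: cycle_decomposition_def)
  obtain bs\<^sub>1 bs\<^sub>2 where bs: "bs = bs\<^sub>1 @ b # bs\<^sub>2"
    using split_list[OF b] by blast
  have bne: "b \<noteq> []"
    using dec'(1) b by auto
  have bX: "set b \<subseteq> X"
    using dec'(2) b by auto
  have "0 \<notin> set b"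
    using bX nonzero_signed_points by blast
  moreover have "distinct (map abs b)"
    using dec'(3) unfolding bs by simp
  ultimately have dist: "distinct L"
    unfolding L_def using distinct_append_uminus_iff by blast
  have disj: "abs ` set c \<inter> abs ` set b = {}" if "c \<in> set bs\<^sub>1 \<union> set bs\<^sub>2 \<union> set ps" for c
  proof -
    let ?U = "abs ` \<Union> (set ` set bs\<^sub>1) \<union> abs ` \<Union> (set ` set bs\<^sub>2) \<union> abs ` \<Union> (set ` set ps)"
    have "?U \<inter> abs ` set b = {}"
      using dec'(3)[unfolded bs, simplified] by (simp only: Int_Un_distrib Int_Un_distrib2 Int_commute Un_empty)
    moreover have "abs ` set c \<subseteq> ?U"
      using that by auto
    moreover have "A \<inter> B = {}" if "U \<inter> B = {}" "A \<subseteq> U" for A B U :: "int set"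
      using that by blast
    ultimately show ?thesis by metis
  qed
  have abs_L: "\<bar>x\<bar> \<in> abs ` set b" if "x \<in> set L" for x
    using that unfolding L_def by auto
  have w_L: "w x = cycle_of_list L x" if x: "x \<in> set L" for x
  proof -
    have fix_bal: "balanced_cycle c y = y" if "c \<in> set bs\<^sub>1 \<union> set bs\<^sub>2" "y \<in> set L" for c y
      using disj[of c] abs_L[OF that(2)] that(1) by (intro balanced_cycle_fixes) blast
    have fix_pair: "paired_cycle c y = y" if "c \<in> set ps" "y \<in> set L" for c y
      using disj[of c] abs_L[OF that(2)] that(1) by (intro paired_cycle_fixes) blast
    have 1: "product (map balanced_cycle bs\<^sub>2 @ map paired_cycle ps) x = x"
      using fix_bal fix_pair x by (intro product_fixes) auto
    have "cycle_of_list L x \<in> set L"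
      using x cycle_permutes[of L] by (simp add: permutes_in_image)
    then have 2: "product (map balanced_cycle bs\<^sub>1) (cycle_of_list L x) = cycle_of_list L x"
      using fix_bal by (intro product_fixes) auto
    have "w = product (map balanced_cycle bs\<^sub>1) \<circ>
        (balanced_cycle b \<circ> product (map balanced_cycle bs\<^sub>2 @ map paired_cycle ps))"
      unfolding dec'(4) bs by (simp add: comp_assoc)
    then have "w x = product (map balanced_cycle bs\<^sub>1)
        (balanced_cycle b (product (map balanced_cycle bs\<^sub>2 @ map paired_cycle ps) x))"
      by (simp only: comp_apply)
    then show ?thesis
      unfolding 1 unfolding balanced_cycle_def L_def[symmetric] 2 .
  qed
  have aL: "a \<in> set L" "hd L = a" "- a \<in> set L"
    using bne by (simp_all add: a_def L_def)
  have in_L: "(w ^^ m) a \<in> set L \<and> (w ^^ m) a = (cycle_of_list L ^^ m) a" for m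
  proof (induction m)
    case (Suc m)
    then have IH: "(w ^^ m) a \<in> set L" "(cycle_of_list L ^^ m) a = (w ^^ m) a"
      by metis+
    have step: "(w ^^ Suc m) a = cycle_of_list L ((w ^^ m) a)"
      using w_L[OF IH(1)] by simp
    show ?case
      unfolding step using IH permutes_in_image[OF cycle_permutes[of L]] by simp
  qed (use aL in simp)
  have orb: "same_orbit w a x \<longleftrightarrow> x \<in> set L" for x
  proof
    assume "x \<in> set L"
    then obtain m where "m < length L" "L ! m = x"
      by (auto simp: in_set_conv_nth)
    then have "(w ^^ m) a = x"
      using in_L[of m] cycle_of_list_funpow[OF dist, of m] aL by simp
    then show "same_orbit w a x"
      by (auto simp: same_orbit_def)
  next
    assume "same_orbit w a x"
    then obtain m where "(w ^^ m) a = x"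
      unfolding same_orbit_def by blast
    with in_L[of m] show "x \<in> set L" by metis
  qed
  have L_minus: "- x \<in> set L \<longleftrightarrow> x \<in> set L" for x
    unfolding L_def by (auto simp: image_iff) (metis add.inverse_inverse)+
  show "hd b \<in> X"
    using bX bne by auto
  show "same_orbit w (hd b) (- hd b)"
    using orb aL by (simp flip: a_def)
  show "balanced_cycle b = orbit_part w (hd b)"
    unfolding a_def[symmetric] balanced_cycle_def L_def[symmetric]
    using w_L by (auto simp: orbit_part_def signed_orbit_def orb L_minus id_outside_supp)
qed

lemma balanced_cycles_eq:
  assumes w: "w \<in> G"
  shows "balanced_cycles n w = {orbit_part w a | a. a \<in> X \<and> same_orbit w a (- a)}"
proof (intro equalityI subsetI)
  fix c assume "c \<in> balanced_cycles n w"
  then obtain b bs ps where "c = balanced_cycle b" "cycle_decomposition n w bs ps" "b \<in> set bs"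
    unfolding balanced_cycles_def by blast
  with balanced_cycle_is_orbit_part[of w bs ps b]
  show "c \<in> {orbit_part w a | a. a \<in> X \<and> same_orbit w a (- a)}"
    by blast
qed (use orbit_part_in_balanced_cycles[OF w] in blast)

lemma abs_length_orbit_part:
  assumes w: "w \<in> G" and a: "a \<in> X" "same_orbit w a (- a)"
  shows "1 \<le> len (orbit_part w a)" "len (orbit_part w a) = 1 \<longleftrightarrow> w a = - a"
proof -
  note hw = hyperoctahedralD[OF w]
  define r where "r = orbit_part w a"
  have rG: "r \<in> G"
    unfolding r_def by (rule orbit_part_hyperoctahedral(1)[OF w])
  have nz: "a \<noteq> 0" "a \<noteq> - a" "- a \<in> X"
    using a(1) nonzero_signed_points[of a] by auto
  have "eqv w a (- a)"
    using same_orbit_imp_eqv[OF a(2)] .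
  then have wa: "w a \<noteq> a"
    using balanced_not_fixed[OF w a(1)] by blast
  have ra: "r a = w a"
    using same_orbit_refl by (simp add: r_def orbit_part_def signed_orbit_def)
  have "r \<noteq> id"
    using ra wa by auto
  then have "len r \<noteq> 0"
    using abs_length_0[OF rG] by blast
  then show "1 \<le> len (orbit_part w a)"
    by (simp flip: r_def)
  show "len (orbit_part w a) = 1 \<longleftrightarrow> w a = - a"
    unfolding r_def[symmetric]
  proof
    assume "len r = 1"
    then obtain i j v where ij: "i \<in> X" "j \<in> X" "i \<noteq> j" "v \<in> G" "r = sswap i j \<circ> v" "len r = Suc (len v)"
      using abs_length_step[OF rG \<open>r \<noteq> id\<close>] by metis
    then have "v = id"
      using abs_length_0[OF ij(4)] \<open>len r = 1\<close> by simp
    \<comment> \<open>Being a reflection, \<open>r\<close> is an involution, so the orbit of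
      \<open>a\<close> is \<open>{a, w a}\<close>; it contains \<open>- a\<close>.\<close>
    then have "r (r a) = a"
      using ij nonzero_signed_points by auto
    moreover have "r (w a) = w (w a)"
      using same_orbit_image[of w a] by (simp add: r_def orbit_part_def signed_orbit_def)
    ultimately have wwa: "w (w a) = a"
      using ra by simp
    have "(w y = a \<or> w y = w a) = (y = a \<or> y = w a)" for y
      using hw(7)[of y a] hw(7)[of y "w a"] wwa by auto
    from same_orbit_invariant[of "\<lambda>y. y = a \<or> y = w a", OF this a(2)] show "w a = - a"
      using nz by auto
  next
    assume wa': "w a = - a"
    then have wma: "w (- a) = a"
      using hw(4)[of a] by simp
    have "(w y = a \<or> w y = - a) = (y = a \<or> y = - a)" for y
      using hw(7)[of y a] hw(7)[of y "- a"] wa' wma by auto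
    then have "same_orbit w a y \<Longrightarrow> y = a \<or> y = - a" for y
      using same_orbit_invariant[of "\<lambda>y. y = a \<or> y = - a" w a y] by simp
    then have "signed_orbit w a y \<longleftrightarrow> y = a \<or> y = - a" for y
      using a(2) same_orbit_refl[of w a] unfolding signed_orbit_def by force
    then have "r = sswap a (- a)"
      using wa' wma nz by (auto simp: r_def orbit_part_def sswap_def fun_eq_iff)
    then show "len r = 1"
      using abs_length_sswap_eq[OF a(1) nz(3,2)] by simp
  qed
qed

section \<open>The partition \<open>mu\<close>\<close>

lemma orbit_part_eq:
  assumes w: "w \<in> G" and "same_orbit w a b"
  shows "orbit_part w a = orbit_part w b"
proof -
  have "same_orbit w a x \<longleftrightarrow> same_orbit w b x" for x
    using assms same_orbit_sym[OF w] same_orbit_trans by blast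
  then show ?thesis
    by (simp add: orbit_part_def signed_orbit_def fun_eq_iff)
qed

lemma hook_partition_mu_iff:
  assumes w: "w \<in> G"
  shows "hook_partition (mu n w) \<longleftrightarrow> hook w"
proof -
  let ?B = "balanced_cycles n w"
  let ?big = "{c \<in> ?B. len c \<noteq> 1}"
  note B = balanced_cycles_eq[OF w]
  have fin: "finite ?big"
    using finite_balanced_cycles[of n w] by simp
  have "\<forall>x\<in>#image_mset len (mset_set ?B). 1 \<le> x"
    using abs_length_orbit_part(1)[OF w] finite_balanced_cycles[of n w] unfolding B by auto
  then have "hook_partition (mu n w) \<longleftrightarrow> size (filter_mset (\<lambda>x. x \<noteq> 1) (image_mset len (mset_set ?B))) \<le> 1"
    unfolding mu_def by (rule hook_partition_sorted_iff)
  also have "size (filter_mset (\<lambda>x. x \<noteq> 1) (image_mset len (mset_set ?B))) = card ?big"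
    using finite_balanced_cycles[of n w] by (simp add: filter_mset_image_mset filter_mset_mset_set)
  also have "card ?big \<le> 1 \<longleftrightarrow> (\<forall>c\<in>?big. \<forall>c'\<in>?big. c = c')"
    using card_le_Suc0_iff_eq[OF fin] by simp
  also have "\<dots> \<longleftrightarrow> hook w"
  proof
    assume eq: "\<forall>c\<in>?big. \<forall>c'\<in>?big. c = c'"
    show "hook w"
      unfolding hook_def
    proof (intro ballI impI)
      fix a b assume a: "a \<in> X" "eqv w a (- a)" "w a \<noteq> - a" and b: "b \<in> X" "eqv w b (- b)" "w b \<noteq> - b"
      have so: "same_orbit w a (- a)" "same_orbit w b (- b)"
        using a b balanced_iff_same_orbit[OF w] by blast+
      then have "orbit_part w a \<in> ?big" "orbit_part w b \<in> ?big"
        using a b abs_length_orbit_part(2)[OF w] unfolding B by blast+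
      then have "orbit_part w a = orbit_part w b"
        using eq by blast
      \<comment> \<open>Since \<open>w b \<noteq> b\<close>, \<open>orbit_part w a\<close> moves
        \<open>b\<close>, which places \<open>b\<close> in the orbit of \<open>a\<close> up to sign;
        a balanced orbit contains both signs.\<close>
      then have "orbit_part w a b = w b"
        using same_orbit_refl[of w b] by (simp add: orbit_part_def signed_orbit_def)
      then have "signed_orbit w a b"
        using balanced_not_fixed[OF w b(1,2)] by (auto simp: orbit_part_def split: if_splits)
      then show "same_orbit w a b"
        using so(1) same_orbit_minus[OF w, of a "- b"] same_orbit_trans[of w a "- a" b]
        by (auto simp: signed_orbit_def)
    qed
  next
    assume hook: "hook w"
    show "\<forall>c\<in>?big. \<forall>c'\<in>?big. c = c'"
    proof (intro ballI)
      fix c c' assume "c \<in> ?big" "c' \<in> ?big"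
      then obtain a b where a: "a \<in> X" "same_orbit w a (- a)" "c = orbit_part w a" "len c \<noteq> 1"
        and b: "b \<in> X" "same_orbit w b (- b)" "c' = orbit_part w b" "len c' \<noteq> 1"
        unfolding B by blast
      have "w a \<noteq> - a" "w b \<noteq> - b"
        using a b abs_length_orbit_part(2)[OF w] by blast+
      then have "same_orbit w a b"
        using hook a(1,2) b(1,2) same_orbit_imp_eqv unfolding hook_def by blast
      then show "c = c'"
        using orbit_part_eq[OF w] a(3) b(3) by blast
    qed
  qed
  finally show ?thesis .
qed

end

theorem theorem5p1:
  fixes n :: nat and w :: "int \<Rightarrow> int"
  assumes "w \<in> hyperoctahedral n"
  shows "Lattice.lattice (interval_poset n w) \<longleftrightarrow> hook_partition (mu n w)"
proof -
  interpret signed_permutations n .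
  show ?thesis
    unfolding lattice_iff_hook[OF assms] hook_partition_mu_iff[OF assms] ..
qed

end
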